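(* Let $E$ be an lcHs over $\mathbb{K}$ and let $(T^{E}_{m},T^{\mathbb{K}}_{m})_{m\in M}$ be a strong, consistent generator for $(\mathcal{FV},E)$. If (i) $\mathcal{FV}(\Omega)$ is a semi-Montel space and $E$ is complete, or (ii) $\mathcal{FV}(\Omega)$ is a Fréchet–Schwartz space and $E$ is locally complete, or (iii) $E$ is a semi-Montel space, or (iv) for every $f\in\mathcal{FV}(\Omega,E)$, $j\in J$, $m\in M$ there is an absolutely convex compact set $K\subset E$ with $N_{j,m}(f)\subset K$, then $\mathcal{FV}(\Omega)$ and $\mathcal{FV}(\Omega,E)$ are $\varepsilon$-compatible; in particular, $\mathcal{FV}(\Omega,E)\cong\mathcal{FV}(\Omega)\varepsilon E$.
   Context: $\mathbb{K}=\mathbb{R}$ or $\mathbb{C}$. An lcHs is a non-trivial locally convex Hausdorff space over $\mathbb{K}$; the topology of $E$ is given by a directed system of seminorms $(p_{\alpha})_{\alpha\in\mathfrak{A}}$ (for $E=\mathbb{K}$ it is $\{|\cdot|\}$). For an lcHs $F$, $F'_{\kappa}$ is $F'$ with the topology of uniform convergence on absolutely convex compact subsets of $F$, and $F\varepsilon E:=L_{e}(F'_{\kappa},E)$ carries the topology of uniform convergence on equicontinuous subsets of $F'$. $\cong$ means linearly topologically isomorphic. $\delta_x(f):=f(x)$. $\mathcal{F}(\Omega)$ and $\mathcal{F}(\Omega,E)$ are $\varepsilon$-compatible if $S\colon\mathcal{F}(\Omega)\varepsilon E\to\mathcal{F}(\Omega,E)$, $u\mapsto[x\mapsto u(\delta_x)]$,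 is a well-defined (topological) isomorphism. $E$ is locally complete if for every closed bounded absolutely convex $D\subset E$ the space $E_D:=\bigcup_n nD$, normed by the gauge of $D$, is a Banach space. Semi-Montel: every bounded set is relatively compact. Weighted spaces: Let $\Omega$, $J$, $M$ be non-empty sets, $(\omega_m)_{m\in M}$ non-empty sets, and $\mathcal{V}=(\nu_{j,m})_{j\in J,m\in M}$ weight functions, i.e. $\nu_{j,m}\colon\omega_m\to[0,\infty)$ and for all $m\in M$, $x\in\omega_m$ there is $j\in J$ with $\nu_{j,m}(x)>0$. For $Y\in\{\mathbb{K},E\}$ let $T^{Y}_m\colon Y^{\Omega}\supset\operatorname{dom}T^{Y}_m\to Y^{\omega_m}$ be linear, $\operatorname{AP}(\Omega,Y)$ a linear subspace of $Y^{\Omega}$, $F(\Omega,Y):=\operatorname{AP}(\Omega,Y)\cap\bigcap_{m}\operatorname{dom}T^{Y}_m$ and \[ \mathcal{FV}(\Omega,Y):=\{f\in F(\Omega,Y)\;|\;\forall j,m,\alpha:\ |f|_{j,m,\alpha}:=\sup_{x\in\omega_m}p_\alpha(T^{Y}_m(f)(x))\nu_{j,m}(x)<\infty\} \] with these seminorms; $F(\Omega):=F(\Omega,\mathbb{K})$, $\mathcal{FV}(\Omega):=\mathcal{FV}(\Omega,\mathbb{K})$. It is a dom-space if it is Hausdorff, the system of seminorms is directed and, if $Y=\mathbb{K}$, all $\delta_x$, $x\in\Omega$, are continuous. $T^{\mathbb{K}}_{m,x}(f):=T^{\mathbb{K}}_m(f)(x)$ (an element of $\mathcal{FV}(\Omega)'$).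 $N_{j,m}(f):=\{T^{E}_m(f)(x)\nu_{j,m}(x)\;|\;x\in\omega_m\}$. $(T^{E}_m,T^{\mathbb{K}}_m)_{m\in M}$ is a generator for $(\mathcal{FV},E)$ if $\mathcal{FV}(\Omega)$ and $\mathcal{FV}(\Omega,E)$ (built with the same $M,J,\omega_m,\mathcal{V}$) are dom-spaces. It is consistent if for all $u\in\mathcal{FV}(\Omega)\varepsilon E$: $S(u)\in F(\Omega,E)$ and $(T^{E}_mS(u))(x)=u(T^{\mathbb{K}}_{m,x})$ for all $m\in M,x\in\omega_m$. It is strong if for all $e'\in E'$, $f\in\mathcal{FV}(\Omega,E)$: $e'\circ f\in F(\Omega)$ and $T^{\mathbb{K}}_m(e'\circ f)(x)=e'(T^{E}_m(f)(x))$ for all $m\in M$, $x\in\omega_m$. *)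

theory Defs
  imports "HOL-Analysis.Analysis" "HOL-Library.Function_Algebras"
begin

section \<open>The scalar field\<close>

text \<open>
  The types of this class are exactly the copies of the normed fields of real and of complex
  numbers: in the second alternative \<open>i\<close> is the imaginary unit and the norm is the usual modulus.
\<close>

class real_or_complex = real_normed_field +
  assumes real_or_complex:
    "(\<forall>z. \<exists>a. z = a *\<^sub>R 1) \<or>
     (\<exists>i. i * i = - 1 \<and>
        (\<forall>z. \<exists>a b. z = a *\<^sub>R 1 + b *\<^sub>R i \<and> norm z = sqrt (a\<^sup>2 + b\<^sup>2)))"

instance real :: real_or_complex
proof
  have "z = z *\<^sub>R 1" for z :: real
    by simp
  then show "(\<forall>z::real. \<exists>a. z = a *\<^sub>R 1) \<or>
     (\<exists>i::real. i * i = - 1 \<and>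
        (\<forall>z. \<exists>a b. z = a *\<^sub>R 1 + b *\<^sub>R i \<and> norm z = sqrt (a\<^sup>2 + b\<^sup>2)))"
    by blast
qed

instance complex :: real_or_complex
proof
  have "z = Re z *\<^sub>R 1 + Im z *\<^sub>R \<i> \<and> norm z = sqrt ((Re z)\<^sup>2 + (Im z)\<^sup>2)" for z
    by (simp add: complex_eq_iff cmod_def)
  then show "(\<forall>z::complex. \<exists>a. z = a *\<^sub>R 1) \<or>
     (\<exists>i::complex. i * i = - 1 \<and>
        (\<forall>z. \<exists>a b. z = a *\<^sub>R 1 + b *\<^sub>R i \<and> norm z = sqrt (a\<^sup>2 + b\<^sup>2)))"
    using i_squared by blast
qed


section \<open>Spaces topologised by a system of seminorms\<close>

text \<open>
  A space is a linear subspace \<open>carrier X\<close> of an ambient vector space (the whole type, with scalar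
  multiplication \<open>scale X\<close>) together with a system of seminorms, relevant only on the carrier.
\<close>

record ('k, 'v) lcs =
  carrier :: "'v set"
  scale :: "'k \<Rightarrow> 'v \<Rightarrow> 'v"
  seminorms :: "('v \<Rightarrow> real) set"

definition lcs_topology :: "('k, 'v::ab_group_add) lcs \<Rightarrow> 'v topology" where
  "lcs_topology X = topology (\<lambda>U. U \<subseteq> carrier X \<and>
     (\<forall>x\<in>U. \<exists>P e. finite P \<and> P \<subseteq> seminorms X \<and> 0 < e \<and>
        {y \<in> carrier X. \<forall>p\<in>P. p (y - x) < e} \<subseteq> U))"

lemma openin_lcs_topology:
  "openin (lcs_topology X) U \<longleftrightarrow> U \<subseteq> carrier X \<and>
     (\<forall>x\<in>U. \<exists>P e. finite P \<and> P \<subseteq> seminorms X \<and> 0 < e \<and>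
        {y \<in> carrier X. \<forall>p\<in>P. p (y - x) < e} \<subseteq> U)"
proof -
  define L where "L U \<longleftrightarrow> U \<subseteq> carrier X \<and>
     (\<forall>x\<in>U. \<exists>P e. finite P \<and> P \<subseteq> seminorms X \<and> 0 < e \<and>
        {y \<in> carrier X. \<forall>p\<in>P. p (y - x) < e} \<subseteq> U)" for U
  have inter: "L (S \<inter> T)" if S: "L S" and T: "L T" for S T
    unfolding L_def
  proof (intro conjI ballI)
    show "S \<inter> T \<subseteq> carrier X"
      using S by (auto simp: L_def)
    fix x assume x: "x \<in> S \<inter> T"
    obtain P d where P: "finite P" "P \<subseteq> seminorms X" "0 < d"
        "{y \<in> carrier X. \<forall>p\<in>P. p (y - x) < d} \<subseteq> S"
      using S x unfolding L_def by blast
    obtain Q e where Q: "finite Q" "Q \<subseteq> seminorms X" "0 < e"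
        "{y \<in> carrier X. \<forall>p\<in>Q. p (y - x) < e} \<subseteq> T"
      using T x unfolding L_def by blast
    have "{y \<in> carrier X. \<forall>p\<in>P \<union> Q. p (y - x) < min d e} \<subseteq> S \<inter> T"
      using P(4) Q(4) by auto
    then show "\<exists>P e. finite P \<and> P \<subseteq> seminorms X \<and> 0 < e \<and>
        {y \<in> carrier X. \<forall>p\<in>P. p (y - x) < e} \<subseteq> S \<inter> T"
      using P Q by (intro exI[of _ "P \<union> Q"] exI[of _ "min d e"]) auto
  qed
  have union: "L (\<Union> K)" if "\<forall>S\<in>K. L S" for K
    unfolding L_def
  proof (intro conjI ballI)
    show "\<Union> K \<subseteq> carrier X"
      using that by (auto simp: L_def)
    fix x assume "x \<in> \<Union> K"
    then obtain S where S: "S \<in> K" "x \<in> S" by blast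
    have "L S"
      using that S(1) by (rule bspec)
    then obtain P e where "finite P \<and> P \<subseteq> seminorms X \<and> 0 < e \<and>
        {y \<in> carrier X. \<forall>p\<in>P. p (y - x) < e} \<subseteq> S"
      using S(2) unfolding L_def by blast
    then show "\<exists>P e. finite P \<and> P \<subseteq> seminorms X \<and> 0 < e \<and>
        {y \<in> carrier X. \<forall>p\<in>P. p (y - x) < e} \<subseteq> \<Union> K"
      using S(1) by (meson Union_upper order_trans)
  qed
  have "istopology L"
    unfolding istopology_def using inter union by blast
  then show ?thesis
    unfolding lcs_topology_def L_def[abs_def] by (simp only: topology_inverse')
qed

lemma topspace_lcs_topology [simp]: "topspace (lcs_topology X) = carrier X"
proof
  show "topspace (lcs_topology X) \<subseteq> carrier X"
    using openin_topspace[of "lcs_topology X"] unfolding openin_lcs_topology by blast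
  have "openin (lcs_topology X) (carrier X)"
    unfolding openin_lcs_topology by (auto intro!: exI[of _ "{}"] exI[of _ "1::real"])
  then show "carrier X \<subseteq> topspace (lcs_topology X)"
    by (rule openin_subset)
qed

definition seminorm_on :: "'v set \<Rightarrow> ('k::real_or_complex \<Rightarrow> 'v \<Rightarrow> 'v) \<Rightarrow> ('v::ab_group_add \<Rightarrow> real) \<Rightarrow> bool" where
  "seminorm_on V s p \<longleftrightarrow>
     (\<forall>x\<in>V. \<forall>y\<in>V. p (x + y) \<le> p x + p y) \<and> (\<forall>c. \<forall>x\<in>V. p (s c x) = norm c * p x)"

definition directed_system :: "('k, 'v) lcs \<Rightarrow> bool" where
  "directed_system X \<longleftrightarrow> seminorms X \<noteq> {} \<and>
     (\<forall>p\<in>seminorms X. \<forall>q\<in>seminorms X. \<exists>r\<in>seminorms X. \<exists>C>0.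
        \<forall>x\<in>carrier X. p x \<le> C * r x \<and> q x \<le> C * r x)"

definition lcHs :: "('k::real_or_complex, 'v::ab_group_add) lcs \<Rightarrow> bool" where
  "lcHs X \<longleftrightarrow> vector_space (scale X) \<and> module.subspace (scale X) (carrier X) \<and>
     carrier X \<noteq> {0} \<and>
     (\<forall>p\<in>seminorms X. seminorm_on (carrier X) (scale X) p) \<and>
     directed_system X \<and> Hausdorff_space (lcs_topology X)"

definition scalars :: "('k::real_or_complex, 'k) lcs" where
  "scalars = \<lparr>carrier = UNIV, scale = (*), seminorms = {norm}\<rparr>"

definition linear_on :: "'v set \<Rightarrow> ('k \<Rightarrow> 'v \<Rightarrow> 'v) \<Rightarrow> ('k \<Rightarrow> 'w \<Rightarrow> 'w) \<Rightarrow>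
    ('v::ab_group_add \<Rightarrow> 'w::ab_group_add) \<Rightarrow> bool" where
  "linear_on V s t f \<longleftrightarrow>
     (\<forall>x\<in>V. \<forall>y\<in>V. f (x + y) = f x + f y) \<and> (\<forall>c. \<forall>x\<in>V. f (s c x) = t c (f x))"

definition lcs_isomorphism :: "('k, 'v::ab_group_add) lcs \<Rightarrow> ('k, 'w::ab_group_add) lcs \<Rightarrow> ('v \<Rightarrow> 'w) \<Rightarrow> bool" where
  "lcs_isomorphism X Y f \<longleftrightarrow> linear_on (carrier X) (scale X) (scale Y) f \<and>
     homeomorphic_map (lcs_topology X) (lcs_topology Y) f"

definition lcs_isomorphic :: "('k, 'v::ab_group_add) lcs \<Rightarrow> ('k, 'w::ab_group_add) lcs \<Rightarrow> bool" where
  "lcs_isomorphic X Y \<longleftrightarrow> (\<exists>f. lcs_isomorphism X Y f)"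

text \<open>
  Maps are total functions in HOL; a map defined on the carrier is represented by its
  extension by zero, so that equality of maps means equality on the carrier.
\<close>

definition ext0 :: "'v set \<Rightarrow> ('v \<Rightarrow> 'w::zero) \<Rightarrow> 'v \<Rightarrow> 'w" where
  "ext0 V f x = (if x \<in> V then f x else 0)"

definition continuous_linear_maps ::
    "('k, 'v::ab_group_add) lcs \<Rightarrow> ('k, 'w::ab_group_add) lcs \<Rightarrow> ('v \<Rightarrow> 'w) set" where
  "continuous_linear_maps X Y = {u. linear_on (carrier X) (scale X) (scale Y) u \<and>
     continuous_map (lcs_topology X) (lcs_topology Y) u \<and> (\<forall>x. x \<notin> carrier X \<longrightarrow> u x = 0)}"

definition dual :: "('k::real_or_complex, 'v::ab_group_add) lcs \<Rightarrow> ('v \<Rightarrow> 'k) set" where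
  "dual X = continuous_linear_maps X scalars"

definition pointwise_scale :: "('k \<Rightarrow> 'w \<Rightarrow> 'w) \<Rightarrow> 'k \<Rightarrow> ('v \<Rightarrow> 'w) \<Rightarrow> 'v \<Rightarrow> 'w" where
  "pointwise_scale s c f = (\<lambda>x. s c (f x))"


section \<open>Properties of spaces and of their subsets\<close>

definition absolutely_convex :: "('k::real_or_complex, 'v::ab_group_add) lcs \<Rightarrow> 'v set \<Rightarrow> bool" where
  "absolutely_convex X D \<longleftrightarrow> D \<subseteq> carrier X \<and> D \<noteq> {} \<and>
     (\<forall>x\<in>D. \<forall>y\<in>D. \<forall>a b. norm a + norm b \<le> 1 \<longrightarrow> scale X a x + scale X b y \<in> D)"

definition bounded_in :: "('k, 'v) lcs \<Rightarrow> 'v set \<Rightarrow> bool" where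
  "bounded_in X B \<longleftrightarrow> B \<subseteq> carrier X \<and> (\<forall>p\<in>seminorms X. bdd_above (p ` B))"

definition semi_Montel :: "('k, 'v::ab_group_add) lcs \<Rightarrow> bool" where
  "semi_Montel X \<longleftrightarrow>
     (\<forall>B. bounded_in X B \<longrightarrow> compactin (lcs_topology X) (lcs_topology X closure_of B))"

definition Cauchy_filter :: "('k, 'v::ab_group_add) lcs \<Rightarrow> 'v filter \<Rightarrow> bool" where
  "Cauchy_filter X F \<longleftrightarrow> F \<noteq> bot \<and> eventually (\<lambda>x. x \<in> carrier X) F \<and>
     (\<forall>p\<in>seminorms X. \<forall>e>0. \<exists>A\<subseteq>carrier X. eventually (\<lambda>x. x \<in> A) F \<and>
        (\<forall>x\<in>A. \<forall>y\<in>A. p (x - y) < e))"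

definition complete_lcs :: "('k, 'v::ab_group_add) lcs \<Rightarrow> bool" where
  "complete_lcs X \<longleftrightarrow>
     (\<forall>F. Cauchy_filter X F \<longrightarrow> (\<exists>l. limitin (lcs_topology X) (\<lambda>x. x) l F))"

definition Banach_space_on :: "'v set \<Rightarrow> ('k::real_or_complex \<Rightarrow> 'v \<Rightarrow> 'v) \<Rightarrow> ('v::ab_group_add \<Rightarrow> real) \<Rightarrow> bool" where
  "Banach_space_on V s q \<longleftrightarrow>
     module.subspace s V \<and> seminorm_on V s q \<and> (\<forall>x\<in>V. q x = 0 \<longrightarrow> x = 0) \<and>
     (\<forall>\<sigma>::nat \<Rightarrow> 'v. (\<forall>n. \<sigma> n \<in> V) \<and>
          (\<forall>e>0. \<exists>N. \<forall>m\<ge>N. \<forall>n\<ge>N. q (\<sigma> m - \<sigma> n) < e) \<longrightarrow>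
        (\<exists>l\<in>V. (\<lambda>n. q (\<sigma> n - l)) \<longlonglongrightarrow> 0))"

definition gauge_of :: "('k::real_or_complex, 'v) lcs \<Rightarrow> 'v set \<Rightarrow> 'v \<Rightarrow> real" where
  "gauge_of X D x = Inf {t. 0 < t \<and> x \<in> scale X (of_real t) ` D}"

definition locally_complete :: "('k::real_or_complex, 'v::ab_group_add) lcs \<Rightarrow> bool" where
  "locally_complete X \<longleftrightarrow>
     (\<forall>D. closedin (lcs_topology X) D \<and> bounded_in X D \<and> absolutely_convex X D \<longrightarrow>
        Banach_space_on (\<Union>n::nat. scale X (of_nat n) ` D) (scale X) (gauge_of X D))"

definition zero_neighbourhood :: "('k, 'v::ab_group_add) lcs \<Rightarrow> 'v set \<Rightarrow> bool" where
  "zero_neighbourhood X U \<longleftrightarrow> U \<subseteq> carrier X \<and> 0 \<in> lcs_topology X interior_of U"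

definition Schwartz_space :: "('k::real_or_complex, 'v::ab_group_add) lcs \<Rightarrow> bool" where
  "Schwartz_space X \<longleftrightarrow>
     (\<forall>U. zero_neighbourhood X U \<and> absolutely_convex X U \<longrightarrow>
        (\<exists>V. zero_neighbourhood X V \<and>
           (\<forall>e>0. \<exists>A. finite A \<and> A \<subseteq> V \<and>
              V \<subseteq> (\<Union>a\<in>A. (\<lambda>y. a + scale X (of_real e) y) ` U))))"

definition Frechet_Schwartz :: "('k::real_or_complex, 'v::ab_group_add) lcs \<Rightarrow> bool" where
  "Frechet_Schwartz X \<longleftrightarrow>
     metrizable_space (lcs_topology X) \<and> complete_lcs X \<and> Schwartz_space X"


section \<open>The \<open>\<epsilon>\<close>-product\<close>

definition equicontinuous :: "('k::real_or_complex, 'v::ab_group_add) lcs \<Rightarrow> ('v \<Rightarrow> 'k) set \<Rightarrow> bool" where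
  "equicontinuous X B \<longleftrightarrow> B \<subseteq> dual X \<and>
     (\<forall>x\<in>carrier X. \<forall>e>0. \<exists>U. openin (lcs_topology X) U \<and> x \<in> U \<and>
        (\<forall>y\<in>U. \<forall>\<phi>\<in>B. norm (\<phi> y - \<phi> x) < e))"

definition kappa_dual :: "('k::real_or_complex, 'v::ab_group_add) lcs \<Rightarrow> ('k, 'v \<Rightarrow> 'k) lcs" where
  "kappa_dual X = \<lparr>carrier = dual X, scale = pointwise_scale (*),
     seminorms = {\<lambda>\<phi>. SUP x\<in>K. norm (\<phi> x) |K.
       absolutely_convex X K \<and> compactin (lcs_topology X) K}\<rparr>"

text \<open>The empty set is excluded from the seminorms because \<open>Sup {}\<close> is unspecified on the reals;
  absolutely convex sets are non-empty by definition.\<close>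

definition eps_product :: "('k::real_or_complex, 'v::ab_group_add) lcs \<Rightarrow> ('k, 'e::ab_group_add) lcs \<Rightarrow>
    ('k, ('v \<Rightarrow> 'k) \<Rightarrow> 'e) lcs" where
  "eps_product X E = \<lparr>carrier = continuous_linear_maps (kappa_dual X) E,
     scale = pointwise_scale (scale E),
     seminorms = {\<lambda>u. SUP \<phi>\<in>B. p (u \<phi>) |B p.
       equicontinuous X B \<and> B \<noteq> {} \<and> p \<in> seminorms E}\<rparr>"


section \<open>Weighted function spaces\<close>

text \<open>
  For \<open>Y\<close> the scalar field or \<open>E\<close>, a record \<open>D\<close> bundles the space \<open>AP(\<Omega>, Y)\<close> with the
  operators \<open>T\<^sub>m\<close> and their domains.  The sets \<open>\<Omega>\<close>, \<open>J\<close>, \<open>M\<close> are the types \<open>'x\<close>, \<open>'j\<close>, \<open>'m\<close>,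
  and the sets \<open>\<omega> m\<close> lie in the type \<open>'w\<close>; only the values of \<open>opr D m f\<close> and \<open>\<nu> j m\<close> on \<open>\<omega> m\<close>
  matter.
\<close>

record ('x, 'w, 'm, 'y) operator_data =
  AP :: "('x \<Rightarrow> 'y) set"
  op_dom :: "'m \<Rightarrow> ('x \<Rightarrow> 'y) set"
  opr :: "'m \<Rightarrow> ('x \<Rightarrow> 'y) \<Rightarrow> 'w \<Rightarrow> 'y"

definition weight_functions :: "('m \<Rightarrow> 'w set) \<Rightarrow> ('j \<Rightarrow> 'm \<Rightarrow> 'w \<Rightarrow> real) \<Rightarrow> bool" where
  "weight_functions \<omega> \<nu> \<longleftrightarrow> (\<forall>m. \<omega> m \<noteq> {}) \<and> (\<forall>j m. \<forall>x\<in>\<omega> m. 0 \<le> \<nu> j m x) \<and>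
     (\<forall>m. \<forall>x\<in>\<omega> m. \<exists>j. 0 < \<nu> j m x)"

definition admissible_data ::
    "('m \<Rightarrow> 'w set) \<Rightarrow> ('k::field, 'y::ab_group_add) lcs \<Rightarrow> ('x, 'w, 'm, 'y) operator_data \<Rightarrow> bool" where
  "admissible_data \<omega> Y D \<longleftrightarrow>
     AP D \<subseteq> {f. \<forall>x. f x \<in> carrier Y} \<and>
     module.subspace (pointwise_scale (scale Y)) (AP D) \<and>
     (\<forall>m. op_dom D m \<subseteq> {f. \<forall>x. f x \<in> carrier Y} \<and>
        module.subspace (pointwise_scale (scale Y)) (op_dom D m) \<and>
        (\<forall>x\<in>\<omega> m. (\<forall>f\<in>op_dom D m. opr D m f x \<in> carrier Y) \<and>
           linear_on (op_dom D m) (pointwise_scale (scale Y)) (scale Y) (\<lambda>f. opr D m f x)))"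

definition F_space :: "('x, 'w, 'm, 'y) operator_data \<Rightarrow> ('x \<Rightarrow> 'y) set" where
  "F_space D = AP D \<inter> (\<Inter>m. op_dom D m)"

definition FV_space :: "('m \<Rightarrow> 'w set) \<Rightarrow> ('j \<Rightarrow> 'm \<Rightarrow> 'w \<Rightarrow> real) \<Rightarrow> ('k, 'y) lcs \<Rightarrow>
    ('x, 'w, 'm, 'y) operator_data \<Rightarrow> ('k, 'x \<Rightarrow> 'y) lcs" where
  "FV_space \<omega> \<nu> Y D = \<lparr>
     carrier = {f \<in> F_space D. \<forall>j m. \<forall>p\<in>seminorms Y.
       bdd_above ((\<lambda>x. p (opr D m f x) * \<nu> j m x) ` \<omega> m)},
     scale = pointwise_scale (scale Y),
     seminorms = {\<lambda>f. SUP x\<in>\<omega> m. p (opr D m f x) * \<nu> j m x |j m p. p \<in> seminorms Y}\<rparr>"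

definition point_evaluation :: "('k, 'x \<Rightarrow> 'y::zero) lcs \<Rightarrow> 'x \<Rightarrow> ('x \<Rightarrow> 'y) \<Rightarrow> 'y" where
  "point_evaluation X x = ext0 (carrier X) (\<lambda>f. f x)"

definition op_evaluation :: "('k, 'x \<Rightarrow> 'y::zero) lcs \<Rightarrow> ('x, 'w, 'm, 'y) operator_data \<Rightarrow>
    'm \<Rightarrow> 'w \<Rightarrow> ('x \<Rightarrow> 'y) \<Rightarrow> 'y" where
  "op_evaluation X D m x = ext0 (carrier X) (\<lambda>f. opr D m f x)"

definition generator :: "('m \<Rightarrow> 'w set) \<Rightarrow> ('j \<Rightarrow> 'm \<Rightarrow> 'w \<Rightarrow> real) \<Rightarrow>
    ('k::real_or_complex, 'e::ab_group_add) lcs \<Rightarrow> ('x, 'w, 'm, 'e) operator_data \<Rightarrow>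
    ('x, 'w, 'm, 'k) operator_data \<Rightarrow> bool" where
  "generator \<omega> \<nu> E DE DK \<longleftrightarrow>
     weight_functions \<omega> \<nu> \<and> admissible_data \<omega> E DE \<and> admissible_data \<omega> scalars DK \<and>
     (let X = FV_space \<omega> \<nu> scalars DK; Z = FV_space \<omega> \<nu> E DE in
        Hausdorff_space (lcs_topology X) \<and> directed_system X \<and>
        (\<forall>x. point_evaluation X x \<in> dual X) \<and>
        Hausdorff_space (lcs_topology Z) \<and> directed_system Z)"

definition S_map :: "('k, 'x \<Rightarrow> 'k::zero) lcs \<Rightarrow> ((('x \<Rightarrow> 'k) \<Rightarrow> 'k) \<Rightarrow> 'e) \<Rightarrow> 'x \<Rightarrow> 'e" where
  "S_map X u = (\<lambda>x. u (point_evaluation X x))"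

definition consistent :: "('m \<Rightarrow> 'w set) \<Rightarrow> ('j \<Rightarrow> 'm \<Rightarrow> 'w \<Rightarrow> real) \<Rightarrow>
    ('k::real_or_complex, 'e::ab_group_add) lcs \<Rightarrow> ('x, 'w, 'm, 'e) operator_data \<Rightarrow>
    ('x, 'w, 'm, 'k) operator_data \<Rightarrow> bool" where
  "consistent \<omega> \<nu> E DE DK \<longleftrightarrow>
     (let X = FV_space \<omega> \<nu> scalars DK in
        \<forall>u\<in>carrier (eps_product X E). S_map X u \<in> F_space DE \<and>
          (\<forall>m. \<forall>x\<in>\<omega> m. opr DE m (S_map X u) x = u (op_evaluation X DK m x)))"

definition strong :: "('m \<Rightarrow> 'w set) \<Rightarrow> ('j \<Rightarrow> 'm \<Rightarrow> 'w \<Rightarrow> real) \<Rightarrow>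
    ('k::real_or_complex, 'e::ab_group_add) lcs \<Rightarrow> ('x, 'w, 'm, 'e) operator_data \<Rightarrow>
    ('x, 'w, 'm, 'k) operator_data \<Rightarrow> bool" where
  "strong \<omega> \<nu> E DE DK \<longleftrightarrow>
     (\<forall>e'\<in>dual E. \<forall>f\<in>carrier (FV_space \<omega> \<nu> E DE). e' \<circ> f \<in> F_space DK \<and>
        (\<forall>m. \<forall>x\<in>\<omega> m. opr DK m (e' \<circ> f) x = e' (opr DE m f x)))"

definition N_set :: "('m \<Rightarrow> 'w set) \<Rightarrow> ('j \<Rightarrow> 'm \<Rightarrow> 'w \<Rightarrow> real) \<Rightarrow>
    ('k::real_or_complex, 'e) lcs \<Rightarrow> ('x, 'w, 'm, 'e) operator_data \<Rightarrow>
    'j \<Rightarrow> 'm \<Rightarrow> ('x \<Rightarrow> 'e) \<Rightarrow> 'e set" where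
  "N_set \<omega> \<nu> E DE j m f = {scale E (of_real (\<nu> j m x)) (opr DE m f x) |x. x \<in> \<omega> m}"

definition eps_compatible :: "('k::real_or_complex, 'x \<Rightarrow> 'k) lcs \<Rightarrow> ('k, 'e::ab_group_add) lcs \<Rightarrow>
    ('k, 'x \<Rightarrow> 'e) lcs \<Rightarrow> bool" where
  "eps_compatible X E Z \<longleftrightarrow> lcs_isomorphism (eps_product X E) Z (S_map X)"

end

theory Submission
  imports Defs
begin

text \<open>
  For \<open>u \<in> \<F>\<V>(\<Omega>) \<epsilon> E\<close> consistency turns the seminorm of \<open>S u\<close> into the supremum of \<open>p \<circ> u\<close> over the
  equicontinuous set of weighted evaluations.  Every other equicontinuous set is dominated by such a set:
  for \<open>e' \<in> E'\<close> the functional \<open>e' \<circ> u\<close> is, by the Mackey--Arens theorem, the evaluation at some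
  \<open>f \<in> \<F>\<V>(\<Omega>)\<close>, so a bound of \<open>\<phi>\<close> by a weighted seminorm passes to \<open>u \<phi>\<close>.  Hence \<open>S\<close> is always
  an isomorphism onto its range.

  For surjectivity, \<open>f\<close> is the image of the transpose of \<open>e' \<mapsto> e' \<circ> f\<close>, provided that polars of
  seminorms have relatively compact images and that every functional \<open>e' \<mapsto> \<phi>(e' \<circ> f)\<close> is represented
  by an element of \<open>E\<close>.  If \<open>f\<close> has relatively compact weighted ranges, the latter is the Mackey--Arens
  theorem in \<open>E\<close>.  Otherwise the represented \<open>\<phi>\<close> form a subspace of the dual that contains the point
  evaluations and is therefore dense for uniform convergence on compact sets; density suffices if \<open>E\<close>
  is complete.  If \<open>E\<close> is only locally complete, pointwise limits of represented functionals in an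
  equicontinuous set are still represented, since in a Schwartz space they are local limits, and the
  subspace is everything by the Krein--Smulian theorem.
\<close>


section \<open>Scalars and the Hahn--Banach theorem\<close>

text \<open>All four cases rest on one dictionary: by strongness the (j,m)-seminorm of e' o f is the
  supremum of |e'| over N_{j,m}(f). If \<phi> is bounded by C times this seminorm, a vector
  representing e' \<mapsto> \<phi>(e' o f) can therefore only lie in C times the bipolar D of
  N_{j,m}(f). With compact ranges such a vector is found by compactness; under local completeness D
  is the disc whose span E_D is a Banach space.

  The obstacle in case (ii) is that represented functionals approximate \<phi> only along nets,
  while local completeness yields only limits of sequences that are Cauchy in some E_D. The Schwartz
  property bridges this on equicontinuous sets: closeness at finitely many points becomes closeness
  on a neighbourhood of 0, so sequences with a rate can be chosen. Metrizability then lets the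
  Krein-Smulian argument exhaust the dual by countably many steps, and completeness supplies the
  compact sets it needs.

  Functionals are never extended from a subspace: Hahn-Banach is applied to seminorms on the whole
  space, in particular to the distance from a subspace.\<close>

lemma norm_of_real_add_imaginary:
  fixes i :: "'k::real_or_complex"
  assumes i: "i * i = - 1"
    and rep: "\<And>z. \<exists>a b. z = a *\<^sub>R 1 + b *\<^sub>R i \<and> norm z = sqrt (a\<^sup>2 + b\<^sup>2)"
  shows "norm (of_real a + of_real b * i) = sqrt (a\<^sup>2 + b\<^sup>2)"
proof -
  \<comment> \<open>The class axiom only says that some pair of coefficients computes the norm.
    \<open>i * i = - 1\<close> makes coefficients unique, since a vanishing combination gives
    \<open>a\<^sup>2 + b\<^sup>2 = 0\<close>; hence the given pair is that pair.\<close>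
  have zero: "a = 0 \<and> b = 0" if "of_real a + of_real b * i = (0::'k)" for a b :: real
  proof -
    have "of_real b * i = - (of_real a)"
      using that by (simp add: add_eq_0_iff)
    then have "(of_real b * i) * (of_real b * i) = of_real (a * a)"
      by simp
    moreover have "(of_real b * i) * (of_real b * i) = of_real (- (b * b))"
    proof -
      have "(of_real b * i) * (of_real b * i) = of_real b * of_real b * (i * i)"
        by (simp only: ac_simps)
      then show ?thesis by (simp add: i)
    qed
    ultimately have "of_real (a * a) = (of_real (- (b * b)) :: 'k)"
      by simp
    then have "a * a = - (b * b)"
      unfolding of_real_eq_iff .
    then have "a\<^sup>2 + b\<^sup>2 = 0"
      by (simp add: power2_eq_square)
    then show ?thesis
      by simp
  qed
  obtain a' b' where ab: "of_real a + of_real b * i = a' *\<^sub>R 1 + b' *\<^sub>R i"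
      "norm (of_real a + of_real b * i) = sqrt (a'\<^sup>2 + b'\<^sup>2)"
    using rep by blast
  have "of_real (a - a') + of_real (b - b') * i = 0"
    using ab(1) by (simp add: scaleR_conv_of_real algebra_simps)
  from zero[OF this] ab(2) show ?thesis
    by simp
qed

text \<open>Real part and complex conjugation for an abstract scalar field, characterised by the
  properties that are used. The last conjunct expands a squared distance along a real line; it is
  the first variation in \<open>Mackey_Arens_finite\<close>.\<close>

definition conjugation :: "('k::real_or_complex \<Rightarrow> real) \<Rightarrow> ('k \<Rightarrow> 'k) \<Rightarrow> bool" where
  "conjugation re cj \<longleftrightarrow>
    (\<forall>z w. re (z + w) = re z + re w) \<and> (\<forall>a. re (of_real a) = a) \<and>
    (\<forall>z. \<bar>re z\<bar> \<le> norm z) \<and> (\<forall>z. cj z * z = of_real ((norm z)\<^sup>2)) \<and>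
    (\<forall>b z t. (norm (b - of_real t * z))\<^sup>2 = (norm b)\<^sup>2 - 2 * t * re (cj b * z) + t\<^sup>2 * (norm z)\<^sup>2)"

lemma conjugation_exists:
  "\<exists>(re :: 'k::real_or_complex \<Rightarrow> real) cj. conjugation re cj"
  using real_or_complex[where 'a='k]
proof
  assume "\<forall>z::'k. \<exists>a. z = a *\<^sub>R 1"
  then obtain re where re: "\<And>z::'k. z = of_real (re z)"
    by (metis of_real_def)
  have re_eq: "re (of_real a) = a" for a
    using re[of "of_real a"] by simp
  have add: "re (z + w) = re z + re w" for z w
  proof -
    have "z + w = of_real (re z + re w)"
      using re[of z] re[of w] by simp
    then show ?thesis
      using re_eq by metis
  qed
  have nrm: "norm z = \<bar>re z\<bar>" for z
    by (subst re) simp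
  have mult: "re (z * w) = re z * re w" for z w
  proof -
    have "z * w = of_real (re z * re w)"
      using re[of z] re[of w] by simp
    then show ?thesis
      using re_eq by metis
  qed
  have diff: "re (z - w) = re z - re w" for z w
    using add[of "z - w" w] by simp
  show ?thesis
    unfolding conjugation_def
  proof (intro exI[of _ re] exI[of _ id] conjI allI)
    show "id z * z = of_real ((norm z)\<^sup>2)" for z :: 'k
      using re[of z] re[of "z * z"] by (simp add: nrm mult power2_eq_square)
    show "(norm (b - of_real t * z))\<^sup>2 = (norm b)\<^sup>2 - 2 * t * re (id b * z) + t\<^sup>2 * (norm z)\<^sup>2" for b z :: 'k and t
      by (simp add: nrm mult diff re_eq power2_eq_square algebra_simps)
  qed (use add re_eq nrm in auto)
next
  assume "\<exists>i::'k. i * i = - 1 \<and> (\<forall>z. \<exists>a b. z = a *\<^sub>R 1 + b *\<^sub>R i \<and> norm z = sqrt (a\<^sup>2 + b\<^sup>2))"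
  then obtain i :: 'k where i: "i * i = - 1"
    and rep: "\<And>z. \<exists>a b. z = a *\<^sub>R 1 + b *\<^sub>R i \<and> norm z = sqrt (a\<^sup>2 + b\<^sup>2)"
    by blast
  note nrm = norm_of_real_add_imaginary[OF i rep]
  obtain re im where ri: "\<And>z::'k. z = of_real (re z) + of_real (im z) * i"
    using rep by (metis scaleR_conv_of_real mult.right_neutral)
  have uniq: "re z = a \<and> im z = b" if "z = of_real a + of_real b * i" for z a b
  proof -
    have "of_real (re z - a) + of_real (im z - b) * i = 0"
      using ri[of z] that by (simp add: algebra_simps)
    then have "sqrt ((re z - a)\<^sup>2 + (im z - b)\<^sup>2) = 0"
      using nrm[of "re z - a" "im z - b"] by simp
    then show ?thesis
      by (simp add: add_nonneg_eq_0_iff)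
  qed
  have nrm2: "(norm z)\<^sup>2 = (re z)\<^sup>2 + (im z)\<^sup>2" for z
    using nrm[of "re z" "im z"] ri[of z] by simp
  have ii: "i * (i * z) = - z" for z
    using i by (simp flip: mult.assoc)
  have add: "re (z + w) = re z + re w \<and> im (z + w) = im z + im w" for z w
    by (rule uniq, subst ri[of z], subst ri[of w]) (simp add: algebra_simps)
  have mult: "re (z * w) = re z * re w - im z * im w \<and> im (z * w) = re z * im w + im z * re w" for z w
    by (rule uniq, subst ri[of z], subst ri[of w]) (simp add: algebra_simps i ii)
  have real: "re (of_real a) = a \<and> im (of_real a) = 0" for a
    by (rule uniq) simp
  have diff: "re (z - w) = re z - re w \<and> im (z - w) = im z - im w" for z w
    using add[of "z - w" w] by simp
  define cj where "cj z = of_real (re z) - of_real (im z) * i" for z :: 'k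
  have cj: "re (cj z) = re z \<and> im (cj z) = - im z" for z
    by (rule uniq) (simp add: cj_def)
  show ?thesis
    unfolding conjugation_def
  proof (intro exI[of _ re] exI[of _ cj] conjI allI)
    show "\<bar>re z\<bar> \<le> norm z" for z
      by (rule abs_le_square_iff[THEN iffD2, of "re z" "norm z", simplified]) (simp add: nrm2)
    show "cj z * z = of_real ((norm z)\<^sup>2)" for z :: 'k
      unfolding nrm2 by (subst ri[of "cj z * z"]) (simp add: mult cj power2_eq_square)
    show "(norm (b - of_real t * z))\<^sup>2 = (norm b)\<^sup>2 - 2 * t * re (cj b * z) + t\<^sup>2 * (norm z)\<^sup>2" for b z t
      unfolding nrm2 by (simp add: mult diff real cj power2_eq_square algebra_simps)
  qed (use add real in auto)
qed

text \<open>The ball is the image of a Euclidean ball in \<open>real\<close> or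
  \<open>real \<times> real\<close> under a norm preserving continuous map. Its compactness feeds
  Tychonoff's theorem in \<open>compact_polar\<close>.\<close>

lemma compact_cball_real_or_complex: "compact (cball (0::'k::real_or_complex) r)"
  using real_or_complex[where 'a='k]
proof
  assume "\<forall>z::'k. \<exists>a. z = a *\<^sub>R 1"
  then have "cball (0::'k) r = of_real ` cball (0::real) r"
    by (force simp: of_real_def)
  then show ?thesis
    by (simp add: compact_continuous_image continuous_on_of_real_id)
next
  assume "\<exists>i::'k. i * i = - 1 \<and> (\<forall>z. \<exists>a b. z = a *\<^sub>R 1 + b *\<^sub>R i \<and> norm z = sqrt (a\<^sup>2 + b\<^sup>2))"
  then obtain i :: 'k where i: "i * i = - 1"
    and rep: "\<And>z. \<exists>a b. z = a *\<^sub>R 1 + b *\<^sub>R i \<and> norm z = sqrt (a\<^sup>2 + b\<^sup>2)"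
    by blast
  define h :: "real \<times> real \<Rightarrow> 'k" where "h x = of_real (fst x) + of_real (snd x) * i" for x
  have nrm: "norm (h x) = norm x" for x
    using norm_of_real_add_imaginary[OF i rep, of "fst x" "snd x"] by (simp add: h_def norm_prod_def)
  have surj: "\<exists>x. z = h x" for z
    using rep[of z] by (auto simp: h_def scaleR_conv_of_real)
  have "cball (0::'k) r = h ` cball 0 r"
  proof (intro equalityI subsetI)
    fix z assume z: "z \<in> cball (0::'k) r"
    obtain x where "z = h x" using surj by blast
    then show "z \<in> h ` cball 0 r"
      using z nrm[of x] by (auto simp: image_iff)
  next
    fix z assume "z \<in> h ` cball 0 r"
    then show "z \<in> cball 0 r" using nrm by auto
  qed
  moreover have "continuous_on (cball 0 r) h"
    unfolding h_def by (intro continuous_intros)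
  ultimately show ?thesis
    by (simp add: compact_continuous_image)
qed

lemma obtain_phase:
  fixes z :: "'k::real_or_complex"
  obtains c where "norm c = 1" "c * z = of_real (norm z)"
proof (cases "z = 0")
  case True
  then show ?thesis by (intro that[of 1]) auto
next
  case False
  then show ?thesis by (intro that[of "of_real (norm z) / z"]) (auto simp: norm_divide)
qed

section \<open>The Hahn-Banach theorem through minimal sublinear functionals\<close>

definition sublinear_on :: "'v set \<Rightarrow> ('k::real_or_complex \<Rightarrow> 'v \<Rightarrow> 'v) \<Rightarrow> ('v::ab_group_add \<Rightarrow> real) \<Rightarrow> bool" where
  "sublinear_on V s q \<longleftrightarrow> (\<forall>x\<in>V. \<forall>y\<in>V. q (x + y) \<le> q x + q y) \<and>
     (\<forall>t>0. \<forall>x\<in>V. q (s (of_real t) x) = t * q x)"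

lemma sublinear_onD:
  assumes "sublinear_on V s q"
  shows "x \<in> V \<Longrightarrow> y \<in> V \<Longrightarrow> q (x + y) \<le> q x + q y"
    and "t > 0 \<Longrightarrow> x \<in> V \<Longrightarrow> q (s (of_real t) x) = t * q x"
  using assms by (auto simp: sublinear_on_def)

context
  fixes s :: "'k::real_or_complex \<Rightarrow> 'v::ab_group_add \<Rightarrow> 'v" and V :: "'v set"
  assumes vs: "vector_space s" and sub: "module.subspace s V"
begin

interpretation vector_space s by (rule vs)

lemma subspace_closure: "0 \<in> V" "x \<in> V \<Longrightarrow> y \<in> V \<Longrightarrow> x + y \<in> V" "x \<in> V \<Longrightarrow> s c x \<in> V"
    "x \<in> V \<Longrightarrow> - x \<in> V"
  using sub subspace_0 subspace_add subspace_scale subspace_neg by auto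

lemma sublinear_zero: assumes "sublinear_on V s q" shows "q 0 = 0"
  using sublinear_onD(2)[OF assms, of 2 0] subspace_closure by simp

lemma sublinear_neg: assumes "sublinear_on V s q" "x \<in> V" shows "- q (- x) \<le> q x"
  using sublinear_onD(1)[OF assms(1), of x "- x"] sublinear_zero[OF assms(1)] subspace_closure assms by simp

text \<open>The witness is the infimum of \<open>q (x + t x0) - t q x0\<close> over \<open>t \<ge> 0\<close>; for a minimal \<open>q\<close> the lemma
  forces \<open>q (- x0) = - q x0\<close>.\<close>

lemma sublinear_lower:
  assumes q: "sublinear_on V s q" and x0: "x0 \<in> V"
  shows "\<exists>r. sublinear_on V s r \<and> (\<forall>x\<in>V. r x \<le> q x) \<and> r (- x0) \<le> - q x0"
proof -
  define S where "S x = (\<lambda>t. q (x + s (of_real t) x0) - t * q x0) ` {0..}" for x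
  define r where "r x = Inf (S x)" for x
  note qa = sublinear_onD(1)[OF q] and qs = sublinear_onD(2)[OF q]
  have scl: "q (s (of_real t) x) = t * q x" if "t \<ge> 0" "x \<in> V" for t x
    using that qs[of t x] sublinear_zero[OF q] by (cases "t = 0") auto
  have lower: "- q (- x) \<le> v" if "v \<in> S x" "x \<in> V" for v x
  proof -
    obtain t where t: "t \<ge> 0" "v = q (x + s (of_real t) x0) - t * q x0"
      using \<open>v \<in> S x\<close> by (auto simp: S_def)
    have "q (s (of_real t) x0) \<le> q (x + s (of_real t) x0) + q (- x)"
      using qa[of "x + s (of_real t) x0" "- x"] subspace_closure x0 that by simp
    then show ?thesis
      using scl[OF t(1) x0] t by simp
  qed
  then have bdd: "bdd_below (S x)" if "x \<in> V" for x
    using that by (intro bdd_belowI[of _ "- q (- x)"]) auto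
  have ne: "S x \<noteq> {}" for x
    by (auto simp: S_def)
  have r_le: "r x \<le> q (x + s (of_real t) x0) - t * q x0" if "t \<ge> 0" "x \<in> V" for x t
    unfolding r_def using that by (intro cInf_lower bdd) (auto simp: S_def)
  have r_ge: "c \<le> r x" if "\<And>t. t \<ge> 0 \<Longrightarrow> c \<le> q (x + s (of_real t) x0) - t * q x0" for c x
    unfolding r_def using that by (intro cInf_greatest ne) (auto simp: S_def)
  have "sublinear_on V s r"
    unfolding sublinear_on_def
  proof (intro conjI ballI allI impI)
    fix x y assume x: "x \<in> V" and y: "y \<in> V"
    have "r (x + y) - (q (y + s (of_real t) x0) - t * q x0) \<le> r x" if t: "t \<ge> 0" for t
    proof (rule r_ge)
      fix t' :: real assume t': "0 \<le> t'"
      have "r (x + y) \<le> q (x + y + s (of_real (t + t')) x0) - (t + t') * q x0"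
        using t t' x y subspace_closure by (intro r_le) auto
      also have "x + y + s (of_real (t + t')) x0 = (x + s (of_real t') x0) + (y + s (of_real t) x0)"
        by (simp add: scale_left_distrib)
      also have "q \<dots> \<le> q (x + s (of_real t') x0) + q (y + s (of_real t) x0)"
        using x y x0 subspace_closure by (intro qa) auto
      finally show "r (x + y) - (q (y + s (of_real t) x0) - t * q x0)
          \<le> q (x + s (of_real t') x0) - t' * q x0"
        by (simp add: algebra_simps)
    qed
    then have "r (x + y) - r x \<le> r y"
      by (intro r_ge) (force simp: algebra_simps)
    then show "r (x + y) \<le> r x + r y" by simp
  next
    have *: "r (s (of_real t) x) \<le> t * r x" if "t > 0" "x \<in> V" for t x
    proof -
      have "r (s (of_real t) x) / t \<le> r x"
      proof (rule r_ge)
        fix t' :: real assume t': "t' \<ge> 0"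
        have "r (s (of_real t) x) \<le> q (s (of_real t) x + s (of_real (t * t')) x0) - (t * t') * q x0"
          using that t' subspace_closure by (intro r_le) auto
        also have "s (of_real t) x + s (of_real (t * t')) x0 = s (of_real t) (x + s (of_real t') x0)"
          by (simp add: scale_right_distrib)
        also have "q \<dots> = t * q (x + s (of_real t') x0)"
          using that x0 subspace_closure by (intro qs) auto
        finally show "r (s (of_real t) x) / t \<le> q (x + s (of_real t') x0) - t' * q x0"
          using that by (simp add: field_simps)
      qed
      then show ?thesis
        using that by (simp add: field_simps)
    qed
    fix t :: real and x assume t: "0 < t" "x \<in> V"
    have "r x \<le> (1 / t) * r (s (of_real t) x)"
      using *[of "1 / t" "s (of_real t) x"] t subspace_closure by (simp flip: of_real_mult)
    then have "t * r x \<le> r (s (of_real t) x)"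
      using t by (simp add: field_simps)
    with *[OF t] show "r (s (of_real t) x) = t * r x" by simp
  qed
  moreover have "r x \<le> q x" if "x \<in> V" for x
    using r_le[of 0 x] that by simp
  moreover have "r (- x0) \<le> - q x0"
    using r_le[of 1 "- x0"] x0 subspace_closure sublinear_zero[OF q] by simp
  ultimately show ?thesis by blast
qed

text \<open>Zorn's lemma, ordered downwards. Minimal functionals take the place of maximal
  extensions from subspaces: by \<open>sublinear_lower\<close> minimality forces oddness, and an odd
  sublinear functional is real linear.\<close>

lemma minimal_sublinear:
  assumes p: "sublinear_on V s p"
  shows "\<exists>q. sublinear_on V s q \<and> (\<forall>x\<in>V. q x \<le> p x) \<and>
    (\<forall>r. sublinear_on V s r \<longrightarrow> (\<forall>x\<in>V. r x \<le> q x) \<longrightarrow> (\<forall>x\<in>V. r x = q x))"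
proof -
  \<comment> \<open>Fixing the value 0 outside \<open>V\<close> makes the pointwise order
    \<open>P\<close> antisymmetric on \<open>A\<close>.\<close>
  define A where "A = {q. sublinear_on V s q \<and> (\<forall>x\<in>V. q x \<le> p x) \<and> (\<forall>x. x \<notin> V \<longrightarrow> q x = 0)}"
  define P where "P q r \<longleftrightarrow> (\<forall>x. r x \<le> q x)" for q r :: "'v \<Rightarrow> real"
  have ext: "sublinear_on V s (\<lambda>x. if x \<in> V then q x else 0)" if "sublinear_on V s q" for q
    using that subspace_closure by (auto simp: sublinear_on_def)
  have lowerA: "- p (- x) \<le> q x" if "q \<in> A" "x \<in> V" for q x
    using sublinear_neg[of q x] that subspace_closure(4)[of x] by (force simp: A_def)
  have "\<exists>m\<in>A. \<forall>a\<in>A. P m a \<longrightarrow> a = m"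
  proof (rule predicate_Zorn)
    show "partial_order_on A (relation_of P A)"
      by (rule partial_order_on_relation_ofI) (auto simp: P_def fun_eq_iff intro: order_trans antisym)
    fix C assume C: "C \<in> Chains (relation_of P A)"
    have tot: "P a b \<or> P b a" if "a \<in> C" "b \<in> C" for a b
      using C that unfolding Chains_def relation_of_def by blast
    have CA: "C \<subseteq> A"
      using C unfolding Chains_def relation_of_def by blast
    show "\<exists>u\<in>A. \<forall>a\<in>C. P a u"
    proof (cases "C = {}")
      case True
      have "(\<lambda>x. if x \<in> V then p x else 0) \<in> A"
        using ext[OF p] by (auto simp: A_def)
      with True show ?thesis by blast
    next
      case False
      define u where "u x = (INF q\<in>C. q x)" for x
      have bdd: "bdd_below ((\<lambda>q. q x) ` C)" for x
      proof (cases "x \<in> V")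
        case True
        then show ?thesis using lowerA CA by (intro bdd_belowI[of _ "- p (- x)"]) auto
      next
        case False
        then show ?thesis using CA by (intro bdd_belowI[of _ 0]) (auto simp: A_def)
      qed
      have u_le: "u x \<le> q x" if "q \<in> C" for q x
        unfolding u_def using that by (intro cINF_lower bdd) auto
      have u_ge: "c \<le> u x" if "\<And>q. q \<in> C \<Longrightarrow> c \<le> q x" for c x
        unfolding u_def using that False by (intro cINF_greatest) auto
      have CS: "sublinear_on V s q" if "q \<in> C" for q
        using CA that by (auto simp: A_def)
      have "sublinear_on V s u"
        unfolding sublinear_on_def
      proof (intro conjI ballI allI impI)
        fix x y assume xy: "x \<in> V" "y \<in> V"
        have "u (x + y) - q y \<le> u x" if q: "q \<in> C" for q
        proof (rule u_ge)
          fix q' assume q': "q' \<in> C"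
          \<comment> \<open>One of \<open>q\<close> and \<open>q'\<close> lies below the other
            everywhere, so a single member of the chain bounds both values and its own subadditivity
            applies.\<close>
          obtain r where r: "r \<in> C" "r x \<le> q' x" "r y \<le> q y"
            using tot[OF q q'] q q' by (auto simp: P_def)
          show "u (x + y) - q y \<le> q' x"
            using u_le[OF r(1), of "x + y"] sublinear_onD(1)[OF CS[OF r(1)] xy] r by simp
        qed
        then have "u (x + y) - u x \<le> u y"
          by (intro u_ge) (force simp: algebra_simps)
        then show "u (x + y) \<le> u x + u y" by simp
      next
        fix t :: real and x assume t: "0 < t" "x \<in> V"
        have "u (s (of_real t) x) / t \<le> u x"
        proof (rule u_ge)
          fix q assume q: "q \<in> C"
          show "u (s (of_real t) x) / t \<le> q x"
            using u_le[OF q, of "s (of_real t) x"] sublinear_onD(2)[OF CS[OF q] t] t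
            by (simp add: field_simps)
        qed
        moreover have "t * u x \<le> u (s (of_real t) x)"
        proof (rule u_ge)
          fix q assume q: "q \<in> C"
          show "t * u x \<le> q (s (of_real t) x)"
            using u_le[OF q, of x] sublinear_onD(2)[OF CS[OF q] t] t by simp
        qed
        ultimately show "u (s (of_real t) x) = t * u x"
          using t by (simp add: field_simps)
      qed
      moreover obtain q where "q \<in> C" using False by blast
      then have "u x \<le> p x" if "x \<in> V" for x
        using u_le[of q x] CA that by (force simp: A_def)
      moreover have "u x = 0" if "x \<notin> V" for x
      proof -
        have "(\<lambda>q. q x) ` C = (\<lambda>q. 0) ` C"
          using that CA by (intro image_cong) (auto simp: A_def)
        then show ?thesis using False by (simp add: u_def)
      qed
      ultimately have "u \<in> A" by (auto simp: A_def)
      then show ?thesis using u_le by (auto simp: P_def)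
    qed
  qed
  then obtain m where m: "m \<in> A" "\<And>a. a \<in> A \<Longrightarrow> P m a \<Longrightarrow> a = m" by blast
  show ?thesis
  proof (intro exI[of _ m] conjI allI impI ballI)
    fix r x assume r: "sublinear_on V s r" "\<forall>x\<in>V. r x \<le> m x" and x: "x \<in> V"
    let ?r = "\<lambda>x. if x \<in> V then r x else 0"
    have "?r \<in> A"
      using ext[OF r(1)] r(2) m(1) by (force simp: A_def)
    moreover have "P m ?r"
      using r(2) m(1) by (auto simp: P_def A_def)
    ultimately have "?r = m" by (rule m(2))
    from fun_cong[OF this, of x] show "r x = m x" using x by simp
  qed (use m(1) in \<open>auto simp: A_def\<close>)
qed

text \<open>A minimal functional below \<open>p\<close> is already linear, but need not attain
  \<open>p\<close> at \<open>x0\<close>. Lowering \<open>p\<close> first gives every minorant the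
  bound \<open>f (- x0) \<le> - p x0\<close>, which oddness turns into
  \<open>f x0 = p x0\<close>.\<close>

lemma Hahn_Banach_real:
  assumes p: "sublinear_on V s p" and x0: "x0 \<in> V"
  obtains f where "\<And>x y. x \<in> V \<Longrightarrow> y \<in> V \<Longrightarrow> f (x + y) = f x + f y"
    "\<And>t x. x \<in> V \<Longrightarrow> f (s (of_real t) x) = t * f x"
    "\<And>x. x \<in> V \<Longrightarrow> f x \<le> p x" "f x0 = p x0"
proof -
  obtain p' where p': "sublinear_on V s p'" "\<And>x. x \<in> V \<Longrightarrow> p' x \<le> p x" "p' (- x0) \<le> - p x0"
    using sublinear_lower[OF p x0] by blast
  obtain f where f: "sublinear_on V s f" "\<And>x. x \<in> V \<Longrightarrow> f x \<le> p' x"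
    and min: "\<And>r x. sublinear_on V s r \<Longrightarrow> (\<And>x. x \<in> V \<Longrightarrow> r x \<le> f x) \<Longrightarrow> x \<in> V \<Longrightarrow> r x = f x"
    using minimal_sublinear[OF p'(1)] by blast
  have neg: "f (- x) = - f x" if x: "x \<in> V" for x
  proof -
    obtain r where r: "sublinear_on V s r" "\<And>x. x \<in> V \<Longrightarrow> r x \<le> f x" "r (- x) \<le> - f x"
      using sublinear_lower[OF f(1) x] by blast
    have "f (- x) \<le> - f x"
      using min[OF r(1,2), of "- x"] r(3) subspace_closure x by simp
    then show ?thesis
      using sublinear_neg[OF f(1) x] by simp
  qed
  show ?thesis
  proof (rule that[of f])
    fix x y assume xy: "x \<in> V" "y \<in> V"
    have "f x \<le> f (x + y) + f (- y)"
      using sublinear_onD(1)[OF f(1), of "x + y" "- y"] xy subspace_closure by simp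
    then show "f (x + y) = f x + f y"
      using neg[OF xy(2)] sublinear_onD(1)[OF f(1) xy] by simp
  next
    fix t x assume x: "x \<in> V"
    show "f (s (of_real t) x) = t * f x"
    proof (cases t "0::real" rule: linorder_cases)
      case less
      have "f (s (of_real (- t)) x) = - t * f x"
        using less x by (intro sublinear_onD(2)[OF f(1)]) auto
      then show ?thesis using neg[of "s (of_real t) x"] x subspace_closure by simp
    next
      case equal
      then show ?thesis using sublinear_zero[OF f(1)] by simp
    next
      case greater
      then show ?thesis using x sublinear_onD(2)[OF f(1)] by simp
    qed
  next
    show "f x \<le> p x" if "x \<in> V" for x
      using f(2) p'(2) that by force
    have "f (- x0) \<le> - p x0"
      using f(2)[of "- x0"] p'(3) x0 subspace_closure by simp
    then show "f x0 = p x0"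
      using neg[OF x0] f(2)[OF x0] p'(2)[OF x0] by simp
  qed
qed

lemma Hahn_Banach:
  assumes p: "seminorm_on V s p" and x0: "x0 \<in> V"
  obtains F where "linear_on V s (*) F" "\<And>x. x \<in> V \<Longrightarrow> norm (F x) \<le> p x" "norm (F x0) = p x0"
proof -
  have pa: "p (x + y) \<le> p x + p y" if "x \<in> V" "y \<in> V" for x y
    using p that by (auto simp: seminorm_on_def)
  have ps: "p (s c x) = norm c * p x" if "x \<in> V" for x c
    using p that by (auto simp: seminorm_on_def)
  have sl: "sublinear_on V s p"
    using pa ps by (auto simp: sublinear_on_def)
  obtain f where add: "\<And>x y. x \<in> V \<Longrightarrow> y \<in> V \<Longrightarrow> f (x + y) = f x + f y"
    and scl: "\<And>t x. x \<in> V \<Longrightarrow> f (s (of_real t) x) = t * f x"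
    and le: "\<And>x. x \<in> V \<Longrightarrow> f x \<le> p x" and fx0: "f x0 = p x0"
    using Hahn_Banach_real[OF sl x0] by blast
  \<comment> \<open>The last clause says that \<open>F x\<close> equals \<open>f x\<close> whenever
    it is real. Rotating \<open>x\<close> until \<open>F x\<close> is its own modulus then gives the
    bound by \<open>p\<close> for both scalar fields at once.\<close>
  from add have "\<exists>F. linear_on V s (*) F \<and> (\<forall>x\<in>V. \<bar>f x\<bar> \<le> norm (F x) \<and>
      (\<forall>c. F x = of_real c \<longrightarrow> c = f x))"
    using real_or_complex[where 'a='k]
  proof (elim disjE)
    assume "\<forall>z::'k. \<exists>a. z = a *\<^sub>R 1"
    then have re: "\<exists>a. c = of_real a" for c :: 'k
      by (metis of_real_def)
    have "f (s c x) *\<^sub>R (1::'k) = c * (f x *\<^sub>R 1)" if "x \<in> V" for x c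
      using re[of c] scl that by (auto simp: scaleR_conv_of_real)
    then have "linear_on V s (*) (\<lambda>x. of_real (f x))"
      using add by (auto simp: linear_on_def scaleR_conv_of_real)
    then show ?thesis by (intro exI[of _ "\<lambda>x. of_real (f x)"]) auto
  next
    assume "\<exists>i::'k. i * i = - 1 \<and> (\<forall>z. \<exists>a b. z = a *\<^sub>R 1 + b *\<^sub>R i \<and> norm z = sqrt (a\<^sup>2 + b\<^sup>2))"
    then obtain i :: 'k where i: "i * i = - 1"
      and rep: "\<And>z. \<exists>a b. z = a *\<^sub>R 1 + b *\<^sub>R i \<and> norm z = sqrt (a\<^sup>2 + b\<^sup>2)"
      by blast
    note nrm = norm_of_real_add_imaginary[OF i rep]
    have ii: "i * (i * z) = - z" for z
      using i by (simp flip: mult.assoc)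
    \<comment> \<open>The usual complexification \<open>f x - i f (i x)\<close>, written with real
      coefficients so that \<open>nrm\<close> computes its modulus.\<close>
    define F where "F x = of_real (f x) + of_real (- f (s i x)) * i" for x
    have "linear_on V s (*) F"
      unfolding linear_on_def
    proof (intro conjI ballI allI)
      fix x y assume "x \<in> V" "y \<in> V"
      then show "F (x + y) = F x + F y"
        using add subspace_closure by (simp add: F_def scale_right_distrib algebra_simps)
    next
      fix c x assume x: "x \<in> V"
      obtain a b where c: "c = of_real a + of_real b * i"
        using rep[of c] by (auto simp: scaleR_conv_of_real)
      have "f (s c x) = a * f x + b * f (s i x)"
        unfolding c using x subspace_closure by (simp add: scale_left_distrib add scl flip: scale_scale)
      moreover have "s i (s c x) = s (of_real a) (s i x) + s (of_real (- b)) x"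
      proof -
        have "i * c = of_real a * i + of_real b * (i * i)"
          unfolding c by (simp only: ac_simps distrib_left)
        then have "i * c = of_real a * i + of_real (- b)"
          by (simp add: i)
        then show ?thesis
          by (simp add: scale_left_distrib flip: of_real_minus)
      qed
      then have "f (s i (s c x)) = a * f (s i x) - b * f x"
        using x subspace_closure add[of "s (of_real a) (s i x)" "s (of_real (- b)) x"] scl[of x "- b"] scl[of "s i x" a] by auto
      ultimately show "F (s c x) = c * F x"
        unfolding F_def by (simp only:) (simp add: c algebra_simps i ii)
    qed
    moreover have "\<bar>f x\<bar> \<le> norm (F x)" for x
      unfolding F_def nrm by simp
    moreover have "c = f x" if "F x = of_real c" for c x
    proof -
      have "of_real (f x - c) + of_real (- f (s i x)) * i = 0"
        using that by (simp add: F_def algebra_simps)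
      then have "sqrt ((f x - c)\<^sup>2 + (- f (s i x))\<^sup>2) = 0"
        using nrm[of "f x - c" "- f (s i x)"] by simp
      then show ?thesis by (simp add: add_nonneg_eq_0_iff)
    qed
    ultimately show ?thesis by blast
  qed
  then obtain F where lin: "linear_on V s (*) F" and F: "\<And>x. x \<in> V \<Longrightarrow> \<bar>f x\<bar> \<le> norm (F x)"
    "\<And>x c. x \<in> V \<Longrightarrow> F x = of_real c \<Longrightarrow> c = f x" by blast
  have le: "norm (F x) \<le> p x" if x: "x \<in> V" for x
  proof -
    obtain c where c: "norm c = 1" "c * F x = of_real (norm (F x))"
      by (rule obtain_phase)
    have "F (s c x) = of_real (norm (F x))"
      using lin x c by (simp add: linear_on_def)
    then have "norm (F x) = f (s c x)"
      by (rule F(2)[OF subspace_closure(3)[OF x]])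
    also have "\<dots> \<le> p x"
      using le[OF subspace_closure(3)[OF x], of c] ps[OF x, of c] c(1) by simp
    finally show ?thesis .
  qed
  show ?thesis
    using that[OF lin le] le[OF x0] F(1)[OF x0] fx0 by simp
qed

end


section \<open>Spaces topologised by seminorms\<close>

text \<open>The reverse inequality comes from applying the given one to the inverse scalar. For
  \<open>c = 0\<close> it is \<open>0 \<le> p 0\<close>, which subadditivity provides.\<close>

lemma seminorm_onI:
  assumes vs: "vector_space s" and sub: "module.subspace s V"
    and add: "\<And>x y. x \<in> V \<Longrightarrow> y \<in> V \<Longrightarrow> p (x + y) \<le> p x + p y"
    and scl: "\<And>c x. x \<in> V \<Longrightarrow> p (s c x) \<le> norm c * p x"
  shows "seminorm_on V s p"
proof -
  interpret vector_space s by (rule vs)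
  have ge: "norm c * p x \<le> p (s c x)" if x: "x \<in> V" for c x
  proof (cases "c = 0")
    case True
    have "0 \<le> p 0" using add[of 0 0] subspace_0[OF sub] by simp
    then show ?thesis using True by simp
  next
    case False
    have "p (s (inverse c) (s c x)) \<le> norm (inverse c) * p (s c x)"
      by (rule scl[OF subspace_scale[OF sub x]])
    moreover have "s (inverse c) (s c x) = x" using False by simp
    ultimately have "p x \<le> inverse (norm c) * p (s c x)" unfolding norm_inverse by simp
    then show ?thesis using False by (simp add: field_simps)
  qed
  have "p (s c x) = norm c * p x" if "x \<in> V" for c x
    using scl[OF that] ge[OF that] by (rule antisym)
  with add show ?thesis unfolding seminorm_on_def by blast
qed

text \<open>Hausdorffness and non-triviality are kept apart from these axioms, so that the scalar
  field, the weighted spaces and the kappa-duals are all instances; lemmas that separate points take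
  Hausdorffness as a premise.\<close>

locale lcspace =
  fixes X :: "('k::real_or_complex, 'v::ab_group_add) lcs"
  assumes vector_space: "vector_space (scale X)"
    and subspace: "module.subspace (scale X) (carrier X)"
    and seminorms: "p \<in> seminorms X \<Longrightarrow> seminorm_on (carrier X) (scale X) p"
    and directed: "directed_system X"
begin

sublocale vector_space "scale X"
  by (rule vector_space)

lemma carrier_zero [simp, intro]: "0 \<in> carrier X"
  and carrier_add [simp, intro]: "x \<in> carrier X \<Longrightarrow> y \<in> carrier X \<Longrightarrow> x + y \<in> carrier X"
  and carrier_diff [simp, intro]: "x \<in> carrier X \<Longrightarrow> y \<in> carrier X \<Longrightarrow> x - y \<in> carrier X"
  and carrier_neg [simp, intro]: "x \<in> carrier X \<Longrightarrow> - x \<in> carrier X"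
  and carrier_scale [simp, intro]: "x \<in> carrier X \<Longrightarrow> scale X c x \<in> carrier X"
  using subspace subspace_0 subspace_add subspace_diff subspace_neg subspace_scale by auto

lemma seminorms_nonempty: "seminorms X \<noteq> {}"
  using directed by (simp add: directed_system_def)

lemma seminorm_triangle: "p \<in> seminorms X \<Longrightarrow> x \<in> carrier X \<Longrightarrow> y \<in> carrier X \<Longrightarrow> p (x + y) \<le> p x + p y"
  and seminorm_scale: "p \<in> seminorms X \<Longrightarrow> x \<in> carrier X \<Longrightarrow> p (scale X c x) = norm c * p x"
  using seminorms by (auto simp: seminorm_on_def)

lemma seminorm_zero [simp]: "p \<in> seminorms X \<Longrightarrow> p 0 = 0"
  using seminorm_scale[of p 0 0] by simp

lemma seminorm_neg: "p \<in> seminorms X \<Longrightarrow> x \<in> carrier X \<Longrightarrow> p (- x) = p x"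
  using seminorm_scale[of p x "- 1"] by simp

lemma seminorm_nonneg: "p \<in> seminorms X \<Longrightarrow> x \<in> carrier X \<Longrightarrow> 0 \<le> p x"
  using seminorm_triangle[of p x "- x"] seminorm_neg[of p x] by simp

lemma seminorm_minus_commute:
  "p \<in> seminorms X \<Longrightarrow> x \<in> carrier X \<Longrightarrow> y \<in> carrier X \<Longrightarrow> p (x - y) = p (y - x)"
  using seminorm_neg[of p "x - y"] by simp

lemma seminorm_triangle_diff:
  assumes "p \<in> seminorms X" "x \<in> carrier X" "y \<in> carrier X" "z \<in> carrier X"
  shows "p (x - z) \<le> p (x - y) + p (y - z)"
  using seminorm_triangle[of p "x - y" "y - z"] assms by simp

lemma directed_finite:
  assumes "finite P" "P \<subseteq> seminorms X"
  shows "\<exists>r\<in>seminorms X. \<exists>C>0. \<forall>p\<in>P. \<forall>x\<in>carrier X. p x \<le> C * r x"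
  using assms
proof (induction P rule: finite_induct)
  case empty
  obtain r where "r \<in> seminorms X" using seminorms_nonempty by blast
  then show ?case by (intro bexI[of _ r] exI[of _ 1]) auto
next
  case (insert p P)
  then obtain r C where r: "r \<in> seminorms X" "C > 0" "\<And>p x. p \<in> P \<Longrightarrow> x \<in> carrier X \<Longrightarrow> p x \<le> C * r x"
    by auto
  obtain r' C' where r': "r' \<in> seminorms X" "C' > 0"
    "\<And>x. x \<in> carrier X \<Longrightarrow> p x \<le> C' * r' x \<and> r x \<le> C' * r' x"
    using directed r(1) insert.prems unfolding directed_system_def by blast
  have "q x \<le> (C' + C * C') * r' x" if "q \<in> insert p P" "x \<in> carrier X" for q x
  proof (cases "q = p")
    case True
    have "0 \<le> C * C' * r' x"
      using r r' seminorm_nonneg[OF r'(1) that(2)] by simp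
    then show ?thesis
      using True r'(3)[OF that(2)] by (simp add: algebra_simps)
  next
    case False
    then have "q x \<le> C * r x" using r(3) that by auto
    also have "\<dots> \<le> C * (C' * r' x)"
      using r'(3)[OF that(2)] r(2) by simp
    also have "\<dots> \<le> (C' + C * C') * r' x"
      using r' seminorm_nonneg[OF r'(1) that(2)] by (simp add: algebra_simps)
    finally show ?thesis .
  qed
  then show ?case
    using r r' by (intro bexI[of _ r'] exI[of _ "C' + C * C'"]) (auto intro: add_pos_pos)
qed

lemma openin_iff:
  "openin (lcs_topology X) U \<longleftrightarrow> U \<subseteq> carrier X \<and>
     (\<forall>x\<in>U. \<exists>r\<in>seminorms X. \<exists>e>0. {y \<in> carrier X. r (y - x) < e} \<subseteq> U)"
proof (intro iffI conjI ballI)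
  fix x assume U: "openin (lcs_topology X) U" and x: "x \<in> U"
  then have xc: "x \<in> carrier X" by (auto simp: openin_lcs_topology)
  obtain P e where P: "finite P" "P \<subseteq> seminorms X" "e > 0"
    "{y \<in> carrier X. \<forall>p\<in>P. p (y - x) < e} \<subseteq> U"
    using U x unfolding openin_lcs_topology by blast
  obtain r C where r: "r \<in> seminorms X" "C > 0" "\<And>p x. p \<in> P \<Longrightarrow> x \<in> carrier X \<Longrightarrow> p x \<le> C * r x"
    using directed_finite[OF P(1,2)] by blast
  have "{y \<in> carrier X. r (y - x) < e / C} \<subseteq> {y \<in> carrier X. \<forall>p\<in>P. p (y - x) < e}"
  proof clarify
    fix y p assume y: "y \<in> carrier X" "r (y - x) < e / C" "p \<in> P"
    have "p (y - x) \<le> C * r (y - x)" using r y xc by blast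
    also have "\<dots> < e" using y r(2) by (simp add: field_simps)
    finally show "p (y - x) < e" .
  qed
  then show "\<exists>r\<in>seminorms X. \<exists>e>0. {y \<in> carrier X. r (y - x) < e} \<subseteq> U"
    using P r by (intro bexI[of _ r] exI[of _ "e / C"]) (auto intro: divide_pos_pos)
next
  show "openin (lcs_topology X) U \<Longrightarrow> U \<subseteq> carrier X"
    by (simp add: openin_lcs_topology)
next
  assume U: "U \<subseteq> carrier X \<and> (\<forall>x\<in>U. \<exists>r\<in>seminorms X. \<exists>e>0. {y \<in> carrier X. r (y - x) < e} \<subseteq> U)"
  show "openin (lcs_topology X) U"
    unfolding openin_lcs_topology
  proof (intro conjI ballI)
    fix x assume "x \<in> U"
    then obtain r e where "r \<in> seminorms X" "e > 0" "{y \<in> carrier X. r (y - x) < e} \<subseteq> U"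
      using U by blast
    then show "\<exists>P e. finite P \<and> P \<subseteq> seminorms X \<and> 0 < e \<and> {y \<in> carrier X. \<forall>p\<in>P. p (y - x) < e} \<subseteq> U"
      by (intro exI[of _ "{r}"] exI[of _ e]) auto
  qed (use U in blast)
qed

lemma openin_ball:
  assumes p: "p \<in> seminorms X" and a: "a \<in> carrier X"
  shows "openin (lcs_topology X) {y \<in> carrier X. p (y - a) < e}"
  unfolding openin_iff
proof (intro conjI ballI)
  fix x assume x: "x \<in> {y \<in> carrier X. p (y - a) < e}"
  have "{y \<in> carrier X. p (y - x) < e - p (x - a)} \<subseteq> {y \<in> carrier X. p (y - a) < e}"
    using seminorm_triangle_diff[OF p _ _ a, of _ x] x by force
  then show "\<exists>r\<in>seminorms X. \<exists>d>0. {y \<in> carrier X. r (y - x) < d} \<subseteq> {y \<in> carrier X. p (y - a) < e}"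
    using p x by (intro bexI[of _ p] exI[of _ "e - p (x - a)"]) auto
qed auto

text \<open>Rescale \<open>x\<close> into the ball of \<open>r\<close>: the factor 2 puts it at
  \<open>r\<close>-size \<open>e / 2\<close>, strictly inside. If \<open>r x = 0\<close>, all
  positive multiples of \<open>x\<close> are inside and homogeneity forces
  \<open>g x \<le> 0\<close>. Since \<open>g\<close> is any positively homogeneous function, this
  covers functionals, maps and differences of functionals.\<close>

lemma scaling_bound:
  assumes r: "r \<in> seminorms X" and e: "e > 0" and c: "c \<ge> 0"
    and g: "\<And>y. y \<in> carrier X \<Longrightarrow> r y < e \<Longrightarrow> g y \<le> c"
    and hom: "\<And>t y. t > 0 \<Longrightarrow> y \<in> carrier X \<Longrightarrow> g (scale X (of_real t) y) = t * g y"
    and x: "x \<in> carrier X"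
  shows "g x \<le> (2 * c / e) * r x"
proof (cases "r x = 0")
  case True
  have *: "t * g x \<le> c" if "t > 0" for t
  proof -
    have "g (scale X (of_real t) x) \<le> c"
      using that x True e by (intro g) (auto simp: seminorm_scale[OF r])
    then show ?thesis using hom[OF that x] by simp
  qed
  have "g x \<le> 0"
  proof (rule ccontr)
    assume "\<not> g x \<le> 0"
    then have gx: "g x > 0" by simp
    then have "(c + 1) / g x * g x \<le> c"
      using c by (intro *) simp
    then show False using gx by simp
  qed
  then show ?thesis using True by simp
next
  case False
  then have rx: "r x > 0" using seminorm_nonneg[OF r x] by simp
  define t where "t = e / (2 * r x)"
  have t: "t > 0" using rx e by (simp add: t_def)
  have "r (scale X (of_real t) x) = t * r x"
    using t seminorm_scale[OF r x, of "of_real t"] by simp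
  also have "\<dots> < e" using rx e by (simp add: t_def)
  finally have "g (scale X (of_real t) x) \<le> c"
    using x by (intro g) auto
  then have "t * g x \<le> c" using hom[OF t x] by simp
  then show ?thesis using rx e by (simp add: t_def field_simps)
qed

lemma zero_neighbourhood_imp:
  assumes "zero_neighbourhood X U"
  shows "\<exists>r\<in>seminorms X. \<exists>e>0. {y \<in> carrier X. r y < e} \<subseteq> U"
proof -
  have "0 \<in> lcs_topology X interior_of U"
    using assms by (simp add: zero_neighbourhood_def)
  then obtain T where T: "openin (lcs_topology X) T" "0 \<in> T" "T \<subseteq> U"
    by (auto simp: interior_of_def)
  then obtain r e where "r \<in> seminorms X" "e > 0" "{y \<in> carrier X. r (y - 0) < e} \<subseteq> T"
    unfolding openin_iff by blast
  then show ?thesis using T(3) by auto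
qed

lemma absolutely_convex_zero:
  assumes "absolutely_convex X D" shows "0 \<in> D"
proof -
  obtain x where x: "x \<in> D" using assms by (auto simp: absolutely_convex_def)
  moreover have "norm (0::'k) + norm (0::'k) \<le> 1" by simp
  ultimately have "scale X 0 x + scale X 0 x \<in> D"
    using assms unfolding absolutely_convex_def by blast
  then show ?thesis by simp
qed

lemma absolutely_convex_scale:
  assumes D: "absolutely_convex X D" and x: "x \<in> D" and c: "norm c \<le> 1"
  shows "scale X c x \<in> D"
proof -
  have "norm c + norm (0::'k) \<le> 1" using c by simp
  then have "scale X c x + scale X 0 x \<in> D"
    using D x unfolding absolutely_convex_def by blast
  then show ?thesis by simp
qed

lemma compactin_bounded:
  assumes K: "compactin (lcs_topology X) K"
  shows "bounded_in X K"
  unfolding bounded_in_def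
proof (intro conjI ballI)
  show KX: "K \<subseteq> carrier X" using compactin_subset_topspace[OF K] by simp
  fix p assume p: "p \<in> seminorms X"
  let ?U = "(\<lambda>n::nat. {y \<in> carrier X. p (y - 0) < real n}) ` UNIV"
  have "\<exists>\<F>. finite \<F> \<and> \<F> \<subseteq> ?U \<and> K \<subseteq> \<Union>\<F>"
  proof -
    have "\<forall>U\<in>?U. openin (lcs_topology X) U"
      using openin_ball[OF p carrier_zero] by blast
    moreover have "K \<subseteq> \<Union>?U"
      using KX reals_Archimedean2 by (fastforce dest: subsetD)
    ultimately show ?thesis using K unfolding compactin_def by blast
  qed
  then obtain \<F> where \<F>: "finite \<F>" "\<F> \<subseteq> ?U" "K \<subseteq> \<Union>\<F>" by blast
  obtain N where "finite N" "\<F> = (\<lambda>n::nat. {y \<in> carrier X. p (y - 0) < real n}) ` N"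
    using finite_subset_image[OF \<F>(1,2)] by blast
  then have N: "finite N" "K \<subseteq> (\<Union>n\<in>N. {y \<in> carrier X. p (y - 0) < real n})"
    using \<F>(3) by simp_all
  then have "p x \<le> (\<Sum>n\<in>N. real n)" if x: "x \<in> K" for x
  proof -
    obtain n where "n \<in> N" "p x < real n" using N x by auto
    then show ?thesis using member_le_sum[of n N real] N(1) by simp
  qed
  then show "bdd_above (p ` K)" by (intro bdd_aboveI[of _ "\<Sum>n\<in>N. real n"]) auto
qed

lemma precompact_cover:
  assumes K: "compactin (lcs_topology X) K" and p: "p \<in> seminorms X" and e: "e > 0"
  shows "\<exists>A. finite A \<and> A \<subseteq> K \<and> (\<forall>x\<in>K. \<exists>a\<in>A. p (x - a) < e)"
proof -
  have KX: "K \<subseteq> carrier X" using compactin_subset_topspace[OF K] by simp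
  let ?U = "(\<lambda>a. {y \<in> carrier X. p (y - a) < e}) ` K"
  have "\<exists>\<F>. finite \<F> \<and> \<F> \<subseteq> ?U \<and> K \<subseteq> \<Union>\<F>"
  proof -
    have "\<forall>U\<in>?U. openin (lcs_topology X) U"
      using openin_ball[OF p] KX by auto
    moreover have "K \<subseteq> \<Union>?U"
      using KX p e by auto
    ultimately show ?thesis using K unfolding compactin_def by blast
  qed
  then obtain \<F> where \<F>: "finite \<F>" "\<F> \<subseteq> ?U" "K \<subseteq> \<Union>\<F>" by blast
  obtain A where "A \<subseteq> K" "finite A" "\<F> = (\<lambda>a. {y \<in> carrier X. p (y - a) < e}) ` A"
    using finite_subset_image[OF \<F>(1,2)] by blast
  then show ?thesis using \<F>(3) by (intro exI[of _ A]) auto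
qed

lemma Hausdorff_zero:
  assumes H: "Hausdorff_space (lcs_topology X)" and x: "x \<in> carrier X"
    and z: "\<And>p. p \<in> seminorms X \<Longrightarrow> p x = 0"
  shows "x = 0"
proof (rule ccontr)
  assume "x \<noteq> 0"
  then obtain U V where UV: "openin (lcs_topology X) U" "openin (lcs_topology X) V" "0 \<in> U" "x \<in> V" "disjnt U V"
    using H x carrier_zero unfolding Hausdorff_space_def topspace_lcs_topology by blast
  then obtain r e where "r \<in> seminorms X" "e > 0" "{y \<in> carrier X. r (y - 0) < e} \<subseteq> U"
    unfolding openin_iff by blast
  then have "x \<in> {y \<in> carrier X. r (y - 0) < e}" using x z[of r] by simp
  then have "x \<in> U" using \<open>{y \<in> carrier X. r (y - 0) < e} \<subseteq> U\<close> by blast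
  then show False using UV by (auto simp: disjnt_def)
qed

end

text \<open>Stated for bare records and finite families of seminorms, because it is applied to
  \<open>eps_product\<close>, of which only closure under differences is established rather than
  \<open>lcspace\<close>.\<close>

lemma continuous_map_lcsI:
  fixes X :: "('k, 'v::ab_group_add) lcs" and Y :: "('k, 'w::ab_group_add) lcs"
  assumes diff: "\<And>x y. x \<in> carrier X \<Longrightarrow> y \<in> carrier X \<Longrightarrow> x - y \<in> carrier X \<and> f (x - y) = f x - f y"
    and car: "\<And>x. x \<in> carrier X \<Longrightarrow> f x \<in> carrier Y"
    and bd: "\<And>p. p \<in> seminorms Y \<Longrightarrow> \<exists>r\<in>seminorms X. \<exists>C>0. \<forall>x\<in>carrier X. p (f x) \<le> C * r x"
  shows "continuous_map (lcs_topology X) (lcs_topology Y) f"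
  unfolding continuous_map_def
proof (intro conjI allI impI)
  show "f \<in> topspace (lcs_topology X) \<rightarrow> topspace (lcs_topology Y)"
    using car by simp
  fix U assume U: "openin (lcs_topology Y) U"
  show "openin (lcs_topology X) {x \<in> topspace (lcs_topology X). f x \<in> U}"
    unfolding openin_lcs_topology
  proof (intro conjI ballI)
    fix x assume "x \<in> {x \<in> topspace (lcs_topology X). f x \<in> U}"
    then have x: "x \<in> carrier X" "f x \<in> U" by auto
    obtain P e where P: "finite P" "P \<subseteq> seminorms Y" "e > 0"
      "{y \<in> carrier Y. \<forall>p\<in>P. p (y - f x) < e} \<subseteq> U"
      using U x(2) unfolding openin_lcs_topology by blast
    have "\<forall>p\<in>P. \<exists>rC. fst rC \<in> seminorms X \<and> snd rC > (0::real) \<and>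
        (\<forall>x\<in>carrier X. p (f x) \<le> snd rC * fst rC x)"
      using bd P(2) by force
    from bchoice[OF this] obtain rC where rC: "\<forall>p\<in>P. fst (rC p) \<in> seminorms X \<and> snd (rC p) > (0::real) \<and>
        (\<forall>x\<in>carrier X. p (f x) \<le> snd (rC p) * fst (rC p) x)" by blast
    define r C where "r p = fst (rC p)" and "C p = snd (rC p)" for p
    have r: "\<And>p. p \<in> P \<Longrightarrow> r p \<in> seminorms X \<and> C p > 0"
      "\<And>p x. p \<in> P \<Longrightarrow> x \<in> carrier X \<Longrightarrow> p (f x) \<le> C p * r p x"
      using rC by (auto simp: r_def C_def)
    define d where "d = Min (insert 1 ((\<lambda>p. e / C p) ` P))"
    have d: "d > 0" "\<And>p. p \<in> P \<Longrightarrow> d \<le> e / C p"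
      using P r(1) by (auto simp: d_def Min_gr_iff)
    have "{y \<in> carrier X. \<forall>q\<in>r ` P. q (y - x) < d} \<subseteq> {x \<in> topspace (lcs_topology X). f x \<in> U}"
    proof clarify
      fix y assume y: "y \<in> carrier X" "\<forall>q\<in>r ` P. q (y - x) < d"
      have "p (f y - f x) < e" if p: "p \<in> P" for p
      proof -
        have "p (f y - f x) = p (f (y - x))" using diff x y by simp
        also have "\<dots> \<le> C p * r p (y - x)" using r(2)[OF p, of "y - x"] diff[OF y(1) x(1)] by blast
        also have "\<dots> < C p * d" using y p r(1) by simp
        also have "\<dots> \<le> e" using d(2)[OF p] r(1)[OF p] by (simp add: field_simps)
        finally show ?thesis .
      qed
      then show "y \<in> topspace (lcs_topology X) \<and> f y \<in> U"
        using P(4) car y by auto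
    qed
    then show "\<exists>P e. finite P \<and> P \<subseteq> seminorms X \<and> 0 < e \<and>
        {y \<in> carrier X. \<forall>p\<in>P. p (y - x) < e} \<subseteq> {x \<in> topspace (lcs_topology X). f x \<in> U}"
      using P d r(1) by (intro exI[of _ "r ` P"] exI[of _ d]) auto
  qed auto
qed

context lcspace
begin

lemma linear_on_neg: "linear_on (carrier X) (scale X) t f \<Longrightarrow> x \<in> carrier X \<Longrightarrow> f (- x) = - f x"
proof -
  assume f: "linear_on (carrier X) (scale X) t f" and x: "x \<in> carrier X"
  have "f (0 + 0) = f 0 + f 0" using f carrier_zero unfolding linear_on_def by blast
  then have "f 0 = 0" by simp
  moreover have "f (x + - x) = f x + f (- x)"
    using f x carrier_neg unfolding linear_on_def by blast
  ultimately show ?thesis by (simp add: eq_neg_iff_add_eq_0 add.commute)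
qed

lemma linear_on_diff:
  assumes f: "linear_on (carrier X) (scale X) t f" and x: "x \<in> carrier X" "y \<in> carrier X"
  shows "f (x - y) = f x - f y"
proof -
  have "f (x + - y) = f x + f (- y)"
    using f x carrier_neg unfolding linear_on_def by blast
  then show ?thesis using linear_on_neg[OF f x(2)] by simp
qed

lemma continuous_linear_bound:
  assumes Y: "lcspace Y" and f: "linear_on (carrier X) (scale X) (scale Y) f"
    and cont: "continuous_map (lcs_topology X) (lcs_topology Y) f" and p: "p \<in> seminorms Y"
  shows "\<exists>r\<in>seminorms X. \<exists>C>0. \<forall>x\<in>carrier X. p (f x) \<le> C * r x"
proof -
  interpret Y: lcspace Y by (rule Y)
  have car: "f x \<in> carrier Y" if "x \<in> carrier X" for x
    using cont that by (auto simp: continuous_map_def)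
  have "openin (lcs_topology X) {x \<in> topspace (lcs_topology X). f x \<in> {y \<in> carrier Y. p (y - 0) < 1}}"
    using cont Y.openin_ball[OF p Y.carrier_zero, of 1] unfolding continuous_map_def by blast
  moreover have "f 0 = 0"
    using linear_on_diff[OF f carrier_zero carrier_zero] by simp
  then have "0 \<in> {x \<in> topspace (lcs_topology X). f x \<in> {y \<in> carrier Y. p (y - 0) < 1}}"
    using p by simp
  ultimately obtain r e where r: "r \<in> seminorms X" "e > 0"
    "{y \<in> carrier X. r (y - 0) < e} \<subseteq> {x \<in> topspace (lcs_topology X). f x \<in> {y \<in> carrier Y. p (y - 0) < 1}}"
    unfolding openin_iff by blast
  have "p (f x) \<le> (2 * 1 / e) * r x" if x: "x \<in> carrier X" for x
  proof (rule scaling_bound[OF r(1,2) _ _ _ x])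
    fix t :: real and y assume t: "t > 0" and y: "y \<in> carrier X"
    have "f (scale X (of_real t) y) = scale Y (of_real t) (f y)"
      using f y unfolding linear_on_def by blast
    then show "p (f (scale X (of_real t) y)) = t * p (f y)"
      using Y.seminorm_scale[OF p car[OF y]] t by simp
  qed (use r(3) in \<open>auto simp: less_imp_le\<close>)
  then show ?thesis using r by (intro bexI[of _ r] exI[of _ "2 * 1 / e"]) auto
qed

end

lemma lcspace_scalars: "lcspace (scalars :: ('k::real_or_complex, 'k) lcs)"
proof
  show "scale scalars a (x + y) = scale scalars a x + scale scalars a y" for a x y :: 'k
    by (simp add: scalars_def algebra_simps)
  show "scale scalars (a + b) x = scale scalars a x + scale scalars b x" for a b x :: 'k
    by (simp add: scalars_def algebra_simps)
  show "scale scalars a (scale scalars b x) = scale scalars (a * b) x" for a b x :: 'k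
    by (simp add: scalars_def algebra_simps)
  show "scale scalars 1 x = x" for x :: 'k
    by (simp add: scalars_def)
  have "module (scale scalars :: 'k \<Rightarrow> 'k \<Rightarrow> 'k)"
    by unfold_locales (simp_all add: scalars_def algebra_simps)
  then show "module.subspace (scale scalars) (carrier (scalars :: ('k, 'k) lcs))"
    by (simp add: module.subspace_def scalars_def)
  show "seminorm_on (carrier scalars) (scale scalars) p" if "p \<in> seminorms scalars" for p :: "'k \<Rightarrow> real"
    using that by (simp add: seminorm_on_def scalars_def norm_triangle_ineq norm_mult)
  show "directed_system (scalars :: ('k, 'k) lcs)"
    by (auto simp: directed_system_def scalars_def intro!: exI[of _ 1])
qed

lemma lcs_topology_scalars: "lcs_topology (scalars :: ('k::real_or_complex, 'k) lcs) = euclidean"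
proof -
  interpret lcspace "scalars :: ('k, 'k) lcs" by (rule lcspace_scalars)
  show ?thesis
    unfolding topology_eq openin_iff open_openin[symmetric] open_dist
    by (auto simp: scalars_def dist_norm subset_iff)
qed


section \<open>Dual spaces\<close>

text \<open>Trades continuity for seminorm estimates; the working descriptions of
  \<open>dual X\<close> and of the epsilon-product are read off from it.\<close>

lemma continuous_linear_maps_iff:
  assumes "lcspace X" and "lcspace Y"
  shows "u \<in> continuous_linear_maps X Y \<longleftrightarrow> linear_on (carrier X) (scale X) (scale Y) u \<and>
    (\<forall>x\<in>carrier X. u x \<in> carrier Y) \<and>
    (\<forall>p\<in>seminorms Y. \<exists>r\<in>seminorms X. \<exists>C>0. \<forall>x\<in>carrier X. p (u x) \<le> C * r x) \<and>
    (\<forall>x. x \<notin> carrier X \<longrightarrow> u x = 0)" (is "?L \<longleftrightarrow> ?R")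
proof -
  interpret X: lcspace X by fact
  interpret Y: lcspace Y by fact
  show ?thesis
  proof
    assume L: ?L
    then have "continuous_map (lcs_topology X) (lcs_topology Y) u"
      by (simp add: continuous_linear_maps_def)
    moreover from this have "\<forall>x\<in>carrier X. u x \<in> carrier Y"
      by (auto simp: continuous_map_def)
    ultimately show ?R
      using L X.continuous_linear_bound[OF assms(2), of u] by (auto simp: continuous_linear_maps_def)
  next
    assume R: ?R
    then have "continuous_map (lcs_topology X) (lcs_topology Y) u"
      using X.linear_on_diff[of "scale Y" u] by (intro continuous_map_lcsI) auto
    then show ?L using R by (auto simp: continuous_linear_maps_def)
  qed
qed

lemma continuous_linear_maps_lincomb:
  assumes "lcspace X" "lcspace Y" and u: "u \<in> continuous_linear_maps X Y" and v: "v \<in> continuous_linear_maps X Y"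
  shows "(\<lambda>x. scale Y a (u x) + scale Y b (v x)) \<in> continuous_linear_maps X Y" (is "?w \<in> _")
proof -
  interpret X: lcspace X by fact
  interpret Y: lcspace Y by fact
  note iff = continuous_linear_maps_iff[OF assms(1,2)]
  have car: "u x \<in> carrier Y" "v x \<in> carrier Y" if "x \<in> carrier X" for x
    using u v that unfolding iff by auto
  have "\<exists>r\<in>seminorms X. \<exists>C>0. \<forall>x\<in>carrier X. p (?w x) \<le> C * r x" if p: "p \<in> seminorms Y" for p
  proof -
    obtain r C where r: "r \<in> seminorms X" "C > 0" "\<And>x. x \<in> carrier X \<Longrightarrow> p (u x) \<le> C * r x"
      using u p unfolding iff by blast
    obtain r' C' where r': "r' \<in> seminorms X" "C' > 0" "\<And>x. x \<in> carrier X \<Longrightarrow> p (v x) \<le> C' * r' x"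
      using v p unfolding iff by blast
    have "finite {r, r'}" "{r, r'} \<subseteq> seminorms X" using r r' by auto
    from X.directed_finite[OF this] obtain q B
      where q: "q \<in> seminorms X" "B > 0" "\<And>p x. p \<in> {r, r'} \<Longrightarrow> x \<in> carrier X \<Longrightarrow> p x \<le> B * q x"
      by blast
    define D where "D = (norm a * C + norm b * C') * B"
    \<comment> \<open>\<open>D\<close> vanishes for \<open>a = b = 0\<close>; the additional unit
      keeps the constant positive.\<close>
    have "p (?w x) \<le> (D + 1) * q x" if x: "x \<in> carrier X" for x
    proof -
      have "p (?w x) \<le> norm a * p (u x) + norm b * p (v x)"
        using Y.seminorm_triangle[OF p Y.carrier_scale[OF car(1)[OF x], of a] Y.carrier_scale[OF car(2)[OF x], of b]]
        by (simp add: Y.seminorm_scale[OF p] car[OF x])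
      also have "\<dots> \<le> norm a * (C * (B * q x)) + norm b * (C' * (B * q x))"
      proof (intro add_mono mult_left_mono norm_ge_zero)
        show "p (u x) \<le> C * (B * q x)"
          by (rule order_trans[OF r(3)[OF x] mult_left_mono[OF q(3)[of r x]]]) (use r(2) x in auto)
        show "p (v x) \<le> C' * (B * q x)"
          by (rule order_trans[OF r'(3)[OF x] mult_left_mono[OF q(3)[of r' x]]]) (use r'(2) x in auto)
      qed
      also have "\<dots> = D * q x" by (simp add: D_def algebra_simps)
      also have "\<dots> \<le> (D + 1) * q x" using X.seminorm_nonneg[OF q(1) x] by (simp add: distrib_right)
      finally show ?thesis .
    qed
    moreover have "D + 1 > 0" using q r r' unfolding D_def by (intro add_nonneg_pos mult_nonneg_nonneg add_nonneg_nonneg) auto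
    ultimately show ?thesis using q(1) by blast
  qed
  moreover have "linear_on (carrier X) (scale X) (scale Y) ?w"
    using u v unfolding iff linear_on_def by (simp add: Y.scale_right_distrib mult.commute)
  moreover have "\<forall>x\<in>carrier X. ?w x \<in> carrier Y" using car by simp
  moreover have "\<forall>x. x \<notin> carrier X \<longrightarrow> ?w x = 0" using u v unfolding iff by simp
  ultimately show ?thesis unfolding iff by blast
qed

lemma vector_space_pointwise_scale: "vector_space t \<Longrightarrow> vector_space (pointwise_scale t)"
  unfolding vector_space_def pointwise_scale_def by (auto simp: fun_eq_iff)

lemma vector_space_times: "vector_space ((*) :: 'k::field \<Rightarrow> 'k \<Rightarrow> 'k)"
  by unfold_locales (auto simp: algebra_simps)

section \<open>Polars and the kappa-dual\<close>

definition polar :: "('k::real_or_complex, 'v::ab_group_add) lcs \<Rightarrow> ('v \<Rightarrow> real) \<Rightarrow> ('v \<Rightarrow> 'k) set" where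
  "polar X r = {\<phi>. linear_on (carrier X) (scale X) (*) \<phi> \<and>
     (\<forall>x\<in>carrier X. norm (\<phi> x) \<le> r x) \<and> (\<forall>x. x \<notin> carrier X \<longrightarrow> \<phi> x = 0)}"

text \<open>Alaoglu's theorem. The product of the balls is compact by Tychonoff's theorem, and
  linearity is a closed condition for pointwise convergence. The factor \<open>{0}\<close> outside
  the carrier accounts for the extension by zero.\<close>

lemma compact_polar: "compact (polar X r)"
proof -
  define B where "B x = (if x \<in> carrier X then cball (0::'b) (r x) else {0})" for x
  have "compactin (product_topology (\<lambda>x. euclidean) UNIV) (PiE UNIV B)"
    unfolding compactin_PiE by (auto simp: B_def compact_cball_real_or_complex)
  then have comp: "compact (PiE UNIV B)"
    by (simp add: euclidean_product_topology)
  have cont: "continuous_on UNIV (\<lambda>\<phi>::'a \<Rightarrow> 'b. \<phi> x)" for x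
    by (rule continuous_on_product_coordinates)
  define L where "L = (\<Inter>x\<in>carrier X. \<Inter>y\<in>carrier X. {\<phi>::'a \<Rightarrow> 'b. \<phi> (x + y) = \<phi> x + \<phi> y}) \<inter>
      (\<Inter>c. \<Inter>x\<in>carrier X. {\<phi>. \<phi> (scale X c x) = c * \<phi> x})"
  have "closed L"
    unfolding L_def by (intro closed_Int closed_INT ballI closed_Collect_eq continuous_intros cont)
  then have "compact (PiE UNIV B \<inter> L)"
    using comp by (rule compact_Int_closed[rotated])
  moreover have "PiE UNIV B \<inter> L = polar X r"
  proof (intro equalityI subsetI)
    fix \<phi> assume \<phi>: "\<phi> \<in> PiE UNIV B \<inter> L"
    then have B: "\<phi> x \<in> B x" for x by (auto simp: PiE_iff)
    show "\<phi> \<in> polar X r"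
      unfolding polar_def
    proof (intro CollectI conjI ballI allI impI)
      show "linear_on (carrier X) (scale X) (*) \<phi>"
        using \<phi> by (auto simp: L_def linear_on_def)
      show "norm (\<phi> x) \<le> r x" if "x \<in> carrier X" for x
        using B[of x] that by (auto simp: B_def)
      show "\<phi> x = 0" if "x \<notin> carrier X" for x
        using B[of x] that by (auto simp: B_def)
    qed
  next
    fix \<phi> assume "\<phi> \<in> polar X r"
    then show "\<phi> \<in> PiE UNIV B \<inter> L"
      by (auto simp: polar_def L_def linear_on_def B_def PiE_iff)
  qed
  ultimately show ?thesis by simp
qed

definition kappa_norm :: "'v set \<Rightarrow> ('v \<Rightarrow> 'k::real_normed_vector) \<Rightarrow> real" where
  "kappa_norm K \<phi> = (SUP x\<in>K. norm (\<phi> x))"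

text \<open>The absolute bipolar, which serves as closed absolutely convex hull. Letting the bound
  \<open>c\<close> vary gives the same set as fixing it at 1 and saves rescaling functionals.
  Membership is tested on functionals alone, which suits vectors known only through their images
  under the dual.\<close>

definition bipolar :: "('k::real_or_complex, 'v::ab_group_add) lcs \<Rightarrow> 'v set \<Rightarrow> 'v set" where
  "bipolar X N = {x \<in> carrier X. \<forall>\<phi>\<in>dual X. \<forall>c\<ge>0. (\<forall>y\<in>N. norm (\<phi> y) \<le> c) \<longrightarrow> norm (\<phi> x) \<le> c}"

context lcspace
begin

lemma dual_iff:
  "\<phi> \<in> dual X \<longleftrightarrow> linear_on (carrier X) (scale X) (*) \<phi> \<and>
    (\<exists>r\<in>seminorms X. \<exists>C>0. \<forall>x\<in>carrier X. norm (\<phi> x) \<le> C * r x) \<and>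
    (\<forall>x. x \<notin> carrier X \<longrightarrow> \<phi> x = 0)"
  unfolding dual_def continuous_linear_maps_iff[OF lcspace_axioms lcspace_scalars]
  by (simp add: scalars_def)

lemma dual_linear: "\<phi> \<in> dual X \<Longrightarrow> linear_on (carrier X) (scale X) (*) \<phi>"
  by (simp add: dual_iff)

lemma dual_add: "\<phi> \<in> dual X \<Longrightarrow> x \<in> carrier X \<Longrightarrow> y \<in> carrier X \<Longrightarrow> \<phi> (x + y) = \<phi> x + \<phi> y"
  and dual_scale: "\<phi> \<in> dual X \<Longrightarrow> x \<in> carrier X \<Longrightarrow> \<phi> (scale X c x) = c * \<phi> x"
  using dual_linear[of \<phi>] by (simp_all add: linear_on_def)

lemma dual_diff: "\<phi> \<in> dual X \<Longrightarrow> x \<in> carrier X \<Longrightarrow> y \<in> carrier X \<Longrightarrow> \<phi> (x - y) = \<phi> x - \<phi> y"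
  using linear_on_diff[OF dual_linear] .

lemma dual_outside: "\<phi> \<in> dual X \<Longrightarrow> x \<notin> carrier X \<Longrightarrow> \<phi> x = 0"
  by (simp add: dual_iff)

lemma dual_bound: "\<phi> \<in> dual X \<Longrightarrow> \<exists>r\<in>seminorms X. \<exists>C>0. \<forall>x\<in>carrier X. norm (\<phi> x) \<le> C * r x"
  by (simp add: dual_iff)

lemma dual_continuous: "\<phi> \<in> dual X \<Longrightarrow> continuous_map (lcs_topology X) euclidean \<phi>"
  by (simp add: dual_def continuous_linear_maps_def lcs_topology_scalars)

lemma polar_dual:
  assumes "r \<in> seminorms X" "C > 0" "\<phi> \<in> polar X (\<lambda>x. C * r x)"
  shows "\<phi> \<in> dual X"
  using assms by (auto simp: dual_iff polar_def)

lemma polar_seminorm_dual: "r \<in> seminorms X \<Longrightarrow> \<phi> \<in> polar X r \<Longrightarrow> \<phi> \<in> dual X"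
  using polar_dual[of r 1 \<phi>] by simp

lemma polar_bound: "\<phi> \<in> polar X r \<Longrightarrow> x \<in> carrier X \<Longrightarrow> norm (\<phi> x) \<le> r x"
  by (simp add: polar_def)

text \<open>Hahn-Banach for the seminorm itself: \<open>p x\<close> is a maximum over
  \<open>polar X p\<close>. Estimates of seminorms thereby become estimates of functionals that are
  uniform on polars.\<close>

lemma polar_norming:
  assumes p: "p \<in> seminorms X" and x: "x \<in> carrier X"
  shows "\<exists>\<phi>\<in>polar X p. norm (\<phi> x) = p x"
proof -
  obtain F where F: "linear_on (carrier X) (scale X) (*) F"
    "\<And>x. x \<in> carrier X \<Longrightarrow> norm (F x) \<le> p x" "norm (F x) = p x"
    using Hahn_Banach[OF vector_space subspace seminorms[OF p] x] by blast
  have "ext0 (carrier X) F \<in> polar X p"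
    using F by (auto simp: polar_def ext0_def linear_on_def)
  then show ?thesis using F x by (intro bexI[of _ "ext0 (carrier X) F"]) (auto simp: ext0_def)
qed

lemma dual_separates:
  assumes "Hausdorff_space (lcs_topology X)" "x \<in> carrier X" "y \<in> carrier X"
    and "\<And>\<phi>. \<phi> \<in> dual X \<Longrightarrow> \<phi> x = \<phi> y"
  shows "x = y"
proof -
  have "p (x - y) = 0" if p: "p \<in> seminorms X" for p
  proof -
    obtain \<phi> where "\<phi> \<in> polar X p" "norm (\<phi> (x - y)) = p (x - y)"
      using polar_norming[OF p, of "x - y"] assms by auto
    moreover from this have "\<phi> (x - y) = 0"
      using assms polar_seminorm_dual[OF p, of \<phi>] by (simp add: dual_diff)
    ultimately show ?thesis by simp
  qed
  then have "x - y = 0"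
    using assms by (intro Hausdorff_zero) auto
  then show ?thesis by simp
qed

lemma dual_plus: "\<phi> \<in> dual X \<Longrightarrow> \<psi> \<in> dual X \<Longrightarrow> \<phi> + \<psi> \<in> dual X"
  using continuous_linear_maps_lincomb[OF lcspace_axioms lcspace_scalars, of \<phi> \<psi> 1 1]
  by (simp add: dual_def scalars_def plus_fun_def)

lemma dual_pointwise_scale: "\<phi> \<in> dual X \<Longrightarrow> pointwise_scale (*) c \<phi> \<in> dual X"
  using continuous_linear_maps_lincomb[OF lcspace_axioms lcspace_scalars, of \<phi> \<phi> c 0]
  by (simp add: dual_def scalars_def pointwise_scale_def)

lemma dual_zero: "0 \<in> dual X"
proof -
  obtain r where "r \<in> seminorms X" using seminorms_nonempty by blast
  then show ?thesis
    by (auto simp: dual_iff linear_on_def seminorm_nonneg intro!: bexI[of _ r] exI[of _ 1])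
qed

lemma dual_subspace: "module.subspace (pointwise_scale (*)) (dual X)"
proof -
  interpret D: vector_space "pointwise_scale ((*) :: 'k \<Rightarrow> 'k \<Rightarrow> 'k) :: 'k \<Rightarrow> ('v \<Rightarrow> 'k) \<Rightarrow> _"
    by (intro vector_space_pointwise_scale vector_space_times)
  show ?thesis
    unfolding D.subspace_def using dual_zero dual_plus dual_pointwise_scale by blast
qed

lemma dual_bounded_on:
  assumes "\<phi> \<in> dual X" "bounded_in X K"
  shows "bdd_above ((\<lambda>x. norm (\<phi> x)) ` K)"
proof -
  obtain r C where r: "r \<in> seminorms X" "C > 0" "\<And>x. x \<in> carrier X \<Longrightarrow> norm (\<phi> x) \<le> C * r x"
    using dual_bound[OF assms(1)] by blast
  have "bdd_above (r ` K)"
    using assms(2) r(1) by (auto simp: bounded_in_def)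
  then obtain M where M: "\<And>x. x \<in> K \<Longrightarrow> r x \<le> M"
    unfolding bdd_above_def by blast
  have "norm (\<phi> x) \<le> C * M" if "x \<in> K" for x
  proof -
    have "norm (\<phi> x) \<le> C * r x" using assms(2) that by (intro r(3)) (auto simp: bounded_in_def)
    also have "\<dots> \<le> C * M" using M[OF that] r(2) by simp
    finally show ?thesis .
  qed
  then show ?thesis by (intro bdd_aboveI[of _ "C * M"]) auto
qed

lemma kappa_norm_upper:
  assumes "\<phi> \<in> dual X" "compactin (lcs_topology X) K" "x \<in> K"
  shows "norm (\<phi> x) \<le> kappa_norm K \<phi>"
  unfolding kappa_norm_def
  using dual_bounded_on[OF assms(1) compactin_bounded[OF assms(2)]] assms(3) by (rule cSUP_upper[rotated])

lemma kappa_norm_least: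
  assumes "K \<noteq> {}" "\<And>x. x \<in> K \<Longrightarrow> norm (\<phi> x) \<le> c"
  shows "kappa_norm K \<phi> \<le> c"
  unfolding kappa_norm_def using assms by (intro cSUP_least) auto

lemma kappa_dual_simps [simp]:
  "carrier (kappa_dual X) = dual X" "scale (kappa_dual X) = pointwise_scale (*)"
  "seminorms (kappa_dual X) = {kappa_norm K |K. absolutely_convex X K \<and> compactin (lcs_topology X) K}"
  by (auto simp: kappa_dual_def kappa_norm_def[abs_def])

lemma continuous_map_plus:
  "continuous_map (prod_topology (lcs_topology X) (lcs_topology X)) (lcs_topology X) (\<lambda>(x, y). x + y)"
  unfolding continuous_map_def
proof (intro conjI allI impI)
  show "(\<lambda>(x, y). x + y) \<in> topspace (prod_topology (lcs_topology X) (lcs_topology X)) \<rightarrow> topspace (lcs_topology X)"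
    by auto
  fix U assume U: "openin (lcs_topology X) U"
  show "openin (prod_topology (lcs_topology X) (lcs_topology X))
      {z \<in> topspace (prod_topology (lcs_topology X) (lcs_topology X)). (case z of (x, y) \<Rightarrow> x + y) \<in> U}"
    unfolding openin_prod_topology_alt
  proof (intro allI impI)
    fix x y assume "(x, y) \<in> {z \<in> topspace (prod_topology (lcs_topology X) (lcs_topology X)). (case z of (x, y) \<Rightarrow> x + y) \<in> U}"
    then have xy: "x \<in> carrier X" "y \<in> carrier X" "x + y \<in> U" by auto
    obtain r e where r: "r \<in> seminorms X" "e > 0" "{z \<in> carrier X. r (z - (x + y)) < e} \<subseteq> U"
      using U xy(3) unfolding openin_iff by blast
    define B where "B a = {z \<in> carrier X. r (z - a) < e / 2}" for a
    have "openin (lcs_topology X) (B a)" if "a \<in> carrier X" for a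
      unfolding B_def by (rule openin_ball[OF r(1) that])
    moreover have "a \<in> B a" if "a \<in> carrier X" for a
      using r that by (auto simp: B_def)
    moreover have "a + b \<in> U" if "a \<in> B x" "b \<in> B y" for a b
    proof -
      have "r ((a - x) + (b - y)) \<le> r (a - x) + r (b - y)"
        using that xy r(1) by (intro seminorm_triangle) (auto simp: B_def)
      then have "r (a + b - (x + y)) < e"
        using that by (simp add: algebra_simps B_def)
      then show ?thesis using r(3) that by (auto simp: B_def)
    qed
    moreover have "z \<in> B a \<Longrightarrow> z \<in> carrier X" for a z
      by (auto simp: B_def)
    ultimately have "openin (lcs_topology X) (B x) \<and> openin (lcs_topology X) (B y) \<and> x \<in> B x \<and> y \<in> B y \<and>
        B x \<times> B y \<subseteq> {z \<in> topspace (prod_topology (lcs_topology X) (lcs_topology X)). (case z of (x, y) \<Rightarrow> x + y) \<in> U}"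
      using xy by auto
    then show "\<exists>A B. openin (lcs_topology X) A \<and> openin (lcs_topology X) B \<and> x \<in> A \<and> y \<in> B \<and>
        A \<times> B \<subseteq> {z \<in> topspace (prod_topology (lcs_topology X) (lcs_topology X)). (case z of (x, y) \<Rightarrow> x + y) \<in> U}"
      by blast
  qed
qed

text \<open>The sum \<open>K + L\<close> is compact as the image of a product under addition and
  contains both sets because each contains 0. It makes the seminorms of the kappa-dual
  directed.\<close>

lemma absolutely_convex_compact_sum:
  assumes K: "absolutely_convex X K" "compactin (lcs_topology X) K"
    and L: "absolutely_convex X L" "compactin (lcs_topology X) L"
  shows "\<exists>M. absolutely_convex X M \<and> compactin (lcs_topology X) M \<and> K \<subseteq> M \<and> L \<subseteq> M"
proof -
  define M where "M = (\<lambda>(x, y). x + y) ` (K \<times> L)"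
  have "compactin (lcs_topology X) M"
    unfolding M_def by (rule image_compactin[OF _ continuous_map_plus]) (simp add: compactin_Times K L)
  moreover have "absolutely_convex X M"
    unfolding absolutely_convex_def
  proof (intro conjI ballI allI impI)
    show "M \<subseteq> carrier X" using K L by (auto simp: M_def absolutely_convex_def)
    show "M \<noteq> {}" using K L by (auto simp: M_def absolutely_convex_def)
    fix x y and a b :: 'k assume xy: "x \<in> M" "y \<in> M" and ab: "norm a + norm b \<le> 1"
    obtain x1 x2 y1 y2 where "x = x1 + x2" "y = y1 + y2" "x1 \<in> K" "x2 \<in> L" "y1 \<in> K" "y2 \<in> L"
      using xy by (auto simp: M_def)
    moreover have "scale X a (x1 + x2) + scale X b (y1 + y2)
        = (scale X a x1 + scale X b y1) + (scale X a x2 + scale X b y2)"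
      by (simp add: scale_right_distrib)
    moreover have "scale X a x1 + scale X b y1 \<in> K" "scale X a x2 + scale X b y2 \<in> L"
      using K L ab \<open>x1 \<in> K\<close> \<open>x2 \<in> L\<close> \<open>y1 \<in> K\<close> \<open>y2 \<in> L\<close> unfolding absolutely_convex_def by blast+
    ultimately show "scale X a x + scale X b y \<in> M"
      unfolding M_def by force
  qed
  moreover have "K \<subseteq> M" "L \<subseteq> M"
    using absolutely_convex_zero[OF K(1)] absolutely_convex_zero[OF L(1)] by (force simp: M_def)+
  ultimately show ?thesis by blast
qed

lemma lcspace_kappa_dual: "lcspace (kappa_dual X)"
proof (rule lcspace.intro)
  show "vector_space (scale (kappa_dual X))"
    by (simp add: vector_space_pointwise_scale vector_space_times)
  show "module.subspace (scale (kappa_dual X)) (carrier (kappa_dual X))"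
    by (simp add: dual_subspace)
next
  fix p assume "p \<in> seminorms (kappa_dual X)"
  then obtain K where K: "absolutely_convex X K" "compactin (lcs_topology X) K" "p = kappa_norm K"
    by auto
  have ne: "K \<noteq> {}" using K(1) by (simp add: absolutely_convex_def)
  have scl: "kappa_norm K (pointwise_scale (*) c \<phi>) \<le> norm c * kappa_norm K \<phi>" if "\<phi> \<in> dual X" for c \<phi>
    using kappa_norm_upper[OF that K(2)]
    by (intro kappa_norm_least[OF ne]) (auto simp: pointwise_scale_def norm_mult intro!: mult_left_mono)
  show "seminorm_on (carrier (kappa_dual X)) (scale (kappa_dual X)) p"
    unfolding K(3) kappa_dual_simps
  proof (rule seminorm_onI[where s = "pointwise_scale (*)"])
    show "module.subspace (pointwise_scale (*)) (dual X)" by (rule dual_subspace)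
    show "kappa_norm K (pointwise_scale (*) c \<phi>) \<le> norm c * kappa_norm K \<phi>" if "\<phi> \<in> dual X" for c \<phi>
      by (rule scl[OF that])
    show "vector_space (pointwise_scale ((*) :: 'k \<Rightarrow> 'k \<Rightarrow> 'k) :: 'k \<Rightarrow> ('v \<Rightarrow> 'k) \<Rightarrow> _)"
      by (intro vector_space_pointwise_scale vector_space_times)
    fix \<phi> \<psi> assume d: "\<phi> \<in> dual X" "\<psi> \<in> dual X"
    show "kappa_norm K (\<phi> + \<psi>) \<le> kappa_norm K \<phi> + kappa_norm K \<psi>"
    proof (rule kappa_norm_least[OF ne])
      fix x assume "x \<in> K"
      then show "norm ((\<phi> + \<psi>) x) \<le> kappa_norm K \<phi> + kappa_norm K \<psi>"
        using kappa_norm_upper[OF d(1) K(2), of x] kappa_norm_upper[OF d(2) K(2), of x]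
          norm_triangle_ineq[of "\<phi> x" "\<psi> x"] by simp
    qed
  qed
next
  have "absolutely_convex X {0}" by (simp add: absolutely_convex_def)
  moreover have "compactin (lcs_topology X) {0}" by simp
  ultimately have ne: "seminorms (kappa_dual X) \<noteq> {}" by auto
  show "directed_system (kappa_dual X)"
    unfolding directed_system_def
  proof (intro conjI ballI ne)
    fix p q assume "p \<in> seminorms (kappa_dual X)" "q \<in> seminorms (kappa_dual X)"
    then obtain K L where K: "absolutely_convex X K" "compactin (lcs_topology X) K" "p = kappa_norm K"
      and L: "absolutely_convex X L" "compactin (lcs_topology X) L" "q = kappa_norm L"
      by auto
    obtain M where M: "absolutely_convex X M" "compactin (lcs_topology X) M" "K \<subseteq> M" "L \<subseteq> M"
      using absolutely_convex_compact_sum[OF K(1,2) L(1,2)] by blast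
    have "p \<phi> \<le> 1 * kappa_norm M \<phi> \<and> q \<phi> \<le> 1 * kappa_norm M \<phi>" if "\<phi> \<in> dual X" for \<phi>
      using kappa_norm_upper[OF that M(2)] K L M
      by (auto simp: absolutely_convex_def intro!: kappa_norm_least)
    then show "\<exists>r\<in>seminorms (kappa_dual X). \<exists>C>0. \<forall>x\<in>carrier (kappa_dual X). p x \<le> C * r x \<and> q x \<le> C * r x"
      using M by (intro bexI[of _ "kappa_norm M"] exI[of _ 1]) auto
  qed
qed

end


section \<open>Bipolars and the Mackey--Arens theorem\<close>

context lcspace
begin

text \<open>Equicontinuity at 0 with tolerance 1 gives a seminorm ball on which the whole family is
  bounded by 1; \<open>scaling_bound\<close> does the rest.\<close>

lemma equicontinuous_bound:
  assumes B: "equicontinuous X B"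
  shows "\<exists>r\<in>seminorms X. \<exists>C>0. \<forall>\<phi>\<in>B. \<forall>x\<in>carrier X. norm (\<phi> x) \<le> C * r x"
proof -
  have d: "\<phi> \<in> dual X" if "\<phi> \<in> B" for \<phi> using B that by (auto simp: equicontinuous_def)
  obtain U where U: "openin (lcs_topology X) U" "0 \<in> U" "\<And>y \<phi>. y \<in> U \<Longrightarrow> \<phi> \<in> B \<Longrightarrow> norm (\<phi> y - \<phi> 0) < 1"
  proof -
    have "\<forall>e>0. \<exists>U. openin (lcs_topology X) U \<and> 0 \<in> U \<and> (\<forall>y\<in>U. \<forall>\<phi>\<in>B. norm (\<phi> y - \<phi> 0) < e)"
      using B carrier_zero unfolding equicontinuous_def by blast
    from this[rule_format, OF zero_less_one] show ?thesis using that by blast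
  qed
  obtain r e where r: "r \<in> seminorms X" "e > 0" "{y \<in> carrier X. r (y - 0) < e} \<subseteq> U"
    using U(1,2) unfolding openin_iff by blast
  have "norm (\<phi> x) \<le> (2 * 1 / e) * r x" if \<phi>: "\<phi> \<in> B" and x: "x \<in> carrier X" for \<phi> x
  proof (rule scaling_bound[OF r(1,2) _ _ _ x])
    have "\<phi> 0 = 0" using dual_diff[OF d[OF \<phi>] x x] by simp
    then show "norm (\<phi> y) \<le> 1" if "y \<in> carrier X" "r y < e" for y
      using U(3)[of y \<phi>] r(3) that \<phi> by auto
    show "norm (\<phi> (scale X (of_real t) y)) = t * norm (\<phi> y)" if "t > 0" "y \<in> carrier X" for t y
      using dual_scale[OF d[OF \<phi>]] that by (simp add: norm_mult)
  qed simp
  then show ?thesis using r by (intro bexI[of _ r] exI[of _ "2 * 1 / e"]) auto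
qed

lemma equicontinuousI:
  assumes "B \<subseteq> dual X" "r \<in> seminorms X" "C > 0" "\<And>\<phi> x. \<phi> \<in> B \<Longrightarrow> x \<in> carrier X \<Longrightarrow> norm (\<phi> x) \<le> C * r x"
  shows "equicontinuous X B"
  unfolding equicontinuous_def
proof (intro conjI assms(1) ballI allI impI)
  fix x and e :: real assume x: "x \<in> carrier X" and e: "e > 0"
  have "norm (\<phi> y - \<phi> x) < e" if y: "y \<in> carrier X" "r (y - x) < e / C" and \<phi>: "\<phi> \<in> B" for y \<phi>
  proof -
    have "norm (\<phi> y - \<phi> x) = norm (\<phi> (y - x))"
      using dual_diff[of \<phi> y x] assms(1) x y \<phi> by auto
    also have "\<dots> \<le> C * r (y - x)" using assms(4)[OF \<phi>] x y by simp
    also have "\<dots> < e" using y(2) assms(3) by (simp add: field_simps)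
    finally show ?thesis .
  qed
  then show "\<exists>U. openin (lcs_topology X) U \<and> x \<in> U \<and> (\<forall>y\<in>U. \<forall>\<phi>\<in>B. norm (\<phi> y - \<phi> x) < e)"
    using openin_ball[OF assms(2) x, of "e / C"] x e assms(2,3)
    by (intro exI[of _ "{y \<in> carrier X. r (y - x) < e / C}"]) auto
qed

lemma dual_lincomb:
  assumes "finite \<Phi>" "\<Phi> \<subseteq> dual X" and \<psi>: "linear_on (dual X) (pointwise_scale (*)) (*) \<psi>"
  shows "(\<lambda>x. \<Sum>\<phi>\<in>\<Phi>. a \<phi> * \<phi> x) \<in> dual X \<and> \<psi> (\<lambda>x. \<Sum>\<phi>\<in>\<Phi>. a \<phi> * \<phi> x) = (\<Sum>\<phi>\<in>\<Phi>. a \<phi> * \<psi> \<phi>)"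
  using assms(1,2)
proof (induction \<Phi> rule: finite_induct)
  case empty
  have "\<psi> (0 + 0) = \<psi> 0 + \<psi> 0" using \<psi> dual_zero unfolding linear_on_def by blast
  then have "\<psi> 0 = 0" by simp
  then show ?case using dual_zero by (simp add: zero_fun_def)
next
  case (insert \<phi> \<Phi>)
  let ?\<theta> = "\<lambda>x. \<Sum>\<phi>\<in>\<Phi>. a \<phi> * \<phi> x"
  have eq: "(\<lambda>x. \<Sum>\<phi>\<in>insert \<phi> \<Phi>. a \<phi> * \<phi> x) = pointwise_scale (*) (a \<phi>) \<phi> + ?\<theta>"
    using insert by (auto simp: pointwise_scale_def fun_eq_iff)
  have d: "\<phi> \<in> dual X" "pointwise_scale (*) (a \<phi>) \<phi> \<in> dual X" "?\<theta> \<in> dual X"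
    using insert dual_pointwise_scale by auto
  have "\<psi> (pointwise_scale (*) (a \<phi>) \<phi> + ?\<theta>) = \<psi> (pointwise_scale (*) (a \<phi>) \<phi>) + \<psi> ?\<theta>"
    using \<psi> d unfolding linear_on_def by blast
  also have "\<psi> (pointwise_scale (*) (a \<phi>) \<phi>) = a \<phi> * \<psi> \<phi>"
    using \<psi> d unfolding linear_on_def by blast
  also have "\<psi> ?\<theta> = (\<Sum>\<phi>\<in>\<Phi>. a \<phi> * \<psi> \<phi>)" using insert by simp
  finally have "\<psi> (pointwise_scale (*) (a \<phi>) \<phi> + ?\<theta>) = (\<Sum>\<phi>\<in>insert \<phi> \<Phi>. a \<phi> * \<psi> \<phi>)"
    using insert by (simp del: plus_fun_apply)
  then show ?case
    unfolding eq using dual_plus[OF d(2,3)] by blast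
qed

text \<open>A point of \<open>K\<close> minimising the sum of the squares of the errors has no error at all: otherwise
  the first variation at the minimum separates \<open>\<psi>\<close> from \<open>K\<close>.\<close>

lemma Mackey_Arens_finite:
  assumes K: "absolutely_convex X K" "compactin (lcs_topology X) K"
    and \<psi>: "linear_on (dual X) (pointwise_scale (*)) (*) \<psi>"
    and bound: "\<And>\<phi>. \<phi> \<in> dual X \<Longrightarrow> norm (\<psi> \<phi>) \<le> kappa_norm K \<phi>"
    and \<Phi>: "finite \<Phi>" "\<Phi> \<subseteq> dual X"
  shows "\<exists>x\<in>K. \<forall>\<phi>\<in>\<Phi>. \<phi> x = \<psi> \<phi>"
proof -
  obtain re :: "'k \<Rightarrow> real" and cj where rc: "conjugation re cj"
    using conjugation_exists by blast
  have re_add: "re (z + w) = re z + re w" and re_real: "re (of_real a) = a" and re_le: "\<bar>re z\<bar> \<le> norm z"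
    and cj: "cj z * z = of_real ((norm z)\<^sup>2)"
    and expand: "(norm (b - of_real t * z))\<^sup>2 = (norm b)\<^sup>2 - 2 * t * re (cj b * z) + t\<^sup>2 * (norm z)\<^sup>2"
    for z w b :: 'k and a t :: real
    using rc unfolding conjugation_def by auto
  have re_diff: "re (z - w) = re z - re w" for z w using re_add[of "z - w" w] by simp
  have re_sum: "re (sum f A) = (\<Sum>x\<in>A. re (f x))" for f :: "('v \<Rightarrow> 'k) \<Rightarrow> 'k" and A
    using re_real[of 0] by (induction A rule: infinite_finite_induct) (auto simp: re_add)
  define G where "G x = (\<Sum>\<phi>\<in>\<Phi>. (norm (\<psi> \<phi> - \<phi> x))\<^sup>2)" for x
  have KX: "K \<subseteq> carrier X" and Kne: "K \<noteq> {}" using K(1) by (auto simp: absolutely_convex_def)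
  have "continuous_map (lcs_topology X) euclidean (\<lambda>x. (norm (\<psi> \<phi> - \<phi> x))\<^sup>2)" if "\<phi> \<in> \<Phi>" for \<phi>
  proof -
    have "continuous_map (lcs_topology X) euclidean ((\<lambda>z. (norm (\<psi> \<phi> - z))\<^sup>2) \<circ> \<phi>)"
    proof (rule continuous_map_compose)
      show "continuous_map (lcs_topology X) euclidean \<phi>"
        using dual_continuous that \<Phi>(2) by blast
      have "continuous_on UNIV (\<lambda>z. (norm (\<psi> \<phi> - z))\<^sup>2)" by (intro continuous_intros)
      then show "continuous_map euclidean euclidean (\<lambda>z. (norm (\<psi> \<phi> - z))\<^sup>2)" by simp
    qed
    then show ?thesis by (simp add: comp_def)
  qed
  then have "continuous_map (lcs_topology X) euclidean G"
    unfolding G_def by (rule continuous_map_sum[OF \<Phi>(1)])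
  from image_compactin[OF K(2) this] have "compact (G ` K)"
    by (simp add: compactin_euclidean_iff)
  then obtain d where d: "d \<in> K" "\<And>x. x \<in> K \<Longrightarrow> G d \<le> G x"
    using compact_attains_inf[of "G ` K"] Kne by auto
  define b where "b \<phi> = \<psi> \<phi> - \<phi> d" for \<phi>
  \<comment> \<open>\<open>\<theta>\<close> is the gradient of \<open>G\<close> at \<open>d\<close>,
    up to the factor -2: \<open>G (d + t (x - d))\<close> equals
    \<open>G d - 2 t re (\<theta> (x - d)) + t\<^sup>2 S\<close>. Minimality along segments in
    \<open>K\<close> thus bounds \<open>re (\<theta> x)\<close> by
    \<open>re (\<theta> d)\<close>.\<close>
  define \<theta> where "\<theta> = (\<lambda>x. \<Sum>\<phi>\<in>\<Phi>. cj (b \<phi>) * \<phi> x)"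
  have \<theta>: "\<theta> \<in> dual X" "\<psi> \<theta> = (\<Sum>\<phi>\<in>\<Phi>. cj (b \<phi>) * \<psi> \<phi>)"
    unfolding \<theta>_def using dual_lincomb[OF \<Phi> \<psi>] by auto
  have variation: "re (\<theta> x) \<le> re (\<theta> d)" if x: "x \<in> K" for x
  proof -
    define S where "S = (\<Sum>\<phi>\<in>\<Phi>. (norm (\<phi> (x - d)))\<^sup>2)"
    have S: "S \<ge> 0" unfolding S_def by (intro sum_nonneg) auto
    have xd: "x \<in> carrier X" "d \<in> carrier X" using x d KX by auto
    have *: "2 * re (\<theta> (x - d)) \<le> t * S" if t: "0 < t" "t \<le> 1" for t
    proof -
      have "norm (of_real (1 - t) :: 'k) + norm (of_real t :: 'k) \<le> 1"
        unfolding norm_of_real using t by simp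
      then have "scale X (of_real (1 - t)) d + scale X (of_real t) x \<in> K"
        using K(1) d(1) x unfolding absolutely_convex_def by blast
      moreover have "scale X (of_real (1 - t)) d + scale X (of_real t) x = d + scale X (of_real t) (x - d)"
        by (simp add: scale_left_diff_distrib scale_right_diff_distrib)
      ultimately have "G d \<le> G (d + scale X (of_real t) (x - d))"
        using d(2) by simp
      also have "\<dots> = (\<Sum>\<phi>\<in>\<Phi>. (norm (b \<phi> - of_real t * \<phi> (x - d)))\<^sup>2)"
      proof -
        have "\<phi> (d + scale X (of_real t) (x - d)) = \<phi> d + of_real t * \<phi> (x - d)" if "\<phi> \<in> \<Phi>" for \<phi>
          using dual_add[of \<phi> d] dual_scale[of \<phi> "x - d"] \<Phi>(2) that xd by auto
        then show ?thesis
          unfolding G_def b_def by (simp add: diff_diff_add)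
      qed
      also have "\<dots> = (\<Sum>\<phi>\<in>\<Phi>. (norm (b \<phi>))\<^sup>2) - 2 * t * (\<Sum>\<phi>\<in>\<Phi>. re (cj (b \<phi>) * \<phi> (x - d))) + t\<^sup>2 * S"
        unfolding expand S_def sum_distrib_left sum.distrib sum_subtractf ..
      also have "(\<Sum>\<phi>\<in>\<Phi>. (norm (b \<phi>))\<^sup>2) = G d" by (simp add: G_def b_def)
      also have "(\<Sum>\<phi>\<in>\<Phi>. re (cj (b \<phi>) * \<phi> (x - d))) = re (\<theta> (x - d))"
        unfolding \<theta>_def re_sum ..
      finally have "t * (2 * re (\<theta> (x - d))) \<le> t * (t * S)"
        by (simp add: power2_eq_square algebra_simps)
      then show ?thesis using t by simp
    qed
    have "re (\<theta> (x - d)) \<le> 0"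
    proof (rule ccontr)
      assume "\<not> re (\<theta> (x - d)) \<le> 0"
      then have r: "re (\<theta> (x - d)) > 0" by simp
      \<comment> \<open>This choice gives \<open>t * S \<le> re (\<theta> (x - d))\<close>, whereas
        \<open>*\<close> demands twice the right side below \<open>t * S\<close>. The denominator
        \<open>S + 1\<close> guards against \<open>S = 0\<close>.\<close>
      define t where "t = min 1 (re (\<theta> (x - d)) / (S + 1))"
      have t: "0 < t" "t \<le> 1" using r S by (auto simp: t_def)
      have "t * S \<le> re (\<theta> (x - d)) / (S + 1) * S"
        using S by (intro mult_right_mono) (auto simp: t_def)
      also have "\<dots> \<le> re (\<theta> (x - d))"
        using S r by (simp add: field_simps)
      finally show False using *[OF t] r by simp
    qed
    then show ?thesis using dual_diff[OF \<theta>(1) xd] re_diff by simp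
  qed
  \<comment> \<open>Rotating points of \<open>K\<close> turns the variational inequality into a
    bound of \<open>\<theta>\<close> on all of \<open>K\<close>, hence of
    \<open>\<psi> \<theta>\<close>. But \<open>re (\<psi> \<theta>)\<close> exceeds
    \<open>re (\<theta> d)\<close> by exactly \<open>G d\<close>, so \<open>G d\<close> is
    0.\<close>
  have "norm (\<psi> \<theta>) \<le> re (\<theta> d)"
  proof (rule order_trans[OF bound[OF \<theta>(1)] kappa_norm_least[OF Kne]])
    fix x assume x: "x \<in> K"
    obtain c where c: "norm c = 1" "c * \<theta> x = of_real (norm (\<theta> x))" by (rule obtain_phase)
    have "scale X c x \<in> K" using absolutely_convex_scale[OF K(1) x] c(1) by simp
    then have "re (\<theta> (scale X c x)) \<le> re (\<theta> d)" by (rule variation)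
    then show "norm (\<theta> x) \<le> re (\<theta> d)"
      using dual_scale[OF \<theta>(1)] x KX c(2) re_real by auto
  qed
  moreover have "re (\<psi> \<theta>) - re (\<theta> d) = G d"
  proof -
    have "\<psi> \<theta> - \<theta> d = (\<Sum>\<phi>\<in>\<Phi>. cj (b \<phi>) * b \<phi>)"
      unfolding \<theta>(2) unfolding \<theta>_def sum_subtractf[symmetric] right_diff_distrib[symmetric]
      by (simp only: b_def)
    also have "\<dots> = of_real (G d)"
      unfolding cj of_real_sum G_def b_def ..
    finally show ?thesis
      unfolding re_diff[symmetric] by (simp only: re_real)
  qed
  ultimately have "G d \<le> 0"
    using re_le[of "\<psi> \<theta>"] by simp
  moreover have "G d \<ge> 0" unfolding G_def by (intro sum_nonneg) auto
  ultimately have "G d = 0" by simp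
  then have "\<forall>\<phi>\<in>\<Phi>. (norm (\<psi> \<phi> - \<phi> d))\<^sup>2 = 0"
    unfolding G_def using \<Phi>(1) by (subst (asm) sum_nonneg_eq_0_iff) auto
  then show ?thesis using d(1) by (intro bexI[of _ d]) auto
qed

text \<open>After division by \<open>C\<close>, any finitely many of the closed conditions
  \<open>\<phi> x = \<psi>' \<phi>\<close> hold at some point of \<open>K\<close>; compactness gives
  one point of \<open>K\<close> for all of them. Multiplying that point by \<open>C\<close> undoes
  the normalisation.\<close>

lemma Mackey_Arens:
  assumes K: "absolutely_convex X K" "compactin (lcs_topology X) K"
    and \<psi>: "linear_on (dual X) (pointwise_scale (*)) (*) \<psi>"
    and bound: "\<And>\<phi>. \<phi> \<in> dual X \<Longrightarrow> norm (\<psi> \<phi>) \<le> C * kappa_norm K \<phi>"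
    and C: "C > 0"
  shows "\<exists>x\<in>carrier X. \<forall>\<phi>\<in>dual X. \<phi> x = \<psi> \<phi>"
proof -
  define \<psi>' where "\<psi>' \<phi> = of_real (1 / C) * \<psi> \<phi>" for \<phi>
  have \<psi>': "linear_on (dual X) (pointwise_scale (*)) (*) \<psi>'"
    using \<psi> by (auto simp: linear_on_def \<psi>'_def algebra_simps)
  have bound': "norm (\<psi>' \<phi>) \<le> kappa_norm K \<phi>" if "\<phi> \<in> dual X" for \<phi>
    using bound[OF that] C by (simp add: \<psi>'_def norm_mult norm_divide field_simps)
  have KX: "K \<subseteq> carrier X" using K(1) by (auto simp: absolutely_convex_def)
  define \<U> where "\<U> = (\<lambda>\<phi>. {x \<in> carrier X. \<phi> x = \<psi>' \<phi>}) ` dual X"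
  have "K \<inter> \<Inter>\<U> \<noteq> {}"
  proof -
    have "\<forall>U\<in>\<U>. closedin (lcs_topology X) U"
    proof
      fix U assume "U \<in> \<U>"
      then obtain \<phi> where \<phi>: "\<phi> \<in> dual X" "U = {x \<in> carrier X. \<phi> x = \<psi>' \<phi>}" by (auto simp: \<U>_def)
      have "closedin (lcs_topology X) {x \<in> topspace (lcs_topology X). \<phi> x \<in> {\<psi>' \<phi>}}"
        by (rule closedin_continuous_map_preimage[OF dual_continuous[OF \<phi>(1)]]) simp
      then show "closedin (lcs_topology X) U" using \<phi>(2) by simp
    qed
    moreover have "K \<inter> \<Inter>\<F> \<noteq> {}" if \<F>: "finite \<F>" "\<F> \<subseteq> \<U>" for \<F>
    proof -
      obtain \<Phi> where \<Phi>: "\<Phi> \<subseteq> dual X" "finite \<Phi>" "\<F> = (\<lambda>\<phi>. {x \<in> carrier X. \<phi> x = \<psi>' \<phi>}) ` \<Phi>"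
        using finite_subset_image[OF \<F>(1)] \<F>(2) unfolding \<U>_def by blast
      obtain x where "x \<in> K" "\<forall>\<phi>\<in>\<Phi>. \<phi> x = \<psi>' \<phi>"
        using Mackey_Arens_finite[OF K \<psi>' bound' \<Phi>(2,1)] by blast
      then show ?thesis using \<Phi>(3) KX by blast
    qed
    ultimately show ?thesis
      using K(2) unfolding compactin_fip by blast
  qed
  then obtain x where x: "x \<in> K" "\<And>\<phi>. \<phi> \<in> dual X \<Longrightarrow> \<phi> x = \<psi>' \<phi>"
    unfolding \<U>_def by blast
  have "\<phi> (scale X (of_real C) x) = \<psi> \<phi>" if "\<phi> \<in> dual X" for \<phi>
  proof -
    have "\<phi> (scale X (of_real C) x) = of_real C * (of_real (1 / C) * \<psi> \<phi>)"
      using dual_scale[OF that, of x "of_real C"] x(1) x(2)[OF that] KX by (auto simp: \<psi>'_def)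
    also have "\<dots> = \<psi> \<phi>" using C by simp
    finally show ?thesis .
  qed
  then show ?thesis using x KX by (intro bexI[of _ "scale X (of_real C) x"]) auto
qed

section \<open>Bipolars as closed absolutely convex hulls\<close>

lemma bipolar_subset: "bipolar X N \<subseteq> carrier X"
  by (auto simp: bipolar_def)

lemma subset_bipolar: "N \<subseteq> carrier X \<Longrightarrow> N \<subseteq> bipolar X N"
  by (auto simp: bipolar_def)

lemma bipolar_bound:
  "x \<in> bipolar X N \<Longrightarrow> \<phi> \<in> dual X \<Longrightarrow> c \<ge> 0 \<Longrightarrow> (\<And>y. y \<in> N \<Longrightarrow> norm (\<phi> y) \<le> c) \<Longrightarrow> norm (\<phi> x) \<le> c"
  unfolding bipolar_def by blast

lemma absolutely_convex_bipolar: "absolutely_convex X (bipolar X N)"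
  unfolding absolutely_convex_def
proof (intro conjI ballI allI impI)
  have "norm (\<phi> 0) \<le> c" if "\<phi> \<in> dual X" "c \<ge> 0" for \<phi> c
    using dual_diff[OF that(1) carrier_zero carrier_zero] that(2) by simp
  then have "0 \<in> bipolar X N"
    unfolding bipolar_def by blast
  then show "bipolar X N \<noteq> {}" by blast
  fix x y and a b :: 'k assume x: "x \<in> bipolar X N" and y: "y \<in> bipolar X N" and ab: "norm a + norm b \<le> 1"
  have xy: "x \<in> carrier X" "y \<in> carrier X" using x y bipolar_subset by auto
  show "scale X a x + scale X b y \<in> bipolar X N"
    unfolding bipolar_def
  proof (intro CollectI conjI ballI allI impI)
    show "scale X a x + scale X b y \<in> carrier X" using xy by auto
    fix \<phi> c assume \<phi>: "\<phi> \<in> dual X" and c: "(0::real) \<le> c" "\<forall>y\<in>N. norm (\<phi> y) \<le> c"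
    have "norm (\<phi> (scale X a x + scale X b y)) \<le> norm a * norm (\<phi> x) + norm b * norm (\<phi> y)"
      using dual_add[OF \<phi>] dual_scale[OF \<phi>] xy norm_triangle_ineq[of "a * \<phi> x" "b * \<phi> y"] by (simp add: norm_mult)
    also have "\<dots> \<le> norm a * c + norm b * c"
      using bipolar_bound[OF x \<phi> c(1)] bipolar_bound[OF y \<phi> c(1)] c(2) by (intro add_mono mult_left_mono) auto
    also have "\<dots> \<le> 1 * c" using ab c(1) unfolding distrib_right[symmetric] by (intro mult_right_mono)
    finally show "norm (\<phi> (scale X a x + scale X b y)) \<le> c" by simp
  qed
qed (use bipolar_subset in auto)

lemma closedin_bipolar: "closedin (lcs_topology X) (bipolar X N)"
proof -
  define I where "I = {(\<phi>, c). \<phi> \<in> dual X \<and> c \<ge> 0 \<and> (\<forall>y\<in>N. norm (\<phi> y) \<le> c)}"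
  define H where "H z = {x \<in> carrier X. norm (fst z x) \<le> snd z}" for z :: "('v \<Rightarrow> 'k) \<times> real"
  have "bipolar X N = (\<Inter>z\<in>I. H z)"
  proof (intro equalityI subsetI)
    fix x assume "x \<in> bipolar X N"
    then show "x \<in> (\<Inter>z\<in>I. H z)" by (auto simp: bipolar_def I_def H_def)
  next
    fix x assume x: "x \<in> (\<Inter>z\<in>I. H z)"
    have "(0, 0) \<in> I" using dual_zero by (simp add: I_def)
    then have "x \<in> carrier X" using x by (auto simp: H_def)
    moreover have "norm (\<phi> x) \<le> c" if "(\<phi>, c) \<in> I" for \<phi> c
      using x that by (force simp: H_def)
    ultimately show "x \<in> bipolar X N" by (simp add: bipolar_def I_def)
  qed
  moreover have "closedin (lcs_topology X) (H z)" if "z \<in> I" for z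
  proof -
    have "fst z \<in> dual X" using that by (auto simp: I_def)
    then show ?thesis
      using closedin_continuous_map_preimage[OF dual_continuous, of "fst z" "cball 0 (snd z)"] by (simp add: H_def)
  qed
  moreover have "I \<noteq> {}" using dual_zero by (auto simp: I_def intro!: exI[of _ 0])
  ultimately show ?thesis by (simp add: closedin_INT)
qed

lemma bounded_bipolar:
  assumes N: "bounded_in X N" shows "bounded_in X (bipolar X N)"
  unfolding bounded_in_def
proof (intro conjI ballI bipolar_subset)
  fix p assume p: "p \<in> seminorms X"
  have "bdd_above (p ` N)" using N p by (auto simp: bounded_in_def)
  then obtain M where M: "\<And>x. x \<in> N \<Longrightarrow> p x \<le> M" unfolding bdd_above_def by blast
  \<comment> \<open>For empty \<open>N\<close> the bound \<open>M\<close> may be negative, and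
    \<open>bipolar_bound\<close> asks for a nonnegative one.\<close>
  have "p x \<le> max M 0" if x: "x \<in> bipolar X N" for x
  proof -
    have "x \<in> carrier X" using x by (simp add: bipolar_def)
    then obtain \<phi> where \<phi>: "\<phi> \<in> polar X p" "norm (\<phi> x) = p x"
      using polar_norming[OF p] by blast
    have "norm (\<phi> y) \<le> max M 0" if "y \<in> N" for y
    proof -
      have "norm (\<phi> y) \<le> p y"
        using N that by (intro polar_bound[OF \<phi>(1)]) (auto simp: bounded_in_def)
      also have "\<dots> \<le> max M 0" using M[OF that] by simp
      finally show ?thesis .
    qed
    then have "norm (\<phi> x) \<le> max M 0"
      by (rule bipolar_bound[OF x polar_seminorm_dual[OF p \<phi>(1)] max.cobounded2])
    then show ?thesis using \<phi>(2) by simp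
  qed
  then show "bdd_above (p ` bipolar X N)" by (intro bdd_aboveI[of _ "max M 0"]) auto
qed

lemma semi_Montel_compact_bipolar:
  assumes "semi_Montel X" "bounded_in X N" shows "compactin (lcs_topology X) (bipolar X N)"
proof -
  have "lcs_topology X closure_of bipolar X N = bipolar X N"
    using closedin_bipolar by (simp add: closure_of_closedin)
  then show ?thesis
    using assms(1)[unfolded semi_Montel_def, rule_format, OF bounded_bipolar[OF assms(2)]] by simp
qed

end


section \<open>Weighted spaces and the \<open>\<epsilon>\<close>-product\<close>

text \<open>Both spaces of the theorem are instances: the scalar field and \<open>E\<close> are
  substituted for \<open>Y\<close> with the same \<open>\<omega>\<close> and
  \<open>\<nu>\<close>.\<close>

locale weighted_space = Y: lcspace Y
  for Y :: "('k::real_or_complex, 'y::ab_group_add) lcs" +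
  fixes \<omega> :: "'m \<Rightarrow> 'w set" and \<nu> :: "'j \<Rightarrow> 'm \<Rightarrow> 'w \<Rightarrow> real"
    and D :: "('x, 'w, 'm, 'y) operator_data"
  assumes weights: "weight_functions \<omega> \<nu>" and admissible: "admissible_data \<omega> Y D"
begin

definition weighted_norm :: "'j \<Rightarrow> 'm \<Rightarrow> ('y \<Rightarrow> real) \<Rightarrow> ('x \<Rightarrow> 'y) \<Rightarrow> real" where
  "weighted_norm j m p f = (SUP x\<in>\<omega> m. p (opr D m f x) * \<nu> j m x)"

lemma FV_simps [simp]:
  "scale (FV_space \<omega> \<nu> Y D) = pointwise_scale (scale Y)"
  "seminorms (FV_space \<omega> \<nu> Y D) = {weighted_norm j m p |j m p. p \<in> seminorms Y}"
  by (auto simp: FV_space_def weighted_norm_def[abs_def])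

lemma nonempty: "\<omega> m \<noteq> {}" and weight_nonneg: "x \<in> \<omega> m \<Longrightarrow> 0 \<le> \<nu> j m x"
  and weight_pos: "x \<in> \<omega> m \<Longrightarrow> \<exists>j. 0 < \<nu> j m x"
  using weights by (auto simp: weight_functions_def)

sublocale FS: vector_space "pointwise_scale (scale Y)"
  by (rule vector_space_pointwise_scale[OF Y.vector_space])

lemma F_space_subspace: "FS.subspace (F_space D)"
proof -
  have "FS.subspace (AP D)" "\<And>m. FS.subspace (op_dom D m)"
    using admissible by (auto simp: admissible_data_def)
  then show ?thesis
    unfolding F_space_def by (auto intro!: FS.subspace_inter FS.subspace_Inter)
qed

lemma F_values: "f \<in> F_space D \<Longrightarrow> f x \<in> carrier Y"
  using admissible by (auto simp: F_space_def admissible_data_def)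

lemma opr_carrier: "f \<in> F_space D \<Longrightarrow> x \<in> \<omega> m \<Longrightarrow> opr D m f x \<in> carrier Y"
  and opr_add: "f \<in> F_space D \<Longrightarrow> g \<in> F_space D \<Longrightarrow> x \<in> \<omega> m \<Longrightarrow> opr D m (f + g) x = opr D m f x + opr D m g x"
  and opr_scale: "f \<in> F_space D \<Longrightarrow> x \<in> \<omega> m \<Longrightarrow> opr D m (pointwise_scale (scale Y) c f) x = scale Y c (opr D m f x)"
  using admissible by (auto simp: F_space_def admissible_data_def linear_on_def)

lemma carrier_FV: "f \<in> carrier (FV_space \<omega> \<nu> Y D) \<longleftrightarrow> f \<in> F_space D \<and>
    (\<forall>j m. \<forall>p\<in>seminorms Y. \<exists>M. \<forall>x\<in>\<omega> m. p (opr D m f x) * \<nu> j m x \<le> M)"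
  by (auto simp: FV_space_def bdd_above_def)

lemma carrier_FV_F: "f \<in> carrier (FV_space \<omega> \<nu> Y D) \<Longrightarrow> f \<in> F_space D"
  by (simp add: carrier_FV)

lemma weighted_norm_upper:
  assumes "f \<in> carrier (FV_space \<omega> \<nu> Y D)" "p \<in> seminorms Y" "x \<in> \<omega> m"
  shows "p (opr D m f x) * \<nu> j m x \<le> weighted_norm j m p f"
proof -
  have "bdd_above ((\<lambda>x. p (opr D m f x) * \<nu> j m x) ` \<omega> m)"
    using assms by (simp add: FV_space_def)
  then show ?thesis
    unfolding weighted_norm_def by (rule cSUP_upper[OF assms(3)])
qed

lemma weighted_norm_least:
  "(\<And>x. x \<in> \<omega> m \<Longrightarrow> p (opr D m f x) * \<nu> j m x \<le> c) \<Longrightarrow> weighted_norm j m p f \<le> c"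
  unfolding weighted_norm_def by (intro cSUP_least nonempty) auto

lemma opr_add_le:
  assumes fg: "f \<in> carrier (FV_space \<omega> \<nu> Y D)" "g \<in> carrier (FV_space \<omega> \<nu> Y D)"
    and p: "p \<in> seminorms Y" and x: "x \<in> \<omega> m"
  shows "p (opr D m (f + g) x) * \<nu> j m x \<le> weighted_norm j m p f + weighted_norm j m p g"
proof -
  note F = fg[THEN carrier_FV_F]
  have "p (opr D m (f + g) x) * \<nu> j m x \<le> (p (opr D m f x) + p (opr D m g x)) * \<nu> j m x"
    using Y.seminorm_triangle[OF p opr_carrier[OF F(1) x] opr_carrier[OF F(2) x]] weight_nonneg[OF x]
    by (simp add: opr_add[OF F x] mult_right_mono)
  also have "\<dots> \<le> weighted_norm j m p f + weighted_norm j m p g"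
    using weighted_norm_upper[OF fg(1) p x, of j] weighted_norm_upper[OF fg(2) p x, of j]
    by (simp add: distrib_right)
  finally show ?thesis .
qed

lemma opr_scale_le:
  assumes f: "f \<in> carrier (FV_space \<omega> \<nu> Y D)" and p: "p \<in> seminorms Y" and x: "x \<in> \<omega> m"
  shows "p (opr D m (pointwise_scale (scale Y) c f) x) * \<nu> j m x \<le> norm c * weighted_norm j m p f"
  using weighted_norm_upper[OF f p x, of j] Y.seminorm_scale[OF p opr_carrier[OF carrier_FV_F[OF f] x]]
  by (simp add: opr_scale[OF carrier_FV_F[OF f] x] mult.assoc mult_left_mono)

lemma FV_subspace: "FS.subspace (carrier (FV_space \<omega> \<nu> Y D))"
  unfolding FS.subspace_def
proof (intro conjI ballI allI)
  have F0: "0 \<in> F_space D" by (rule FS.subspace_0[OF F_space_subspace])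
  have "opr D m 0 x = 0" if "x \<in> \<omega> m" for m x
    using opr_add[OF F0 F0 that] by simp
  then show "0 \<in> carrier (FV_space \<omega> \<nu> Y D)"
    unfolding carrier_FV using F0 by (auto intro!: exI[of _ 0])
next
  fix f g assume fg: "f \<in> carrier (FV_space \<omega> \<nu> Y D)" "g \<in> carrier (FV_space \<omega> \<nu> Y D)"
  show "f + g \<in> carrier (FV_space \<omega> \<nu> Y D)"
    unfolding carrier_FV
    using FS.subspace_add[OF F_space_subspace fg[THEN carrier_FV_F]] opr_add_le[OF fg] by blast
next
  fix c f assume f: "f \<in> carrier (FV_space \<omega> \<nu> Y D)"
  show "pointwise_scale (scale Y) c f \<in> carrier (FV_space \<omega> \<nu> Y D)"
    unfolding carrier_FV
    using FS.subspace_scale[OF F_space_subspace carrier_FV_F[OF f]] opr_scale_le[OF f] by blast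
qed

lemma seminorm_on_weighted_norm:
  assumes p: "p \<in> seminorms Y"
  shows "seminorm_on (carrier (FV_space \<omega> \<nu> Y D)) (pointwise_scale (scale Y)) (weighted_norm j m p)"
  using FV_subspace opr_add_le[OF _ _ p] opr_scale_le[OF _ p]
  by (intro seminorm_onI FS.vector_space_axioms weighted_norm_least) auto

lemma lcspace_FV:
  assumes "directed_system (FV_space \<omega> \<nu> Y D)" shows "lcspace (FV_space \<omega> \<nu> Y D)"
  using FS.vector_space_axioms FV_subspace assms seminorm_on_weighted_norm
  by (intro lcspace.intro) auto

end

locale epsilon_setting =
  fixes E :: "('k::real_or_complex, 'e::ab_group_add) lcs"
    and \<omega> :: "'m \<Rightarrow> 'w set"
    and \<nu> :: "'j \<Rightarrow> 'm \<Rightarrow> 'w \<Rightarrow> real"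
    and DE :: "('x, 'w, 'm, 'e) operator_data"
    and DK :: "('x, 'w, 'm, 'k) operator_data"
  assumes lcHs: "lcHs E"
    and generator: "generator \<omega> \<nu> E DE DK"
    and strong: "strong \<omega> \<nu> E DE DK"
    and consistent: "consistent \<omega> \<nu> E DE DK"
begin

abbreviation X where "X \<equiv> FV_space \<omega> \<nu> (scalars :: ('k, 'k) lcs) DK"
abbreviation Z where "Z \<equiv> FV_space \<omega> \<nu> E DE"
abbreviation XE where "XE \<equiv> eps_product X E"

sublocale E: lcspace E
  using lcHs by (intro lcspace.intro) (auto simp: lcHs_def)

sublocale WZ: weighted_space E \<omega> \<nu> DE
  using generator by unfold_locales (auto simp: generator_def)

sublocale K: lcspace "scalars :: ('k, 'k) lcs"
  by (rule lcspace_scalars)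

sublocale WX: weighted_space "scalars :: ('k, 'k) lcs" \<omega> \<nu> DK
  using generator by unfold_locales (auto simp: generator_def)

sublocale X: lcspace X
  using generator by (intro WX.lcspace_FV) (auto simp: generator_def Let_def)

sublocale Z: lcspace Z
  using generator by (intro WZ.lcspace_FV) (auto simp: generator_def Let_def)

sublocale X': lcspace "kappa_dual X"
  by (rule X.lcspace_kappa_dual)

lemma Hausdorff_E: "Hausdorff_space (lcs_topology E)"
  using lcHs by (simp add: lcHs_def)

lemma scalars_simps [simp]: "carrier (scalars :: ('k, 'k) lcs) = UNIV" "scale (scalars :: ('k, 'k) lcs) = (*)"
  "seminorms (scalars :: ('k, 'k) lcs) = {norm}"
  by (simp_all add: scalars_def)

lemma point_evaluation_dual: "point_evaluation X x \<in> dual X"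
  using generator by (simp add: generator_def Let_def)

lemma point_evaluation_apply [simp]: "f \<in> carrier X \<Longrightarrow> point_evaluation X x f = f x"
  by (simp add: point_evaluation_def ext0_def)

lemma op_evaluation_apply [simp]: "f \<in> carrier X \<Longrightarrow> op_evaluation X DK m x f = opr DK m f x"
  by (simp add: op_evaluation_def ext0_def)

lemma seminorms_X: "seminorms X = {WX.weighted_norm j m norm |j m. True}"
  by auto

text \<open>Some weight is positive at \<open>x\<close>; dividing by it bounds the value of the
  operator at \<open>x\<close> by the corresponding weighted seminorm.\<close>

lemma op_evaluation_dual:
  assumes x: "x \<in> \<omega> m" shows "op_evaluation X DK m x \<in> dual X"
proof -
  obtain j where j: "\<nu> j m x > 0" using WX.weight_pos[OF x] by blast
  have "norm (opr DK m f x) \<le> 1 / \<nu> j m x * WX.weighted_norm j m norm f" if "f \<in> carrier X" for f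
    using WX.weighted_norm_upper[OF that, of norm x m j] x j by (simp add: field_simps)
  then have "\<exists>r\<in>seminorms X. \<exists>C>0. \<forall>f\<in>carrier X. norm (op_evaluation X DK m x f) \<le> C * r f"
    using j unfolding seminorms_X
    by (intro bexI[of _ "WX.weighted_norm j m norm"] exI[of _ "1 / \<nu> j m x"]) auto
  moreover have "linear_on (carrier X) (scale X) (*) (op_evaluation X DK m x)"
    using WX.opr_add[OF WX.carrier_FV_F WX.carrier_FV_F x] WX.opr_scale[OF WX.carrier_FV_F x]
      X.carrier_add X.carrier_scale
    by (simp add: linear_on_def)
  ultimately show ?thesis
    unfolding X.dual_iff by (simp add: op_evaluation_def ext0_def)
qed

section \<open>Two-sided seminorm estimates for the map S\<close>

definition weighted_evaluations :: "'j \<Rightarrow> 'm \<Rightarrow> (('x \<Rightarrow> 'k) \<Rightarrow> 'k) set" where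
  "weighted_evaluations j m = (\<lambda>x. pointwise_scale (*) (of_real (\<nu> j m x)) (op_evaluation X DK m x)) ` \<omega> m"

lemma weighted_evaluations_dual: "weighted_evaluations j m \<subseteq> dual X"
  unfolding weighted_evaluations_def using X.dual_pointwise_scale[OF op_evaluation_dual] by blast

lemma weighted_evaluations_bound:
  assumes "\<phi> \<in> weighted_evaluations j m" "f \<in> carrier X"
  shows "norm (\<phi> f) \<le> WX.weighted_norm j m norm f"
proof -
  obtain x where x: "x \<in> \<omega> m" "\<phi> = pointwise_scale (*) (of_real (\<nu> j m x)) (op_evaluation X DK m x)"
    using assms(1) by (auto simp: weighted_evaluations_def)
  then show ?thesis
    using WX.weighted_norm_upper[OF assms(2), of norm x m j] assms(2) WX.weight_nonneg[of x m j]
    by (simp add: pointwise_scale_def norm_mult mult.commute)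
qed

lemma equicontinuous_weighted_evaluations: "equicontinuous X (weighted_evaluations j m)"
proof (rule X.equicontinuousI[OF weighted_evaluations_dual, where C = 1])
  show "WX.weighted_norm j m norm \<in> seminorms X" unfolding seminorms_X by blast
qed (use weighted_evaluations_bound in auto)

lemma carrier_XE: "u \<in> carrier XE \<longleftrightarrow> linear_on (dual X) (pointwise_scale (*)) (scale E) u \<and>
    (\<forall>\<phi>\<in>dual X. u \<phi> \<in> carrier E) \<and>
    (\<forall>p\<in>seminorms E. \<exists>K. absolutely_convex X K \<and> compactin (lcs_topology X) K \<and>
      (\<exists>C>0. \<forall>\<phi>\<in>dual X. p (u \<phi>) \<le> C * kappa_norm K \<phi>)) \<and>
    (\<forall>\<phi>. \<phi> \<notin> dual X \<longrightarrow> u \<phi> = 0)"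
  unfolding eps_product_def lcs.simps
  unfolding continuous_linear_maps_iff[OF X'.lcspace_axioms E.lcspace_axioms] X.kappa_dual_simps
  by (intro conj_cong ball_cong refl) blast

lemma eps_seminorms: "seminorms XE =
    {\<lambda>u. SUP \<phi>\<in>B. p (u \<phi>) |B p. equicontinuous X B \<and> B \<noteq> {} \<and> p \<in> seminorms E}"
  by (simp add: eps_product_def)

lemma XE_weighted:
  assumes u: "u \<in> carrier XE" and p: "p \<in> seminorms E" and x: "x \<in> \<omega> m"
  shows "p (u (pointwise_scale (*) (of_real (\<nu> j m x)) (op_evaluation X DK m x))) = p (opr DE m (S_map X u) x) * \<nu> j m x"
proof -
  note d = op_evaluation_dual[OF x]
  have "u (pointwise_scale (*) (of_real (\<nu> j m x)) (op_evaluation X DK m x)) =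
      scale E (of_real (\<nu> j m x)) (u (op_evaluation X DK m x))"
    using u d unfolding carrier_XE linear_on_def by blast
  moreover have "u (op_evaluation X DK m x) \<in> carrier E"
    using u d unfolding carrier_XE by blast
  moreover have "opr DE m (S_map X u) x = u (op_evaluation X DK m x)"
    using consistent u x unfolding consistent_def Let_def by blast
  ultimately show ?thesis
    using E.seminorm_scale[OF p] WX.weight_nonneg[OF x] by (simp add: mult.commute)
qed

text \<open>Continuity of \<open>u\<close> bounds \<open>p (u \<phi>)\<close> by the supremum of
  \<open>\<phi>\<close> over a compact \<open>K\<close>. All weighted evaluations are bounded on
  \<open>K\<close> by the supremum of one weighted seminorm, which is finite because compact sets
  are bounded.\<close>

lemma S_map_carrier:
  assumes u: "u \<in> carrier XE" shows "S_map X u \<in> carrier Z"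
  unfolding WZ.carrier_FV
proof (intro conjI allI ballI)
  show "S_map X u \<in> F_space DE"
    using consistent u unfolding consistent_def Let_def by blast
  fix j m p assume p: "p \<in> seminorms E"
  obtain K C where K: "absolutely_convex X K" "compactin (lcs_topology X) K" "C > 0"
    "\<And>\<phi>. \<phi> \<in> dual X \<Longrightarrow> p (u \<phi>) \<le> C * kappa_norm K \<phi>"
    using u p unfolding carrier_XE by blast
  have Kne: "K \<noteq> {}" using K(1) by (simp add: absolutely_convex_def)
  have r: "WX.weighted_norm j m norm \<in> seminorms X" unfolding seminorms_X by blast
  have "\<forall>p\<in>seminorms X. bdd_above (p ` K)"
    using X.compactin_bounded[OF K(2)] unfolding bounded_in_def by (rule conjunct2)
  from bspec[OF this r] have "bdd_above (WX.weighted_norm j m norm ` K)" .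
  then obtain M where M: "\<And>f. f \<in> K \<Longrightarrow> WX.weighted_norm j m norm f \<le> M"
    unfolding bdd_above_def by blast
  have "p (opr DE m (S_map X u) x) * \<nu> j m x \<le> C * M" if x: "x \<in> \<omega> m" for x
  proof -
    let ?\<phi> = "pointwise_scale (*) (of_real (\<nu> j m x)) (op_evaluation X DK m x)"
    have \<phi>: "?\<phi> \<in> weighted_evaluations j m" using x by (auto simp: weighted_evaluations_def)
    then have "?\<phi> \<in> dual X" using weighted_evaluations_dual by blast
    then have "p (u ?\<phi>) \<le> C * kappa_norm K ?\<phi>" by (rule K(4))
    also have "kappa_norm K ?\<phi> \<le> M"
    proof (rule X.kappa_norm_least[OF Kne])
      fix f assume f: "f \<in> K"
      then have "f \<in> carrier X" using K(1) by (auto simp: absolutely_convex_def)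
      then show "norm (?\<phi> f) \<le> M"
        using weighted_evaluations_bound[OF \<phi>] M[OF f] by force
    qed
    finally show ?thesis
      using XE_weighted[OF u p x] K(3) by simp
  qed
  then show "\<exists>M. \<forall>x\<in>\<omega> m. p (opr DE m (S_map X u) x) * \<nu> j m x \<le> M" by blast
qed

lemma weighted_norm_S_map:
  assumes u: "u \<in> carrier XE" and p: "p \<in> seminorms E"
  shows "WZ.weighted_norm j m p (S_map X u) = (SUP \<phi>\<in>weighted_evaluations j m. p (u \<phi>))"
proof -
  have "(\<lambda>x. p (opr DE m (S_map X u) x) * \<nu> j m x) ` \<omega> m = (\<lambda>\<phi>. p (u \<phi>)) ` weighted_evaluations j m"
    unfolding weighted_evaluations_def image_image
    by (intro image_cong refl) (simp add: XE_weighted[OF u p])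
  then show ?thesis by (simp add: WZ.weighted_norm_def)
qed

text \<open>By the Mackey--Arens theorem the functionals \<open>e' \<circ> u\<close> on the dual are evaluations at elements of
  \<open>X\<close>, so that the bound on \<open>\<phi>\<close> can be applied to them.\<close>

lemma XE_bound:
  assumes u: "u \<in> carrier XE" and p: "p \<in> seminorms E" and \<phi>: "\<phi> \<in> dual X"
    and C: "C \<ge> 0" "\<And>f. f \<in> carrier X \<Longrightarrow> norm (\<phi> f) \<le> C * WX.weighted_norm j m norm f"
  shows "p (u \<phi>) \<le> C * WZ.weighted_norm j m p (S_map X u)"
proof -
  have car: "u \<phi> \<in> carrier E" if "\<phi> \<in> dual X" for \<phi>
    using u that unfolding carrier_XE by blast
  obtain e' where e': "e' \<in> polar E p" "norm (e' (u \<phi>)) = p (u \<phi>)"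
    using E.polar_norming[OF p car[OF \<phi>]] by blast
  have lin: "linear_on (dual X) (pointwise_scale (*)) (*) (\<lambda>\<phi>. e' (u \<phi>))"
  proof -
    have "linear_on (carrier E) (scale E) (*) e'" using e'(1) by (simp add: polar_def)
    then show ?thesis
      using u car unfolding carrier_XE linear_on_def by simp
  qed
  obtain K B where K: "absolutely_convex X K" "compactin (lcs_topology X) K" "B > 0"
    "\<And>\<phi>. \<phi> \<in> dual X \<Longrightarrow> p (u \<phi>) \<le> B * kappa_norm K \<phi>"
    using u p unfolding carrier_XE by blast
  have "norm (e' (u \<phi>)) \<le> B * kappa_norm K \<phi>" if "\<phi> \<in> dual X" for \<phi>
    using E.polar_bound[OF e'(1) car[OF that]] K(4)[OF that] by simp
  from X.Mackey_Arens[OF K(1,2) lin this K(3)]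
  obtain f where f: "f \<in> carrier X" "\<And>\<phi>. \<phi> \<in> dual X \<Longrightarrow> \<phi> f = e' (u \<phi>)" by blast
  \<comment> \<open>Evaluating the operators at \<open>f\<close> gives
    \<open>opr DK m f x = e' (opr DE m (S_map X u) x)\<close> by consistency, so \<open>f\<close>
    inherits the bound of \<open>S_map X u\<close>. Afterwards the bound on \<open>\<phi>\<close> is
    used at \<open>f\<close>, where the modulus of \<open>\<phi> f\<close> is
    \<open>p (u \<phi>)\<close>.\<close>
  have "WX.weighted_norm j m norm f \<le> WZ.weighted_norm j m p (S_map X u)"
  proof (rule WX.weighted_norm_least)
    fix x assume x: "x \<in> \<omega> m"
    have "opr DK m f x = e' (u (op_evaluation X DK m x))"
      using f(2)[OF op_evaluation_dual[OF x]] f(1) by simp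
    also have "u (op_evaluation X DK m x) = opr DE m (S_map X u) x"
      using consistent u x unfolding consistent_def Let_def by metis
    finally have "norm (opr DK m f x) \<le> p (opr DE m (S_map X u) x)"
      using E.polar_bound[OF e'(1) WZ.opr_carrier[OF WZ.carrier_FV_F[OF S_map_carrier[OF u]] x]] by simp
    then have "norm (opr DK m f x) * \<nu> j m x \<le> p (opr DE m (S_map X u) x) * \<nu> j m x"
      using WX.weight_nonneg[OF x] by (rule mult_right_mono)
    also have "\<dots> \<le> WZ.weighted_norm j m p (S_map X u)"
      by (rule WZ.weighted_norm_upper[OF S_map_carrier[OF u] p x])
    finally show "norm (opr DK m f x) * \<nu> j m x \<le> WZ.weighted_norm j m p (S_map X u)" .
  qed
  then have "C * WX.weighted_norm j m norm f \<le> C * WZ.weighted_norm j m p (S_map X u)"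
    using C(1) by (rule mult_left_mono)
  then show ?thesis
    using C(2)[OF f(1)] f(2)[OF \<phi>] e'(2) by simp
qed

lemma equicontinuous_XE_bound:
  assumes B: "equicontinuous X B" "B \<noteq> {}" and p: "p \<in> seminorms E"
  shows "\<exists>j m. \<exists>C>0. \<forall>u\<in>carrier XE. (SUP \<phi>\<in>B. p (u \<phi>)) \<le> C * WZ.weighted_norm j m p (S_map X u)"
proof -
  obtain r C where r: "r \<in> seminorms X" "C > 0" "\<And>\<phi> f. \<phi> \<in> B \<Longrightarrow> f \<in> carrier X \<Longrightarrow> norm (\<phi> f) \<le> C * r f"
    using X.equicontinuous_bound[OF B(1)] by blast
  obtain j m where jm: "r = WX.weighted_norm j m norm" using r(1) unfolding seminorms_X by blast
  have d: "\<phi> \<in> dual X" if "\<phi> \<in> B" for \<phi> using B(1) that by (auto simp: equicontinuous_def)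
  have "(SUP \<phi>\<in>B. p (u \<phi>)) \<le> C * WZ.weighted_norm j m p (S_map X u)" if u: "u \<in> carrier XE" for u
  proof (rule cSUP_least[OF B(2)])
    fix \<phi> assume \<phi>: "\<phi> \<in> B"
    show "p (u \<phi>) \<le> C * WZ.weighted_norm j m p (S_map X u)"
      using r(2) r(3)[OF \<phi>] unfolding jm by (intro XE_bound[OF u p d[OF \<phi>]]) auto
  qed
  then show ?thesis using r(2) by blast
qed

lemma XE_lincomb:
  "u \<in> carrier XE \<Longrightarrow> v \<in> carrier XE \<Longrightarrow> (\<lambda>\<phi>. scale E a (u \<phi>) + scale E b (v \<phi>)) \<in> carrier XE"
  using continuous_linear_maps_lincomb[OF X'.lcspace_axioms E.lcspace_axioms] by (simp add: eps_product_def)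

lemma XE_diff: "u \<in> carrier XE \<Longrightarrow> v \<in> carrier XE \<Longrightarrow> u - v \<in> carrier XE"
  using XE_lincomb[of u v 1 "- 1"] by (simp add: fun_diff_def)

text \<open>\<open>XE_bound\<close> for \<open>u - v\<close>, whose image under
  \<open>S_map X\<close> is 0, makes every seminorm of \<open>u \<phi> - v \<phi>\<close> vanish;
  then \<open>E\<close> being Hausdorff applies.\<close>

lemma inj_on_S_map: "inj_on (S_map X) (carrier XE)"
proof (rule inj_onI)
  fix u v assume u: "u \<in> carrier XE" and v: "v \<in> carrier XE" and eq: "S_map X u = S_map X v"
  have w: "u - v \<in> carrier XE" using u v by (rule XE_diff)
  have S0: "S_map X (u - v) = 0" using eq by (simp add: S_map_def fun_eq_iff)
  have "u \<phi> = v \<phi>" if \<phi>: "\<phi> \<in> dual X" for \<phi>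
  proof -
    have car: "u \<phi> \<in> carrier E" "v \<phi> \<in> carrier E" using u v \<phi> unfolding carrier_XE by auto
    obtain r C where r: "r \<in> seminorms X" "C > 0" "\<And>f. f \<in> carrier X \<Longrightarrow> norm (\<phi> f) \<le> C * r f"
      using X.dual_bound[OF \<phi>] by blast
    obtain j m where jm: "r = WX.weighted_norm j m norm" using r(1) unfolding seminorms_X by blast
    have "p (u \<phi> - v \<phi>) = 0" if p: "p \<in> seminorms E" for p
    proof -
      have "p ((u - v) \<phi>) \<le> C * WZ.weighted_norm j m p (S_map X (u - v))"
        using r(2,3) unfolding jm by (intro XE_bound[OF w p \<phi>]) auto
      also have "WZ.weighted_norm j m p (S_map X (u - v)) = 0"
        unfolding S0 using p by (intro Z.seminorm_zero) auto
      finally show ?thesis using E.seminorm_nonneg[OF p, of "u \<phi> - v \<phi>"] car by simp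
    qed
    then have "u \<phi> - v \<phi> = 0" using car by (intro E.Hausdorff_zero[OF Hausdorff_E]) auto
    then show ?thesis by simp
  qed
  moreover have "u \<phi> = v \<phi>" if "\<phi> \<notin> dual X" for \<phi> using u v that unfolding carrier_XE by simp
  ultimately show "u = v" by blast
qed

text \<open>Each seminorm of \<open>S_map X u\<close> is itself a seminorm of the epsilon-product at
  \<open>u\<close>, which gives continuity; \<open>equicontinuous_XE_bound\<close> is the reverse
  estimate and makes the inverse continuous. The four cases thus have to supply surjectivity
  only.\<close>

lemma isomorphism_if_surjective:
  assumes surj: "\<And>f. f \<in> carrier Z \<Longrightarrow> f \<in> S_map X ` carrier XE"
  shows "lcs_isomorphism XE Z (S_map X) \<and> lcs_isomorphic Z XE"
proof -
  define T where "T = inv_into (carrier XE) (S_map X)"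
  have T: "T f \<in> carrier XE" "S_map X (T f) = f" if "f \<in> carrier Z" for f
    using surj[OF that] by (auto simp: T_def inv_into_into f_inv_into_f)
  have TS: "T (S_map X u) = u" if "u \<in> carrier XE" for u
    using that by (simp add: T_def inv_into_f_f[OF inj_on_S_map])
  have S_diff: "S_map X (u - v) = S_map X u - S_map X v" for u v :: "(('x \<Rightarrow> 'k) \<Rightarrow> 'k) \<Rightarrow> 'e"
    by (simp add: S_map_def fun_eq_iff)
  have T_diff: "T (f - g) = T f - T g" if "f \<in> carrier Z" "g \<in> carrier Z" for f g
    using TS[OF XE_diff[OF T(1)[OF that(1)] T(1)[OF that(2)]]] T(2)[OF that(1)] T(2)[OF that(2)]
    by (simp add: S_diff)
  have contS: "continuous_map (lcs_topology XE) (lcs_topology Z) (S_map X)"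
  proof (rule continuous_map_lcsI)
    fix q assume "q \<in> seminorms Z"
    then obtain j m p where q: "q = WZ.weighted_norm j m p" "p \<in> seminorms E" by auto
    have "(\<lambda>u. SUP \<phi>\<in>weighted_evaluations j m. p (u \<phi>)) \<in> seminorms XE"
      unfolding eps_seminorms using equicontinuous_weighted_evaluations q(2) WX.nonempty[of m]
      by (fastforce simp: weighted_evaluations_def)
    then show "\<exists>r\<in>seminorms XE. \<exists>C>0. \<forall>u\<in>carrier XE. q (S_map X u) \<le> C * r u"
      using weighted_norm_S_map[OF _ q(2)] unfolding q(1)
      by (intro bexI[of _ "\<lambda>u. SUP \<phi>\<in>weighted_evaluations j m. p (u \<phi>)"] exI[of _ 1]) auto
  qed (use S_diff XE_diff S_map_carrier in auto)
  have contT: "continuous_map (lcs_topology Z) (lcs_topology XE) T"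
  proof (rule continuous_map_lcsI)
    fix q assume "q \<in> seminorms XE"
    then obtain B p where q: "q = (\<lambda>u. SUP \<phi>\<in>B. p (u \<phi>))" "equicontinuous X B" "B \<noteq> {}" "p \<in> seminorms E"
      unfolding eps_seminorms by blast
    obtain j m C where C: "C > 0" "\<And>u. u \<in> carrier XE \<Longrightarrow> q u \<le> C * WZ.weighted_norm j m p (S_map X u)"
      using equicontinuous_XE_bound[OF q(2,3,4)] unfolding q(1) by blast
    have "q (T f) \<le> C * WZ.weighted_norm j m p f" if "f \<in> carrier Z" for f
      using C(2)[OF T(1)[OF that]] T(2)[OF that] by simp
    then show "\<exists>r\<in>seminorms Z. \<exists>C>0. \<forall>f\<in>carrier Z. q (T f) \<le> C * r f"
      using C(1) q(4) by (intro bexI[of _ "WZ.weighted_norm j m p"] exI[of _ C]) auto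
  qed (use T_diff T Z.carrier_diff in auto)
  have maps: "homeomorphic_maps (lcs_topology XE) (lcs_topology Z) (S_map X) T"
    unfolding homeomorphic_maps_def using contS contT TS T by simp
  have linS: "linear_on (carrier XE) (scale XE) (scale Z) (S_map X)"
    by (simp add: linear_on_def S_map_def eps_product_def pointwise_scale_def fun_eq_iff)
  have "linear_on (carrier Z) (scale Z) (scale XE) T"
    unfolding linear_on_def
  proof (intro conjI ballI allI)
    fix f g assume fg: "f \<in> carrier Z" "g \<in> carrier Z"
    have "T f + T g \<in> carrier XE"
      using XE_lincomb[OF T(1)[OF fg(1)] T(1)[OF fg(2)], of 1 1] by (simp add: plus_fun_def)
    moreover have "S_map X (T f + T g) = f + g"
      using T(2)[OF fg(1)] T(2)[OF fg(2)] by (simp add: S_map_def fun_eq_iff)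
    ultimately show "T (f + g) = T f + T g" using TS by metis
  next
    fix c f assume f: "f \<in> carrier Z"
    have "scale XE c (T f) \<in> carrier XE"
      using XE_lincomb[OF T(1)[OF f] T(1)[OF f], of c 0] by (simp add: eps_product_def pointwise_scale_def)
    moreover have "S_map X (scale XE c (T f)) = scale Z c f"
      using T(2)[OF f] by (simp add: S_map_def eps_product_def pointwise_scale_def fun_eq_iff)
    ultimately show "T (scale Z c f) = scale XE c (T f)" using TS by metis
  qed
  then show ?thesis
    using maps linS homeomorphic_maps_sym[of "lcs_topology XE"]
    unfolding lcs_isomorphic_def lcs_isomorphism_def homeomorphic_map_maps by blast
qed

end


section \<open>Surjectivity for relatively compact ranges\<close>

lemma bounded_in_bound:
  assumes "bounded_in X B" and "p \<in> seminorms X"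
  shows "\<exists>M>0. \<forall>x\<in>B. p x \<le> M"
proof -
  have "\<forall>p\<in>seminorms X. bdd_above (p ` B)" using assms(1) unfolding bounded_in_def by (rule conjunct2)
  from bspec[OF this assms(2)] obtain M where "\<forall>y\<in>p ` B. y \<le> M" unfolding bdd_above_def ..
  then have "\<forall>x\<in>B. p x \<le> max M 1" by force
  then show ?thesis by (intro exI[of _ "max M 1"]) auto
qed

context epsilon_setting
begin

sublocale E': lcspace "kappa_dual E"
  by (rule E.lcspace_kappa_dual)

lemma dual_E_diff: "e \<in> dual E \<Longrightarrow> e' \<in> dual E \<Longrightarrow> e - e' \<in> dual E"
  using E'.carrier_diff by simp

lemma opr_dual_comp:
  assumes "f \<in> carrier Z" "e' \<in> dual E"
  shows "e' \<circ> f \<in> F_space DK" "x \<in> \<omega> m \<Longrightarrow> opr DK m (e' \<circ> f) x = e' (opr DE m f x)"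
  using strong assms unfolding strong_def by blast+

lemma opr_Z_carrier: "f \<in> carrier Z \<Longrightarrow> x \<in> \<omega> m \<Longrightarrow> opr DE m f x \<in> carrier E"
  using WZ.opr_carrier[OF WZ.carrier_FV_F] .

lemma dual_comp_carrier:
  assumes f: "f \<in> carrier Z" and e': "e' \<in> dual E"
  shows "e' \<circ> f \<in> carrier X"
  unfolding WX.carrier_FV
proof (intro conjI allI ballI opr_dual_comp(1)[OF f e'])
  fix j m and p :: "'k \<Rightarrow> real" assume "p \<in> seminorms scalars"
  then have p: "p = norm" by simp
  obtain r C where r: "r \<in> seminorms E" "C > 0" "\<And>x. x \<in> carrier E \<Longrightarrow> norm (e' x) \<le> C * r x"
    using E.dual_bound[OF e'] by blast
  have "norm (opr DK m (e' \<circ> f) x) * \<nu> j m x \<le> C * WZ.weighted_norm j m r f" if x: "x \<in> \<omega> m" for x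
  proof -
    have "norm (opr DK m (e' \<circ> f) x) * \<nu> j m x \<le> C * r (opr DE m f x) * \<nu> j m x"
      using r(3)[OF opr_Z_carrier[OF f x]] WZ.weight_nonneg[OF x]
      by (simp add: opr_dual_comp(2)[OF f e' x] mult_right_mono)
    also have "\<dots> \<le> C * WZ.weighted_norm j m r f"
      using WZ.weighted_norm_upper[OF f r(1) x, of j] r(2) by (simp add: mult.assoc)
    finally show ?thesis .
  qed
  then show "\<exists>M. \<forall>x\<in>\<omega> m. p (opr DK m (e' \<circ> f) x) * \<nu> j m x \<le> M" unfolding p by blast
qed

text \<open>Strongness moves \<open>e'\<close> through the operator, and the nonnegative weight
  moves inside \<open>e'\<close>, so the weighted values of \<open>e' \<circ> f\<close> are the
  moduli of \<open>e'\<close> on \<open>N_set\<close>. This is how \<open>f\<close> enters all later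
  estimates.\<close>

lemma weighted_norm_dual_comp:
  assumes f: "f \<in> carrier Z" and e': "e' \<in> dual E"
    and bound: "\<And>y. y \<in> N_set \<omega> \<nu> E DE j m f \<Longrightarrow> norm (e' y) \<le> c"
  shows "WX.weighted_norm j m norm (e' \<circ> f) \<le> c"
proof (rule WX.weighted_norm_least)
  fix x assume x: "x \<in> \<omega> m"
  have "norm (opr DK m (e' \<circ> f) x) * \<nu> j m x = norm (e' (scale E (of_real (\<nu> j m x)) (opr DE m f x)))"
    using WZ.weight_nonneg[OF x]
    by (simp add: opr_dual_comp(2)[OF f e' x] E.dual_scale[OF e' opr_Z_carrier[OF f x]] norm_mult mult.commute)
  also have "\<dots> \<le> c"
    using x by (intro bound) (auto simp: N_set_def)
  finally show "norm (opr DK m (e' \<circ> f) x) * \<nu> j m x \<le> c" .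
qed

lemma bounded_N_set:
  assumes f: "f \<in> carrier Z" shows "bounded_in E (N_set \<omega> \<nu> E DE j m f)"
  unfolding bounded_in_def
proof (intro conjI ballI)
  show "N_set \<omega> \<nu> E DE j m f \<subseteq> carrier E"
    using opr_Z_carrier[OF f] by (auto simp: N_set_def)
  fix p assume p: "p \<in> seminorms E"
  have "p y \<le> WZ.weighted_norm j m p f" if y: "y \<in> N_set \<omega> \<nu> E DE j m f" for y
  proof -
    obtain x where x: "x \<in> \<omega> m" "y = scale E (of_real (\<nu> j m x)) (opr DE m f x)"
      using y by (auto simp: N_set_def)
    then show ?thesis
      using WZ.weighted_norm_upper[OF f p x(1), of j] E.seminorm_scale[OF p opr_Z_carrier[OF f x(1)]]
        WZ.weight_nonneg[OF x(1)] by (simp add: mult.commute)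
  qed
  then show "bdd_above (p ` N_set \<omega> \<nu> E DE j m f)" by (intro bdd_aboveI) auto
qed

text \<open>Vectors of \<open>E\<close> are determined by the functionals on \<open>E\<close>, so
  the representing vectors depend linearly on \<open>\<phi>\<close>. The compact sets make this map
  continuous on the kappa-dual, and \<open>point_evaluation X x\<close> is represented by
  \<open>f x\<close>, which identifies the image under \<open>S_map X\<close> with
  \<open>f\<close>.\<close>

lemma in_range_S_map:
  assumes f: "f \<in> carrier Z"
    and K: "\<And>p. p \<in> seminorms E \<Longrightarrow> \<exists>K. absolutely_convex X K \<and> compactin (lcs_topology X) K \<and>
      (\<forall>e'\<in>polar E p. e' \<circ> f \<in> K)"
    and ex: "\<And>\<phi>. \<phi> \<in> dual X \<Longrightarrow> \<exists>y\<in>carrier E. \<forall>e'\<in>dual E. e' y = \<phi> (e' \<circ> f)"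
  shows "f \<in> S_map X ` carrier XE"
proof -
  from ex have "\<forall>\<phi>\<in>dual X. \<exists>y. y \<in> carrier E \<and> (\<forall>e'\<in>dual E. e' y = \<phi> (e' \<circ> f))" by blast
  from bchoice[OF this] obtain u0 where
    u0: "\<forall>\<phi>\<in>dual X. u0 \<phi> \<in> carrier E \<and> (\<forall>e'\<in>dual E. e' (u0 \<phi>) = \<phi> (e' \<circ> f))" ..
  define u where "u = ext0 (dual X) u0"
  have car: "u \<phi> \<in> carrier E" if "\<phi> \<in> dual X" for \<phi>
    using u0 that by (simp add: u_def ext0_def)
  have u: "e' (u \<phi>) = \<phi> (e' \<circ> f)" if "\<phi> \<in> dual X" "e' \<in> dual E" for \<phi> e'
    using u0 that by (simp add: u_def ext0_def)
  have "linear_on (dual X) (pointwise_scale (*)) (scale E) u"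
    unfolding linear_on_def
  proof (intro conjI ballI allI)
    fix \<phi> \<psi> assume d: "\<phi> \<in> dual X" "\<psi> \<in> dual X"
    show "u (\<phi> + \<psi>) = u \<phi> + u \<psi>"
    proof (rule E.dual_separates[OF Hausdorff_E])
      fix e' assume e': "e' \<in> dual E"
      show "e' (u (\<phi> + \<psi>)) = e' (u \<phi> + u \<psi>)"
        using u[OF X.dual_plus[OF d] e'] u[OF d(1) e'] u[OF d(2) e'] E.dual_add[OF e' car[OF d(1)] car[OF d(2)]]
        by simp
    qed (use car d X.dual_plus in auto)
  next
    fix c \<phi> assume d: "\<phi> \<in> dual X"
    show "u (pointwise_scale (*) c \<phi>) = scale E c (u \<phi>)"
    proof (rule E.dual_separates[OF Hausdorff_E])
      fix e' assume e': "e' \<in> dual E"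
      show "e' (u (pointwise_scale (*) c \<phi>)) = e' (scale E c (u \<phi>))"
        using u[OF X.dual_pointwise_scale[OF d] e'] u[OF d e'] E.dual_scale[OF e' car[OF d]]
        by (simp add: pointwise_scale_def)
    qed (use car d X.dual_pointwise_scale in auto)
  qed
  moreover have "\<exists>K. absolutely_convex X K \<and> compactin (lcs_topology X) K \<and>
      (\<exists>C>0. \<forall>\<phi>\<in>dual X. p (u \<phi>) \<le> C * kappa_norm K \<phi>)" if p: "p \<in> seminorms E" for p
  proof -
    obtain K where K': "absolutely_convex X K" "compactin (lcs_topology X) K" "\<And>e'. e' \<in> polar E p \<Longrightarrow> e' \<circ> f \<in> K"
      using K[OF p] by blast
    \<comment> \<open>For a norming \<open>e'\<close> the seminorm equals the modulus of
      \<open>\<phi> (e' \<circ> f)\<close>, a value of \<open>\<phi>\<close> on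
      \<open>K\<close>.\<close>
    have "p (u \<phi>) \<le> 1 * kappa_norm K \<phi>" if \<phi>: "\<phi> \<in> dual X" for \<phi>
    proof -
      obtain e' where e': "e' \<in> polar E p" "norm (e' (u \<phi>)) = p (u \<phi>)"
        using E.polar_norming[OF p car[OF \<phi>]] by blast
      then show ?thesis
        using X.kappa_norm_upper[OF \<phi> K'(2) K'(3)[OF e'(1)]] u[OF \<phi> E.polar_seminorm_dual[OF p e'(1)]] by simp
    qed
    then show ?thesis using K' zero_less_one[where 'a=real] by blast
  qed
  ultimately have "u \<in> carrier XE"
    unfolding carrier_XE using car by (simp add: u_def ext0_def)
  moreover have "S_map X u = f"
  proof
    fix x
    have fx: "f x \<in> carrier E" using WZ.F_values[OF WZ.carrier_FV_F[OF f]] .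
    show "S_map X u x = f x"
      unfolding S_map_def
    proof (rule E.dual_separates[OF Hausdorff_E car[OF point_evaluation_dual] fx])
      fix e' assume e': "e' \<in> dual E"
      show "e' (u (point_evaluation X x)) = e' (f x)"
        using u[OF point_evaluation_dual e'] dual_comp_carrier[OF f e'] by simp
    qed
  qed
  ultimately show ?thesis by blast
qed

lemma dual_comp_plus:
  fixes e e' :: "'e \<Rightarrow> 'k" and f :: "'x \<Rightarrow> 'e"
  shows "(e + e') \<circ> f = (e \<circ> f) + (e' \<circ> f)"
  by (rule ext) simp

lemma dual_comp_scale:
  fixes e' :: "'e \<Rightarrow> 'k" and f :: "'x \<Rightarrow> 'e"
  shows "pointwise_scale (*) c e' \<circ> f = pointwise_scale (*) c (e' \<circ> f)"
  by (rule ext) (simp add: pointwise_scale_def)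

lemma dual_comp_linear:
  assumes f: "f \<in> carrier Z" and \<phi>: "\<phi> \<in> dual X"
  shows "linear_on (dual E) (pointwise_scale (*)) (*) (\<lambda>e'. \<phi> (e' \<circ> f))"
  unfolding linear_on_def
proof (intro conjI ballI allI)
  fix e e' assume "e \<in> dual E" "e' \<in> dual E"
  then show "\<phi> ((e + e') \<circ> f) = \<phi> (e \<circ> f) + \<phi> (e' \<circ> f)"
    unfolding dual_comp_plus using f by (intro X.dual_add[OF \<phi>] dual_comp_carrier)
next
  fix c e' assume "e' \<in> dual E"
  then show "\<phi> (pointwise_scale (*) c e' \<circ> f) = c * \<phi> (e' \<circ> f)"
    unfolding dual_comp_scale
    using X.dual_scale[OF \<phi> dual_comp_carrier[OF f], of e' c] by simp
qed

text \<open>On the equicontinuous set \<open>polar E p\<close> the topology of pointwise convergence coincides with that of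
  uniform convergence on compact sets.\<close>

lemma compactin_polar_comp:
  assumes f: "f \<in> carrier Z" and p: "p \<in> seminorms E"
    and N: "\<And>j m. \<exists>K. absolutely_convex E K \<and> compactin (lcs_topology E) K \<and> N_set \<omega> \<nu> E DE j m f \<subseteq> K"
  shows "compactin (lcs_topology X) ((\<lambda>e'. e' \<circ> f) ` polar E p)"
proof (rule image_compactin)
  have pd: "e' \<in> dual E" if "e' \<in> polar E p" for e'
    using E.polar_seminorm_dual[OF p that] .
  show "compactin (top_of_set (polar E p)) (polar E p)"
    using compact_polar[of E p] by (simp add: compactin_subtopology)
  show "continuous_map (top_of_set (polar E p)) (lcs_topology X) (\<lambda>e'. e' \<circ> f)"
    unfolding continuous_map_def
  proof (intro conjI allI impI)
    show "(\<lambda>e'. e' \<circ> f) \<in> topspace (top_of_set (polar E p)) \<rightarrow> topspace (lcs_topology X)"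
      using dual_comp_carrier[OF f pd] by auto
    fix U assume U: "openin (lcs_topology X) U"
    show "openin (top_of_set (polar E p)) {e' \<in> topspace (top_of_set (polar E p)). e' \<circ> f \<in> U}"
    proof (subst openin_subopen, intro ballI)
      fix e0 assume "e0 \<in> {e' \<in> topspace (top_of_set (polar E p)). e' \<circ> f \<in> U}"
      then have e0: "e0 \<in> polar E p" "e0 \<circ> f \<in> U" by auto
      obtain r \<epsilon> where r: "r \<in> seminorms X" "\<epsilon> > 0" "{y \<in> carrier X. r (y - (e0 \<circ> f)) < \<epsilon>} \<subseteq> U"
        using U e0(2) unfolding X.openin_iff by blast
      obtain j m where jm: "r = WX.weighted_norm j m norm" using r(1) unfolding seminorms_X by blast
      obtain K where K: "compactin (lcs_topology E) K" "N_set \<omega> \<nu> E DE j m f \<subseteq> K" using N by blast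
      have KE: "K \<subseteq> carrier E" using compactin_subset_topspace[OF K(1)] by simp
      \<comment> \<open>A finite net reduces closeness on \<open>K\<close> to closeness within
        \<open>\<epsilon> / 4\<close> on \<open>A\<close>. Off the net \<open>e'\<close> and
        \<open>e0\<close> cost \<open>\<epsilon> / 8\<close> each, being in the polar of
        \<open>p\<close>; the total \<open>\<epsilon> / 2\<close> keeps the inequality strict after
        the supremum.\<close>
      obtain A where A: "finite A" "A \<subseteq> K" "\<And>x. x \<in> K \<Longrightarrow> \<exists>a\<in>A. p (x - a) < \<epsilon> / 8"
        using E.precompact_cover[OF K(1) p, of "\<epsilon> / 8"] r(2) by auto
      define T where "T = polar E p \<inter> (\<Inter>a\<in>A. {e'. norm (e' a - e0 a) < \<epsilon> / 4})"
      have "open (\<Inter>a\<in>A. {e'::'e \<Rightarrow> 'k. norm (e' a - e0 a) < \<epsilon> / 4})"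
        using A(1) by (intro open_INT ballI open_Collect_less continuous_intros continuous_on_product_coordinates) auto
      then have "openin (top_of_set (polar E p)) T"
        unfolding T_def by (rule openin_open_Int)
      moreover have "e0 \<in> T" using e0 r(2) by (simp add: T_def)
      moreover have "e' \<circ> f \<in> U" if e': "e' \<in> T" for e'
      proof -
        have e'p: "e' \<in> polar E p" using e' by (simp add: T_def)
        have diff: "e' - e0 \<in> dual E" using dual_E_diff pd e'p e0(1) by blast
        have "WX.weighted_norm j m norm ((e' - e0) \<circ> f) \<le> \<epsilon> / 2"
        proof (rule weighted_norm_dual_comp[OF f diff])
          fix y assume "y \<in> N_set \<omega> \<nu> E DE j m f"
          then have y: "y \<in> K" using K(2) by blast
          obtain a where a: "a \<in> A" "p (y - a) < \<epsilon> / 8" using A(3)[OF y] by blast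
          have car: "y \<in> carrier E" "a \<in> carrier E" using y a(1) A(2) KE by auto
          have "e' y - e0 y = (e' a - e0 a) + (e' (y - a) - e0 (y - a))"
            using E.dual_diff[OF pd[OF e'p] car] E.dual_diff[OF pd[OF e0(1)] car] by simp
          then have "norm (e' y - e0 y) \<le> norm (e' a - e0 a) + norm (e' (y - a) - e0 (y - a))"
            using norm_triangle_ineq by metis
          also have "\<dots> \<le> norm (e' a - e0 a) + (norm (e' (y - a)) + norm (e0 (y - a)))"
            using norm_triangle_ineq4 by (intro add_mono order_refl)
          also have "\<dots> \<le> \<epsilon> / 4 + (\<epsilon> / 8 + \<epsilon> / 8)"
          proof (intro add_mono)
            show "norm (e' a - e0 a) \<le> \<epsilon> / 4" using e' a(1) by (force simp: T_def)
            have ya: "y - a \<in> carrier E" using car by blast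
            show "norm (e' (y - a)) \<le> \<epsilon> / 8" using E.polar_bound[OF e'p ya] a(2) by simp
            show "norm (e0 (y - a)) \<le> \<epsilon> / 8" using E.polar_bound[OF e0(1) ya] a(2) by simp
          qed
          finally show "norm ((e' - e0) y) \<le> \<epsilon> / 2" by simp
        qed
        moreover have "(e' - e0) \<circ> f = (e' \<circ> f) - (e0 \<circ> f)" by (simp add: fun_eq_iff)
        ultimately have "r ((e' \<circ> f) - (e0 \<circ> f)) < \<epsilon>" using r(2) jm by simp
        then show ?thesis using r(3) dual_comp_carrier[OF f pd[OF e'p]] by blast
      qed
      ultimately show "\<exists>T. openin (top_of_set (polar E p)) T \<and> e0 \<in> T \<and>
          T \<subseteq> {e' \<in> topspace (top_of_set (polar E p)). e' \<circ> f \<in> U}"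
        by (intro exI[of _ T]) (auto simp: T_def)
    qed
  qed
qed

lemma absolutely_convex_polar_comp:
  assumes f: "f \<in> carrier Z" and p: "p \<in> seminorms E"
  shows "absolutely_convex X ((\<lambda>e'. e' \<circ> f) ` polar E p)"
  unfolding absolutely_convex_def
proof (intro conjI ballI allI impI)
  have pd: "e' \<in> dual E" if "e' \<in> polar E p" for e'
    using E.polar_seminorm_dual[OF p that] .
  show "(\<lambda>e'. e' \<circ> f) ` polar E p \<subseteq> carrier X"
    using dual_comp_carrier[OF f pd] by blast
  show "(\<lambda>e'. e' \<circ> f) ` polar E p \<noteq> {}"
    using E.polar_norming[OF p E.carrier_zero] by blast
  fix g h and a b :: 'k assume g: "g \<in> (\<lambda>e'. e' \<circ> f) ` polar E p" and h: "h \<in> (\<lambda>e'. e' \<circ> f) ` polar E p"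
    and ab: "norm a + norm b \<le> 1"
  obtain e e' where e: "e \<in> polar E p" "g = e \<circ> f" and e': "e' \<in> polar E p" "h = e' \<circ> f"
    using g h by blast
  let ?e = "\<lambda>x. a * e x + b * e' x"
  have "?e \<in> polar E p"
    unfolding polar_def
  proof (intro CollectI conjI ballI allI impI)
    show "linear_on (carrier E) (scale E) (*) ?e"
      using e(1) e'(1) by (simp add: polar_def linear_on_def algebra_simps)
    show "?e x = 0" if "x \<notin> carrier E" for x
      using e(1) e'(1) that by (simp add: polar_def)
    fix x assume x: "x \<in> carrier E"
    have "norm (?e x) \<le> norm a * norm (e x) + norm b * norm (e' x)"
      using norm_triangle_ineq[of "a * e x" "b * e' x"] by (simp add: norm_mult)
    also have "\<dots> \<le> norm a * p x + norm b * p x"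
      using E.polar_bound[OF e(1) x] E.polar_bound[OF e'(1) x] by (intro add_mono mult_left_mono) auto
    also have "\<dots> \<le> 1 * p x"
      using ab E.seminorm_nonneg[OF p x] unfolding distrib_right[symmetric] by (intro mult_right_mono)
    finally show "norm (?e x) \<le> p x" by simp
  qed
  moreover have "scale X a g + scale X b h = ?e \<circ> f"
    by (simp add: e(2) e'(2) pointwise_scale_def fun_eq_iff)
  ultimately show "scale X a g + scale X b h \<in> (\<lambda>e'. e' \<circ> f) ` polar E p" by blast
qed

lemma surjective_compact_range:
  assumes f: "f \<in> carrier Z"
    and N: "\<And>j m. \<exists>K. absolutely_convex E K \<and> compactin (lcs_topology E) K \<and> N_set \<omega> \<nu> E DE j m f \<subseteq> K"
  shows "f \<in> S_map X ` carrier XE"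
proof (rule in_range_S_map[OF f])
  fix p assume p: "p \<in> seminorms E"
  show "\<exists>K. absolutely_convex X K \<and> compactin (lcs_topology X) K \<and> (\<forall>e'\<in>polar E p. e' \<circ> f \<in> K)"
    using absolutely_convex_polar_comp[OF f p] compactin_polar_comp[OF f p N]
    by (intro exI[of _ "(\<lambda>e'. e' \<circ> f) ` polar E p"]) simp
next
  fix \<phi> assume \<phi>: "\<phi> \<in> dual X"
  obtain r C where r: "r \<in> seminorms X" "C > 0" "\<And>g. g \<in> carrier X \<Longrightarrow> norm (\<phi> g) \<le> C * r g"
    using X.dual_bound[OF \<phi>] by blast
  obtain j m where jm: "r = WX.weighted_norm j m norm" using r(1) unfolding seminorms_X by blast
  obtain K where K: "absolutely_convex E K" "compactin (lcs_topology E) K" "N_set \<omega> \<nu> E DE j m f \<subseteq> K"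
    using N by blast
  \<comment> \<open>A single weighted seminorm bounds \<open>\<phi>\<close>, and its value at
    \<open>e' \<circ> f\<close> is at most the supremum of \<open>e'\<close> over \<open>K\<close>.
    Hence \<open>e' \<mapsto> \<phi> (e' \<circ> f)\<close> is continuous on the kappa-dual of
    \<open>E\<close>.\<close>
  have "norm (\<phi> (e' \<circ> f)) \<le> C * kappa_norm K e'" if e': "e' \<in> dual E" for e'
  proof -
    have "r (e' \<circ> f) \<le> kappa_norm K e'"
      unfolding jm using E.kappa_norm_upper[OF e' K(2)] K(3) by (intro weighted_norm_dual_comp[OF f e']) blast
    then have "C * r (e' \<circ> f) \<le> C * kappa_norm K e'" using r(2) by simp
    then show ?thesis using r(3)[OF dual_comp_carrier[OF f e']] by simp
  qed
  from E.Mackey_Arens[OF K(1,2) dual_comp_linear[OF f \<phi>] this r(2)]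
  show "\<exists>y\<in>carrier E. \<forall>e'\<in>dual E. e' y = \<phi> (e' \<circ> f)" .
qed

text \<open>The bipolar of a weighted range is closed and bounded, hence compact in a semi-Montel
  space, so this is an instance of compact ranges.\<close>

lemma surjective_semi_Montel_range:
  assumes f: "f \<in> carrier Z" and E: "semi_Montel E"
  shows "f \<in> S_map X ` carrier XE"
proof (rule surjective_compact_range[OF f])
  fix j m
  show "\<exists>K. absolutely_convex E K \<and> compactin (lcs_topology E) K \<and> N_set \<omega> \<nu> E DE j m f \<subseteq> K"
    using E.absolutely_convex_bipolar E.semi_Montel_compact_bipolar[OF E bounded_N_set[OF f]]
      E.subset_bipolar bounded_N_set[OF f]
    by (intro exI[of _ "bipolar E (N_set \<omega> \<nu> E DE j m f)"]) (auto simp: bounded_in_def)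
qed

text \<open>Every \<open>e'\<close> in the polar of \<open>p\<close> is bounded on
  \<open>N_set\<close> by a bound of \<open>p\<close> there, so the functions
  \<open>e' \<circ> f\<close> form a bounded set. Its bipolar is the required compact set.\<close>

lemma semi_Montel_polar_comp:
  assumes f: "f \<in> carrier Z" and X: "semi_Montel X" and p: "p \<in> seminorms E"
  shows "\<exists>K. absolutely_convex X K \<and> compactin (lcs_topology X) K \<and> (\<forall>e'\<in>polar E p. e' \<circ> f \<in> K)"
proof -
  define A where "A = (\<lambda>e'. e' \<circ> f) ` polar E p"
  have AX: "A \<subseteq> carrier X"
    using dual_comp_carrier[OF f E.polar_seminorm_dual[OF p]] by (auto simp: A_def)
  have "bounded_in X A"
    unfolding bounded_in_def
  proof (intro conjI AX ballI)
    fix r assume "r \<in> seminorms X"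
    then obtain j m where jm: "r = WX.weighted_norm j m norm" unfolding seminorms_X by blast
    obtain M where M: "\<And>y. y \<in> N_set \<omega> \<nu> E DE j m f \<Longrightarrow> p y \<le> M"
      using bounded_in_bound[OF bounded_N_set[OF f, of j m] p] by blast
    have "r g \<le> M" if g: "g \<in> A" for g
    proof -
      obtain e' where e': "e' \<in> polar E p" "g = e' \<circ> f" using g by (auto simp: A_def)
      show ?thesis
        unfolding jm e'(2)
      proof (rule weighted_norm_dual_comp[OF f E.polar_seminorm_dual[OF p e'(1)]])
        fix y assume y: "y \<in> N_set \<omega> \<nu> E DE j m f"
        then have "y \<in> carrier E" using bounded_N_set[OF f] by (auto simp: bounded_in_def)
        then show "norm (e' y) \<le> M" using E.polar_bound[OF e'(1)] M[OF y] by force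
      qed
    qed
    then show "bdd_above (r ` A)" by (intro bdd_aboveI) auto
  qed
  then show ?thesis
    using X.absolutely_convex_bipolar[of A] X.semi_Montel_compact_bipolar[OF X] X.subset_bipolar[OF AX]
    by (intro exI[of _ "bipolar X A"]) (auto simp: A_def)
qed

end


section \<open>Surjectivity for complete \<open>E\<close>\<close>

context lcspace
begin

lemma limitin_seminorm:
  assumes l: "limitin (lcs_topology X) (\<lambda>y. y) l F" and p: "p \<in> seminorms X" and e: "e > 0"
  shows "eventually (\<lambda>y. y \<in> carrier X \<and> p (y - l) < e) F"
proof -
  have lX: "l \<in> carrier X" using l by (simp add: limitin_def)
  have "l \<in> {y \<in> carrier X. p (y - l) < e}" using lX p e by simp
  then have "eventually (\<lambda>y. y \<in> {y \<in> carrier X. p (y - l) < e}) F"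
    using l openin_ball[OF p lX, of e] unfolding limitin_def by blast
  then show ?thesis by simp
qed

text \<open>The infimum is the distance to \<open>G\<close>, i.e. the seminorm of the quotient by
  \<open>G\<close>. A functional bounded by it vanishes on \<open>G\<close>.\<close>

lemma seminorm_quotient:
  assumes p: "p \<in> seminorms X" and G: "subspace G" "G \<subseteq> carrier X"
  shows "seminorm_on (carrier X) (scale X) (\<lambda>x. INF g\<in>G. p (x - g))"
    and "x \<in> carrier X \<Longrightarrow> g \<in> G \<Longrightarrow> (INF g\<in>G. p (x - g)) \<le> p (x - g)"
proof -
  define q where "q x = (INF g\<in>G. p (x - g))" for x
  have G0: "0 \<in> G" using subspace_0[OF G(1)] .
  have q_le: "q x \<le> p (x - g)" if "x \<in> carrier X" "g \<in> G" for x g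
    unfolding q_def using that G(2) seminorm_nonneg[OF p]
    by (intro cINF_lower bdd_belowI[of _ 0]) auto
  have q_ge: "c \<le> q x" if "\<And>g. g \<in> G \<Longrightarrow> c \<le> p (x - g)" for c x
    unfolding q_def using G0 that by (intro cINF_greatest) auto
  have scl: "q (scale X c x) \<le> norm c * q x" if x: "x \<in> carrier X" for c x
  proof (cases "c = 0")
    case True
    then show ?thesis using q_le[OF carrier_zero G0] p by simp
  next
    case False
    have "q (scale X c x) / norm c \<le> q x"
    proof (rule q_ge)
      fix g assume g: "g \<in> G"
      have "q (scale X c x) \<le> p (scale X c x - scale X c g)"
        using x g by (intro q_le subspace_scale[OF G(1)]) auto
      also have "\<dots> = norm c * p (x - g)"
        using seminorm_scale[OF p, of "x - g" c] x g G(2) by (auto simp: scale_right_diff_distrib)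
      finally show "q (scale X c x) / norm c \<le> p (x - g)"
        using False by (simp add: field_simps)
    qed
    then show ?thesis using False by (simp add: field_simps)
  qed
  have "seminorm_on (carrier X) (scale X) q"
  proof (rule seminorm_onI[OF vector_space subspace _ scl])
    fix x y assume xy: "x \<in> carrier X" "y \<in> carrier X"
    have "q (x + y) - p (y - h) \<le> q x" if h: "h \<in> G" for h
    proof (rule q_ge)
      fix g assume g: "g \<in> G"
      have "q (x + y) \<le> p (x + y - (g + h))"
        using xy g h by (intro q_le subspace_add[OF G(1)]) auto
      also have "x + y - (g + h) = (x - g) + (y - h)" by simp
      also have "p \<dots> \<le> p (x - g) + p (y - h)"
        using xy g h G(2) by (intro seminorm_triangle[OF p]) auto
      finally show "q (x + y) - p (y - h) \<le> p (x - g)" by simp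
    qed
    then have "q (x + y) - q x \<le> q y"
      by (intro q_ge) (force simp: algebra_simps)
    then show "q (x + y) \<le> q x + q y" by simp
  qed
  then show "seminorm_on (carrier X) (scale X) (\<lambda>x. INF g\<in>G. p (x - g))"
    by (simp add: q_def[abs_def])
  show "x \<in> carrier X \<Longrightarrow> g \<in> G \<Longrightarrow> (INF g\<in>G. p (x - g)) \<le> p (x - g)"
    using q_le by (simp add: q_def)
qed

text \<open>If \<open>\<phi>\<close> had positive distance to \<open>G\<close>, Hahn-Banach for the
  distance seminorm would give a functional that vanishes on \<open>G\<close> but not at
  \<open>\<phi>\<close>. It is bounded by \<open>kappa_norm K\<close>, hence by
  \<open>Mackey_Arens\<close> the evaluation at some \<open>x\<close>. All of \<open>G\<close>
  vanishes at this \<open>x\<close>, so \<open>x = 0\<close> and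
  \<open>\<phi> x = 0\<close>.\<close>

lemma separating_subspace_dense:
  assumes G: "module.subspace (pointwise_scale (*)) G" "G \<subseteq> dual X"
    and sep: "\<And>x. x \<in> carrier X \<Longrightarrow> (\<And>\<phi>. \<phi> \<in> G \<Longrightarrow> \<phi> x = 0) \<Longrightarrow> x = 0"
    and K: "absolutely_convex X K" "compactin (lcs_topology X) K"
    and \<phi>: "\<phi> \<in> dual X" and e: "e > 0"
  shows "\<exists>\<theta>\<in>G. kappa_norm K (\<phi> - \<theta>) < e"
proof (rule ccontr)
  assume "\<not> ?thesis"
  then have far: "e \<le> kappa_norm K (\<phi> - \<theta>)" if "\<theta> \<in> G" for \<theta> using that by force
  interpret D: lcspace "kappa_dual X" by (rule lcspace_kappa_dual)
  have kn: "kappa_norm K \<in> seminorms (kappa_dual X)" using K by auto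
  have G': "D.subspace G" "G \<subseteq> carrier (kappa_dual X)" using G by simp_all
  define q where "q \<phi> = (INF \<theta>\<in>G. kappa_norm K (\<phi> - \<theta>))" for \<phi> :: "'v \<Rightarrow> 'k"
  have q: "seminorm_on (carrier (kappa_dual X)) (scale (kappa_dual X)) q"
    using D.seminorm_quotient(1)[OF kn G'] by (simp add: q_def[abs_def])
  have q_le: "q \<psi> \<le> kappa_norm K (\<psi> - \<theta>)" if "\<psi> \<in> dual X" "\<theta> \<in> G" for \<psi> \<theta>
    using D.seminorm_quotient(2)[OF kn G', of \<psi> \<theta>] that by (simp add: q_def)
  have G0: "0 \<in> G" using D.subspace_0[OF G'(1)] .
  have "e \<le> q \<phi>" unfolding q_def using G0 far by (intro cINF_greatest) auto
  have \<phi>': "\<phi> \<in> carrier (kappa_dual X)" using \<phi> by simp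
  obtain F where F: "linear_on (carrier (kappa_dual X)) (scale (kappa_dual X)) (*) F"
    "\<And>\<psi>. \<psi> \<in> carrier (kappa_dual X) \<Longrightarrow> norm (F \<psi>) \<le> q \<psi>" "norm (F \<phi>) = q \<phi>"
    using Hahn_Banach[OF D.vector_space D.subspace q \<phi>'] by blast
  have "norm (F \<psi>) \<le> 1 * kappa_norm K \<psi>" if "\<psi> \<in> dual X" for \<psi>
    using F(2)[of \<psi>] q_le[OF that G0] that by simp
  moreover have "linear_on (dual X) (pointwise_scale (*)) (*) F" using F(1) by simp
  ultimately obtain x where x: "x \<in> carrier X" "\<And>\<psi>. \<psi> \<in> dual X \<Longrightarrow> \<psi> x = F \<psi>"
    using Mackey_Arens[OF K, of F 1] zero_less_one by blast
  have "\<theta> x = 0" if \<theta>: "\<theta> \<in> G" for \<theta>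
  proof -
    have d: "\<theta> \<in> dual X" using \<theta> G(2) by blast
    have "norm (F \<theta>) \<le> q \<theta>" using F(2)[of \<theta>] d by simp
    also have "q \<theta> \<le> kappa_norm K (\<theta> - \<theta>)" by (rule q_le[OF d \<theta>])
    also have "\<dots> = 0" using D.seminorm_zero[OF kn] by simp
    finally show ?thesis using x(2)[OF d] by simp
  qed
  then have "x = 0" by (rule sep[OF x(1)])
  then have "\<phi> x = 0" using dual_diff[OF \<phi> x(1) x(1)] by simp
  then have "q \<phi> = 0" using x(2)[OF \<phi>] F(3) by simp
  then show False using \<open>e \<le> q \<phi>\<close> e by simp
qed

end

context epsilon_setting
begin

text \<open>Transposing \<open>e' \<mapsto> e' \<circ> f\<close> sends a functional on
  \<open>X\<close> to a linear form on the dual of \<open>E\<close>; this is the preimage of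
  \<open>E\<close> under that transpose, the part of the dual on which a \<open>u\<close> with
  \<open>S_map X u = f\<close> can be read off in \<open>E\<close>.\<close>

definition represented :: "('x \<Rightarrow> 'e) \<Rightarrow> (('x \<Rightarrow> 'k) \<Rightarrow> 'k) set" where
  "represented f = {\<phi> \<in> dual X. \<exists>y\<in>carrier E. \<forall>e'\<in>dual E. e' y = \<phi> (e' \<circ> f)}"

lemma represented_subspace: "module.subspace (pointwise_scale (*)) (represented f)"
proof -
  have "X'.subspace (represented f)"
    unfolding X'.subspace_def
  proof (intro conjI ballI allI)
    have "e' 0 = 0" if "e' \<in> dual E" for e'
      using E.dual_diff[OF that E.carrier_zero E.carrier_zero] by simp
    then show "0 \<in> represented f"
      using X.dual_zero by (auto simp: represented_def intro!: bexI[of _ 0])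
  next
    fix \<phi> \<psi> assume "\<phi> \<in> represented f" "\<psi> \<in> represented f"
    then obtain y z where "\<phi> \<in> dual X" "\<psi> \<in> dual X" "y \<in> carrier E" "z \<in> carrier E"
      "\<forall>e'\<in>dual E. e' y = \<phi> (e' \<circ> f)" "\<forall>e'\<in>dual E. e' z = \<psi> (e' \<circ> f)"
      by (auto simp: represented_def)
    then show "\<phi> + \<psi> \<in> represented f"
      using X.dual_plus E.dual_add by (auto simp: represented_def intro!: bexI[of _ "y + z"])
  next
    fix c \<phi> assume "\<phi> \<in> represented f"
    then obtain y where "\<phi> \<in> dual X" "y \<in> carrier E" "\<forall>e'\<in>dual E. e' y = \<phi> (e' \<circ> f)"
      by (auto simp: represented_def)
    then show "scale (kappa_dual X) c \<phi> \<in> represented f"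
      using X.dual_pointwise_scale E.dual_scale
      by (auto simp: represented_def pointwise_scale_def intro!: bexI[of _ "scale E c y"])
  qed
  then show ?thesis by simp
qed

lemma represented_separates:
  assumes f: "f \<in> carrier Z" and g: "g \<in> carrier X" "\<And>\<phi>. \<phi> \<in> represented f \<Longrightarrow> \<phi> g = 0"
  shows "g = 0"
proof
  fix x
  have "point_evaluation X x \<in> represented f"
    using point_evaluation_dual WZ.F_values[OF WZ.carrier_FV_F[OF f]] dual_comp_carrier[OF f]
    by (auto simp: represented_def intro!: bexI[of _ "f x"])
  from g(2)[OF this] g(1) show "g x = 0 x" by simp
qed

lemma represented_dense:
  assumes f: "f \<in> carrier Z" and K: "absolutely_convex X K" "compactin (lcs_topology X) K"
    and \<phi>: "\<phi> \<in> dual X" "\<epsilon> > 0"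
  shows "\<exists>\<theta>\<in>represented f. kappa_norm K (\<phi> - \<theta>) < \<epsilon>"
proof (rule X.separating_subspace_dense[OF represented_subspace _ _ K \<phi>])
  show "represented f \<subseteq> dual X" by (auto simp: represented_def)
qed (rule represented_separates[OF f])

lemma polar_rescale:
  assumes "p \<in> seminorms E" "C > 0" "e' \<in> dual E" "\<And>x. x \<in> carrier E \<Longrightarrow> norm (e' x) \<le> C * p x"
  shows "pointwise_scale (*) (of_real (1 / C)) e' \<in> polar E p"
proof -
  have "pointwise_scale (*) (of_real (1 / C)) e' \<in> dual E"
    using assms(3) by (rule E.dual_pointwise_scale)
  then show ?thesis
    using assms by (auto simp: polar_def E.dual_iff pointwise_scale_def norm_mult norm_divide field_simps)
qed

text \<open>Density on the compact set that contains all \<open>e' \<circ> f\<close> with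
  \<open>e'\<close> in a polar yields vectors of \<open>E\<close> approximating
  \<open>e' \<mapsto> \<phi> (e' \<circ> f)\<close> uniformly on that polar. As a seminorm is
  computed on its polar, these approximations form a Cauchy filter, and its limit represents
  \<open>\<phi>\<close>.\<close>

lemma represented_if_complete:
  assumes f: "f \<in> carrier Z" and X: "semi_Montel X" and E: "complete_lcs E" and \<phi>: "\<phi> \<in> dual X"
  shows "\<phi> \<in> represented f"
proof -
  define A where "A z = {y \<in> carrier E. \<forall>e'\<in>polar E (fst z). norm (e' y - \<phi> (e' \<circ> f)) < snd z}"
    for z :: "('e \<Rightarrow> real) \<times> real"
  define I :: "(('e \<Rightarrow> real) \<times> real) set" where "I = {z. fst z \<in> seminorms E \<and> snd z > 0}"
  have ne: "A z \<noteq> {}" if z: "z \<in> I" for z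
  proof -
    have p: "fst z \<in> seminorms E" "snd z > 0" using z by (auto simp: I_def)
    obtain K where K: "absolutely_convex X K" "compactin (lcs_topology X) K"
      "\<And>e'. e' \<in> polar E (fst z) \<Longrightarrow> e' \<circ> f \<in> K"
      using semi_Montel_polar_comp[OF f X p(1)] by blast
    obtain \<theta> where \<theta>: "\<theta> \<in> represented f" "kappa_norm K (\<phi> - \<theta>) < snd z"
      using represented_dense[OF f K(1,2) \<phi> p(2)] by blast
    then obtain y where y: "y \<in> carrier E" "\<forall>e'\<in>dual E. e' y = \<theta> (e' \<circ> f)" "\<theta> \<in> dual X"
      by (auto simp: represented_def)
    have "\<phi> - \<theta> \<in> dual X" using X'.carrier_diff \<phi> y(3) by simp
    then have "norm ((\<phi> - \<theta>) (e' \<circ> f)) < snd z" if "e' \<in> polar E (fst z)" for e'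
      using X.kappa_norm_upper[OF _ K(2) K(3)[OF that]] \<theta>(2) by force
    then have *: "norm (\<phi> (e' \<circ> f) - \<theta> (e' \<circ> f)) < snd z" if "e' \<in> polar E (fst z)" for e'
      using that by simp
    have "norm (e' y - \<phi> (e' \<circ> f)) < snd z" if "e' \<in> polar E (fst z)" for e'
      using y(2) E.polar_seminorm_dual[OF p(1) that] *[OF that]
        norm_minus_commute[of "\<theta> (e' \<circ> f)" "\<phi> (e' \<circ> f)"] by simp
    then show ?thesis using y(1) by (auto simp: A_def)
  qed
  \<comment> \<open>Scaling \<open>e'\<close> into the polar of \<open>p\<close> multiplies the
    error by \<open>C\<close>; this compares the sets \<open>A\<close> of different
    seminorms.\<close>
  have rescale: "norm (e' y - \<phi> (e' \<circ> f)) < C * \<epsilon>"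
    if p: "p \<in> seminorms E" "C > 0" "e' \<in> dual E" "\<And>x. x \<in> carrier E \<Longrightarrow> norm (e' x) \<le> C * p x" and y: "y \<in> A (p, \<epsilon>)"
    for p C e' y \<epsilon>
  proof -
    have "norm (of_real (1 / C) * e' y - \<phi> (pointwise_scale (*) (of_real (1 / C)) e' \<circ> f)) < \<epsilon>"
      using y polar_rescale[OF p] by (force simp: A_def pointwise_scale_def)
    also have "\<phi> (pointwise_scale (*) (of_real (1 / C)) e' \<circ> f) = of_real (1 / C) * \<phi> (e' \<circ> f)"
      unfolding dual_comp_scale using X.dual_scale[OF \<phi> dual_comp_carrier[OF f p(3)], of "of_real (1 / C)"] by simp
    finally have "norm (of_real (1 / C) * (e' y - \<phi> (e' \<circ> f))) < \<epsilon>"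
      unfolding right_diff_distrib .
    then show ?thesis using p(2) unfolding norm_mult norm_of_real by (simp add: field_simps)
  qed
  have Ine: "I \<noteq> {}"
  proof -
    obtain p where "p \<in> seminorms E" using E.seminorms_nonempty by blast
    then have "(p, 1) \<in> I" by (simp add: I_def)
    then show ?thesis by blast
  qed
  have base: "\<exists>c\<in>I. A c \<subseteq> A a \<inter> A b" if a: "a \<in> I" and b: "b \<in> I" for a b
  proof -
    have "finite {fst a, fst b}" "{fst a, fst b} \<subseteq> seminorms E" using a b by (auto simp: I_def)
    from E.directed_finite[OF this] obtain r C where r: "r \<in> seminorms E" "C > 0"
      "\<And>p x. p \<in> {fst a, fst b} \<Longrightarrow> x \<in> carrier E \<Longrightarrow> p x \<le> C * r x" by blast
    define d where "d = min (snd a) (snd b) / C"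
    have d: "d > 0" using a b r(2) by (auto simp: d_def I_def)
    have "A (r, d) \<subseteq> A z" if z: "z \<in> {a, b}" for z
    proof
      fix y assume y: "y \<in> A (r, d)"
      have "norm (e' y - \<phi> (e' \<circ> f)) < snd z" if e': "e' \<in> polar E (fst z)" for e'
      proof -
        have fz: "fst z \<in> seminorms E" using z a b by (auto simp: I_def)
        have "norm (e' x) \<le> C * r x" if x: "x \<in> carrier E" for x
          using E.polar_bound[OF e' x] r(3)[of "fst z" x] x z by force
        from rescale[OF r(1,2) E.polar_seminorm_dual[OF fz e'] this y]
        have "norm (e' y - \<phi> (e' \<circ> f)) < C * d" .
        also have "C * d \<le> snd z" using r(2) z by (auto simp: d_def)
        finally show ?thesis .
      qed
      then show "y \<in> A z" using y by (simp add: A_def)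
    qed
    then show ?thesis using r(1) d by (intro bexI[of _ "(r, d)"]) (auto simp: I_def)
  qed
  define F where "F = (INF z\<in>I. principal (A z))"
  have ev: "eventually P F \<longleftrightarrow> (\<exists>z\<in>I. \<forall>y\<in>A z. P y)" for P
  proof -
    have "eventually P F \<longleftrightarrow> (\<exists>z\<in>I. eventually P (principal (A z)))"
      unfolding F_def
    proof (rule eventually_INF_base[OF Ine])
      fix a b assume "a \<in> I" "b \<in> I"
      from base[OF this] show "\<exists>x\<in>I. principal (A x) \<le> inf (principal (A a)) (principal (A b))"
        by simp
    qed
    then show ?thesis by (simp add: eventually_principal)
  qed
  have "Cauchy_filter E F"
    unfolding Cauchy_filter_def
  proof (intro conjI ballI allI impI)
    show "F \<noteq> bot"
    proof
      assume "F = bot"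
      then have "eventually (\<lambda>y. False) F" by simp
      then show False unfolding ev using ne by blast
    qed
    show "eventually (\<lambda>y. y \<in> carrier E) F"
      unfolding ev using Ine by (auto simp: A_def)
    fix p and \<epsilon> :: real assume p: "p \<in> seminorms E" and \<epsilon>: "\<epsilon> > 0"
    have "(p, \<epsilon> / 2) \<in> I" using p \<epsilon> by (simp add: I_def)
    then have "eventually (\<lambda>y. y \<in> A (p, \<epsilon> / 2)) F" unfolding ev by blast
    moreover have "p (y - z) < \<epsilon>" if y: "y \<in> A (p, \<epsilon> / 2)" and z: "z \<in> A (p, \<epsilon> / 2)" for y z
    proof -
      have car: "y \<in> carrier E" "z \<in> carrier E" using y z by (auto simp: A_def)
      then have yz: "y - z \<in> carrier E" by blast
      obtain e' where e': "e' \<in> polar E p" "norm (e' (y - z)) = p (y - z)"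
        using E.polar_norming[OF p yz] by blast
      have "e' (y - z) = (e' y - \<phi> (e' \<circ> f)) - (e' z - \<phi> (e' \<circ> f))"
        using E.dual_diff[OF E.polar_seminorm_dual[OF p e'(1)] car] by simp
      then have "norm (e' (y - z)) \<le> norm (e' y - \<phi> (e' \<circ> f)) + norm (e' z - \<phi> (e' \<circ> f))"
        using norm_triangle_ineq4 by metis
      moreover have "norm (e' y - \<phi> (e' \<circ> f)) < \<epsilon> / 2" "norm (e' z - \<phi> (e' \<circ> f)) < \<epsilon> / 2"
        using y z e'(1) by (auto simp: A_def)
      ultimately show ?thesis using e'(2) by simp
    qed
    moreover have "A (p, \<epsilon> / 2) \<subseteq> carrier E" by (auto simp: A_def)
    ultimately show "\<exists>A\<subseteq>carrier E. eventually (\<lambda>x. x \<in> A) F \<and> (\<forall>x\<in>A. \<forall>y\<in>A. p (x - y) < \<epsilon>)"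
      by (intro exI[of _ "A (p, \<epsilon> / 2)"]) auto
  qed
  then obtain l where l: "limitin (lcs_topology E) (\<lambda>x. x) l F"
    using E unfolding complete_lcs_def by blast
  then have lE: "l \<in> carrier E" by (simp add: limitin_def)
  have "e' l = \<phi> (e' \<circ> f)" if e': "e' \<in> dual E" for e'
  proof (rule ccontr)
    assume neq: "e' l \<noteq> \<phi> (e' \<circ> f)"
    obtain r C where r: "r \<in> seminorms E" "C > 0" "\<And>x. x \<in> carrier E \<Longrightarrow> norm (e' x) \<le> C * r x"
      using E.dual_bound[OF e'] by blast
    \<comment> \<open>Chosen so that two errors of size \<open>C * \<epsilon>\<close> add up to
      exactly the supposed gap, while one of them is strict.\<close>
    define \<epsilon> where "\<epsilon> = norm (e' l - \<phi> (e' \<circ> f)) / (2 * C)"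
    have \<epsilon>: "\<epsilon> > 0" using neq r(2) by (simp add: \<epsilon>_def)
    obtain z where z: "z \<in> I" "\<And>y. y \<in> A z \<Longrightarrow> r (y - l) < \<epsilon>"
      using E.limitin_seminorm[OF l r(1) \<epsilon>] unfolding ev by auto
    have "(r, \<epsilon>) \<in> I" using r(1) \<epsilon> by (simp add: I_def)
    from base[OF z(1) this] obtain c where "c \<in> I" "A c \<subseteq> A z \<inter> A (r, \<epsilon>)" by blast
    then obtain y where y: "y \<in> A z" "y \<in> A (r, \<epsilon>)" using ne by blast
    have yE: "y \<in> carrier E" using y(1) by (auto simp: A_def)
    have "e' l - \<phi> (e' \<circ> f) = (e' y - \<phi> (e' \<circ> f)) - e' (y - l)"
      using E.dual_diff[OF e' yE lE] by simp
    then have "norm (e' l - \<phi> (e' \<circ> f)) \<le> norm (e' y - \<phi> (e' \<circ> f)) + norm (e' (y - l))"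
      using norm_triangle_ineq4 by metis
    also have "\<dots> < C * \<epsilon> + C * \<epsilon>"
    proof (rule add_less_le_mono)
      show "norm (e' y - \<phi> (e' \<circ> f)) < C * \<epsilon>" by (rule rescale[OF r(1,2) e' r(3) y(2)])
      have "norm (e' (y - l)) \<le> C * r (y - l)" using yE lE by (intro r(3)) blast
      also have "\<dots> \<le> C * \<epsilon>" using z(2)[OF y(1)] r(2) by simp
      finally show "norm (e' (y - l)) \<le> C * \<epsilon>" .
    qed
    also have "\<dots> = norm (e' l - \<phi> (e' \<circ> f))" using r(2) by (simp add: \<epsilon>_def)
    finally show False by simp
  qed
  then show ?thesis using \<phi> lE by (auto simp: represented_def)
qed

lemma surjective_if_represented:
  assumes f: "f \<in> carrier Z" and X: "semi_Montel X" and rep: "\<And>\<phi>. \<phi> \<in> dual X \<Longrightarrow> \<phi> \<in> represented f"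
  shows "f \<in> S_map X ` carrier XE"
  using semi_Montel_polar_comp[OF f X] rep by (intro in_range_S_map[OF f]) (auto simp: represented_def)

end


section \<open>Schwartz spaces and the Krein--Smulian theorem\<close>

context lcspace
begin

section \<open>Frechet-Schwartz spaces are semi-Montel\<close>

lemma metrizable_countable_seminorms:
  assumes "metrizable_space (lcs_topology X)"
  shows "\<exists>r :: nat \<Rightarrow> 'v \<Rightarrow> real. (\<forall>n. r n \<in> seminorms X) \<and>
    (\<forall>p\<in>seminorms X. \<exists>n. \<exists>C>0. \<forall>x\<in>carrier X. p x \<le> C * r n x)"
proof -
  obtain M d where Md: "Metric_space M d" "lcs_topology X = Metric_space.mtopology M d"
    using assms unfolding metrizable_space_def by blast
  interpret M: Metric_space M d by (rule Md(1))
  have M: "M = carrier X" using Md(2) M.topspace_mtopology topspace_lcs_topology by metis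
  \<comment> \<open>A seminorm ball is chosen inside each metric ball of radius
    \<open>1 / (n + 1)\<close> around 0. Seminorms are compared near 0 only, so any compatible
    metric serves.\<close>
  have "\<forall>n::nat. \<exists>r. r \<in> seminorms X \<and> (\<exists>e>0. {y \<in> carrier X. r y < e} \<subseteq> M.mball 0 (1 / (real n + 1)))"
  proof
    fix n :: nat
    have "openin (lcs_topology X) (M.mball 0 (1 / (real n + 1)))" unfolding Md(2) by (rule M.openin_mball)
    moreover have "0 \<in> M.mball 0 (1 / (real n + 1))"
      by (rule M.centre_in_mball_iff[THEN iffD2]) (simp add: M)
    ultimately have "\<exists>r\<in>seminorms X. \<exists>e>0. {y \<in> carrier X. r (y - 0) < e} \<subseteq> M.mball 0 (1 / (real n + 1))"
      unfolding openin_iff by blast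
    then show "\<exists>r. r \<in> seminorms X \<and> (\<exists>e>0. {y \<in> carrier X. r y < e} \<subseteq> M.mball 0 (1 / (real n + 1)))" by simp blast
  qed
  from choice[OF this] obtain r where
    r: "\<forall>n. r n \<in> seminorms X \<and> (\<exists>e>0. {y \<in> carrier X. r n y < e} \<subseteq> M.mball 0 (1 / (real n + 1)))" ..
  have "\<exists>n. \<exists>C>0. \<forall>x\<in>carrier X. p x \<le> C * r n x" if p: "p \<in> seminorms X" for p
  proof -
    have "openin M.mtopology {y \<in> carrier X. p (y - 0) < 1}"
      using openin_ball[OF p carrier_zero, of 1] unfolding Md(2) .
    moreover have "0 \<in> {y \<in> carrier X. p (y - 0) < 1}" using p by simp
    ultimately obtain \<epsilon> where \<epsilon>: "\<epsilon> > 0" "M.mball 0 \<epsilon> \<subseteq> {y \<in> carrier X. p (y - 0) < 1}"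
      unfolding M.openin_mtopology by blast
    obtain n :: nat where n: "1 / (real n + 1) < \<epsilon>"
      using \<epsilon>(1) reals_Archimedean[of \<epsilon>] by (auto simp: inverse_eq_divide add.commute)
    obtain e where e: "e > 0" "{y \<in> carrier X. r n y < e} \<subseteq> M.mball 0 (1 / (real n + 1))"
      using r by blast
    have "M.mball 0 (1 / (real n + 1)) \<subseteq> M.mball 0 \<epsilon>" using n by (intro M.mball_subset_concentric) simp
    then have sub: "{y \<in> carrier X. r n y < e} \<subseteq> {y \<in> carrier X. p (y - 0) < 1}"
      using e(2) \<epsilon>(2) by blast
    have "p x \<le> (2 * 1 / e) * r n x" if x: "x \<in> carrier X" for x
    proof (rule scaling_bound[OF _ e(1) _ _ _ x])
      show "r n \<in> seminorms X" using r by blast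
      show "p y \<le> 1" if "y \<in> carrier X" "r n y < e" for y
        using sub that by fastforce
      show "p (scale X (of_real t) y) = t * p y" if "t > 0" "y \<in> carrier X" for t y
        using seminorm_scale[OF p that(2), of "of_real t"] that(1) by simp
    qed simp
    moreover have "2 * 1 / e > 0" using e(1) by simp
    ultimately show ?thesis by blast
  qed
  then show ?thesis using r by blast
qed

text \<open>The Schwartz condition for the unit ball of \<open>p\<close>, with its neighbourhood
  shrunk to a ball of one seminorm. The order of quantifiers matters: \<open>s\<close> and
  \<open>d\<close> are fixed before the scale \<open>e\<close>.\<close>

lemma Schwartz_cover:
  assumes S: "Schwartz_space X" and p: "p \<in> seminorms X"
  shows "\<exists>s\<in>seminorms X. \<exists>d>0. \<forall>e>0. \<exists>A. finite A \<and> A \<subseteq> carrier X \<and>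
    (\<forall>x\<in>carrier X. s x < d \<longrightarrow> (\<exists>a\<in>A. \<exists>y\<in>carrier X. p y \<le> 1 \<and> x = a + scale X (of_real e) y))"
proof -
  define U where "U = {x \<in> carrier X. p x \<le> 1}"
  have "zero_neighbourhood X U"
  proof -
    have "{y \<in> carrier X. p (y - 0) < 1} \<subseteq> U" by (auto simp: U_def)
    then have "{y \<in> carrier X. p (y - 0) < 1} \<subseteq> lcs_topology X interior_of U"
      by (rule interior_of_maximal[OF _ openin_ball[OF p carrier_zero]])
    moreover have "0 \<in> {y \<in> carrier X. p (y - 0) < 1}" using p by simp
    ultimately show ?thesis unfolding zero_neighbourhood_def U_def by blast
  qed
  moreover have "absolutely_convex X U"
    unfolding absolutely_convex_def
  proof (intro conjI ballI allI impI)
    show "U \<noteq> {}" using p by (auto simp: U_def intro!: exI[of _ 0])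
    fix x y and a b :: 'k assume x: "x \<in> U" and y: "y \<in> U" and ab: "norm a + norm b \<le> 1"
    have "p (scale X a x + scale X b y) \<le> norm a * p x + norm b * p y"
      using seminorm_triangle[OF p, of "scale X a x" "scale X b y"] seminorm_scale[OF p] x y by (auto simp: U_def)
    also have "\<dots> \<le> norm a * 1 + norm b * 1"
      using x y by (intro add_mono mult_left_mono) (auto simp: U_def)
    finally show "scale X a x + scale X b y \<in> U" using ab x y by (auto simp: U_def)
  qed (auto simp: U_def)
  ultimately have "zero_neighbourhood X U \<and> absolutely_convex X U" ..
  from S[unfolded Schwartz_space_def, rule_format, OF this] obtain V where V': "zero_neighbourhood X V \<and>
    (\<forall>e>0. \<exists>A. finite A \<and> A \<subseteq> V \<and> V \<subseteq> (\<Union>a\<in>A. (\<lambda>y. a + scale X (of_real e) y) ` U))" ..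
  note V = conjunct1[OF V'] conjunct2[OF V', rule_format]
  obtain s d where s: "s \<in> seminorms X" "d > 0" "{y \<in> carrier X. s y < d} \<subseteq> V"
    using zero_neighbourhood_imp[OF V(1)] by blast
  have VX: "V \<subseteq> carrier X" using V(1) by (simp add: zero_neighbourhood_def)
  have "\<exists>A. finite A \<and> A \<subseteq> carrier X \<and>
      (\<forall>x\<in>carrier X. s x < d \<longrightarrow> (\<exists>a\<in>A. \<exists>y\<in>carrier X. p y \<le> 1 \<and> x = a + scale X (of_real e) y))"
    if e: "e > 0" for e
  proof -
    obtain A where A: "finite A" "A \<subseteq> V" "V \<subseteq> (\<Union>a\<in>A. (\<lambda>y. a + scale X (of_real e) y) ` U)"
      using V(2)[OF e] by blast
    have "\<exists>a\<in>A. \<exists>y\<in>carrier X. p y \<le> 1 \<and> x = a + scale X (of_real e) y" if x: "x \<in> carrier X" "s x < d" for x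
    proof -
      have "x \<in> V" using s(3) x by blast
      then have "x \<in> (\<Union>a\<in>A. (\<lambda>y. a + scale X (of_real e) y) ` U)" using A(3) by blast
      then show ?thesis by (auto simp: U_def)
    qed
    then show ?thesis using A(1,2) VX by blast
  qed
  then show ?thesis using s(1,2) by blast
qed

lemma Schwartz_totally_bounded:
  assumes S: "Schwartz_space X" and D: "bounded_in X D" and p: "p \<in> seminorms X" and e: "e > 0"
  shows "\<exists>A. finite A \<and> A \<subseteq> carrier X \<and> (\<forall>x\<in>D. \<exists>a\<in>A. p (x - a) < e)"
proof -
  obtain s d where s: "s \<in> seminorms X" "d > 0" and cover: "\<forall>e>0. \<exists>A. finite A \<and> A \<subseteq> carrier X \<and>
    (\<forall>x\<in>carrier X. s x < d \<longrightarrow> (\<exists>a\<in>A. \<exists>y\<in>carrier X. p y \<le> 1 \<and> x = a + scale X (of_real e) y))"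
    using Schwartz_cover[OF S p] by blast
  obtain M where M: "M > 0" "\<And>x. x \<in> D \<Longrightarrow> s x \<le> M"
    using bounded_in_bound[OF D s(1)] by blast
  \<comment> \<open>Dividing by \<open>t\<close> brings \<open>D\<close> into
    \<open>s \<le> d / 2\<close>. The cover is taken at scale \<open>e / (2 * t)\<close>, so that
    multiplying back by \<open>t\<close> leaves an error of at most \<open>e / 2\<close>.\<close>
  define t where "t = 2 * M / d"
  have t: "t > 0" using M(1) s(2) by (simp add: t_def)
  have "e / (2 * t) > 0" using e t by simp
  from cover[rule_format, OF this] obtain A where A': "finite A \<and> A \<subseteq> carrier X \<and> (\<forall>x\<in>carrier X. s x < d \<longrightarrow>
      (\<exists>a\<in>A. \<exists>y\<in>carrier X. p y \<le> 1 \<and> x = a + scale X (of_real (e / (2 * t))) y))" ..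
  note A = conjunct1[OF A'] conjunct1[OF conjunct2[OF A']] conjunct2[OF conjunct2[OF A'], rule_format]
  have "\<exists>a\<in>scale X (of_real t) ` A. p (x - a) < e" if x: "x \<in> D" for x
  proof -
    have xc: "x \<in> carrier X" using D x by (auto simp: bounded_in_def)
    have "s (scale X (of_real (1 / t)) x) = s x / t"
      using seminorm_scale[OF s(1) xc, of "of_real (1 / t)"] t by (simp add: norm_divide)
    also have "\<dots> \<le> M / t" using M(2)[OF x] t by (simp add: divide_right_mono)
    also have "\<dots> < d" using M(1) s(2) by (simp add: t_def)
    finally have "s (scale X (of_real (1 / t)) x) < d" .
    from A(3)[OF carrier_scale[OF xc] this] obtain a y where ay: "a \<in> A" "y \<in> carrier X" "p y \<le> 1"
      "scale X (of_real (1 / t)) x = a + scale X (of_real (e / (2 * t))) y"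
      by (elim bexE conjE)
    have "x = scale X (of_real t) (scale X (of_real (1 / t)) x)"
      using t by simp
    also have "\<dots> = scale X (of_real t) a + scale X (of_real (e / 2)) y"
      unfolding ay(4) using t by (simp add: scale_right_distrib)
    finally have "x - scale X (of_real t) a = scale X (of_real (e / 2)) y" by simp
    then have "p (x - scale X (of_real t) a) = e / 2 * p y"
      using seminorm_scale[OF p ay(2), of "of_real (e / 2)"] e by (simp add: norm_divide)
    also have "\<dots> < e" using ay(3) e by (simp add: field_simps)
    finally show ?thesis using ay(1) by blast
  qed
  then show ?thesis using A(1,2) by (intro exI[of _ "scale X (of_real t) ` A"]) auto
qed

text \<open>As in the proof of the Heine--Borel theorem, a closed set without a finite subcover contains a
  decreasing sequence of such sets whose diameters tend to zero with respect to every seminorm.\<close>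

lemma totally_bounded_closed_compact:
  assumes r: "\<And>n. r n \<in> seminorms X"
    and base: "\<And>p. p \<in> seminorms X \<Longrightarrow> \<exists>n. \<exists>C>0. \<forall>x\<in>carrier X. p x \<le> C * r (n::nat) x"
    and complete: "complete_lcs X" and closed: "closedin (lcs_topology X) D"
    and tb: "\<And>p e. p \<in> seminorms X \<Longrightarrow> e > 0 \<Longrightarrow> \<exists>A. finite A \<and> A \<subseteq> carrier X \<and> (\<forall>x\<in>D. \<exists>a\<in>A. p (x - a) < e)"
  shows "compactin (lcs_topology X) D"
proof (rule ccontr)
  assume not: "\<not> compactin (lcs_topology X) D"
  have DX: "D \<subseteq> carrier X" using closedin_subset[OF closed] by simp
  obtain \<U> where \<U>: "\<And>U. U \<in> \<U> \<Longrightarrow> openin (lcs_topology X) U" "D \<subseteq> \<Union>\<U>"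
    "\<not> (\<exists>\<F>. finite \<F> \<and> \<F> \<subseteq> \<U> \<and> D \<subseteq> \<Union>\<F>)"
    using not DX unfolding compactin_def by auto
  define bad where "bad S \<longleftrightarrow> S \<subseteq> D \<and> \<not> (\<exists>\<F>. finite \<F> \<and> \<F> \<subseteq> \<U> \<and> S \<subseteq> \<Union>\<F>)" for S
  have step: "\<exists>S'. bad S' \<and> (S' \<subseteq> S \<and> (\<forall>i\<le>n. \<forall>x\<in>S'. \<forall>y\<in>S'. r i (x - y) < 1 / (real n + 1)))"
    if S: "bad S" for S n
  proof -
    have "finite (r ` {..n})" "r ` {..n} \<subseteq> seminorms X" using r by auto
    from directed_finite[OF this] obtain s C where s: "s \<in> seminorms X" "C > 0"
      "\<And>p x. p \<in> r ` {..n} \<Longrightarrow> x \<in> carrier X \<Longrightarrow> p x \<le> C * s x" by blast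
    \<comment> \<open>Two points within \<open>e\<close> of one centre differ by less than
      \<open>2 * e\<close>, and \<open>C * (2 * e)\<close> is \<open>1 / (n + 1)\<close>.\<close>
    define e where "e = 1 / (2 * C * (real n + 1))"
    have e: "e > 0" using s(2) by (simp add: e_def)
    obtain A where A: "finite A" "A \<subseteq> carrier X" "\<And>x. x \<in> D \<Longrightarrow> \<exists>a\<in>A. s (x - a) < e"
      using tb[OF s(1) e] by blast
    define B where "B a = {x \<in> S. s (x - a) < e}" for a
    have "\<exists>a\<in>A. bad (B a)"
    proof (rule ccontr)
      assume "\<not> (\<exists>a\<in>A. bad (B a))"
      then have "\<forall>a\<in>A. \<exists>\<F>. finite \<F> \<and> \<F> \<subseteq> \<U> \<and> B a \<subseteq> \<Union>\<F>"
        using S by (auto simp: bad_def B_def)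
      from bchoice[OF this] obtain \<F> where \<F>: "\<forall>a\<in>A. finite (\<F> a) \<and> \<F> a \<subseteq> \<U> \<and> B a \<subseteq> \<Union>(\<F> a)" ..
      have "S \<subseteq> (\<Union>a\<in>A. B a)"
      proof
        fix x assume x: "x \<in> S"
        then have "x \<in> D" using S by (auto simp: bad_def)
        then obtain a where "a \<in> A" "s (x - a) < e" using A(3) by blast
        then show "x \<in> (\<Union>a\<in>A. B a)" using x by (auto simp: B_def)
      qed
      moreover have "B a \<subseteq> \<Union>(\<Union>(\<F> ` A))" if "a \<in> A" for a
      proof -
        have "B a \<subseteq> \<Union>(\<F> a)" using \<F> that by blast
        also have "\<dots> \<subseteq> \<Union>(\<Union>(\<F> ` A))" using that by blast
        finally show ?thesis .
      qed
      ultimately have "S \<subseteq> \<Union>(\<Union>(\<F> ` A))" by blast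
      moreover have "finite (\<Union>(\<F> ` A))" using A(1) \<F> by blast
      moreover have "\<Union>(\<F> ` A) \<subseteq> \<U>" using \<F> by blast
      ultimately show False using S unfolding bad_def by blast
    qed
    then obtain a where a: "a \<in> A" "bad (B a)" by blast
    have "r i (x - y) < 1 / (real n + 1)" if "i \<le> n" "x \<in> B a" "y \<in> B a" for i x y
    proof -
      have car: "x \<in> carrier X" "y \<in> carrier X" "a \<in> carrier X"
        using that S DX a(1) A(2) by (auto simp: bad_def B_def)
      have "r i (x - y) \<le> C * s (x - y)" using that(1) car by (intro s(3)) auto
      also have "s (x - y) \<le> s (x - a) + s (y - a)"
        using seminorm_triangle_diff[OF s(1) car(1,3,2)] seminorm_minus_commute[OF s(1) car(3,2)] by simp
      also have "\<dots> < e + e" using that by (intro add_strict_mono) (auto simp: B_def)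
      finally have "r i (x - y) < C * (e + e)" using s(2) by (simp add: mult_left_mono)
      also have "C * (e + e) = (2 * C) / ((2 * C) * (real n + 1))" by (simp add: e_def)
      also have "\<dots> = 1 / (real n + 1)" using s(2) by (intro nonzero_divide_mult_cancel_left) simp
      finally show ?thesis .
    qed
    then show ?thesis using a(2) by (intro exI[of _ "B a"]) (auto simp: B_def)
  qed
  have "bad D" using \<U>(3) by (simp add: bad_def)
  have "\<exists>S. \<forall>n. bad (S n) \<and> (S (Suc n) \<subseteq> S n \<and>
      (\<forall>i\<le>n. \<forall>x\<in>S (Suc n). \<forall>y\<in>S (Suc n). r i (x - y) < 1 / (real n + 1)))"
  proof (rule dependent_nat_choice[where P = "\<lambda>n S. bad S" and
      Q = "\<lambda>n S S'. S' \<subseteq> S \<and> (\<forall>i\<le>n. \<forall>x\<in>S'. \<forall>y\<in>S'. r i (x - y) < 1 / (real n + 1))"])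
    show "\<exists>S. bad S" using \<open>bad D\<close> ..
  qed (rule step)
  then obtain S where S': "\<forall>n. bad (S n) \<and> (S (Suc n) \<subseteq> S n \<and>
      (\<forall>i\<le>n. \<forall>x\<in>S (Suc n). \<forall>y\<in>S (Suc n). r i (x - y) < 1 / (real n + 1)))" ..
  have S: "bad (S n)" "S (Suc n) \<subseteq> S n \<and> (\<forall>i\<le>n. \<forall>x\<in>S (Suc n). \<forall>y\<in>S (Suc n). r i (x - y) < 1 / (real n + 1))" for n
    using spec[OF S', of n] by (rule conjunct1, rule conjunct2)
  have mono: "S n \<subseteq> S m" if "m \<le> n" for m n
    using that
  proof (induction rule: dec_induct)
    case (step k)
    then show ?case using conjunct1[OF S(2)[of k]] by simp
  qed simp
  have SD: "S n \<subseteq> D" for n using S(1) by (simp add: bad_def)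
  have "\<exists>x. x \<in> S n" for n
  proof (rule ccontr)
    assume "\<nexists>x. x \<in> S n"
    then have "finite {} \<and> {} \<subseteq> \<U> \<and> S n \<subseteq> \<Union>{}" by blast
    then show False using S(1)[of n] unfolding bad_def by blast
  qed
  then have "\<forall>n. \<exists>x. x \<in> S n" by blast
  from choice[OF this] obtain x where x: "\<forall>n. x n \<in> S n" ..
  \<comment> \<open>Stage \<open>n\<close> controls \<open>r i\<close> for all
    \<open>i \<le> n\<close>, so each fixed \<open>r k\<close> is controlled from stage
    \<open>k\<close> on. Taking \<open>n\<close> also beyond \<open>C / e\<close> brings the
    \<open>p\<close>-diameter of \<open>S (Suc n)\<close> below \<open>e\<close>.\<close>
  have small: "\<exists>N. \<forall>y\<in>S N. \<forall>z\<in>S N. p (y - z) < e" if p: "p \<in> seminorms X" and e: "e > 0" for p e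
  proof -
    obtain k C where C: "C > 0" "\<And>x. x \<in> carrier X \<Longrightarrow> p x \<le> C * r k x" using base[OF p] by blast
    obtain n0 :: nat where "C / e < real n0" using reals_Archimedean2 by blast
    then have n0: "C / e < real (max n0 k) + 1" by simp
    define n where "n = max n0 k"
    have "p (y - z) < e" if y: "y \<in> S (Suc n)" and z: "z \<in> S (Suc n)" for y z
    proof -
      have "y - z \<in> carrier X" using y z SD DX by blast
      then have "p (y - z) \<le> C * r k (y - z)" by (rule C(2))
      also have "\<dots> < C * (1 / (real n + 1))"
      proof -
        have "k \<le> n" by (simp add: n_def)
        then have "r k (y - z) < 1 / (real n + 1)" using S(2)[of n] y z by blast
        then show ?thesis using C(1) by (rule mult_strict_left_mono)
      qed
      also have "\<dots> < e"
      proof -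
        have "C < (real n + 1) * e" using n0 e unfolding n_def[symmetric] by (simp add: pos_divide_less_eq)
        then show ?thesis by (simp add: pos_divide_less_eq mult.commute)
      qed
      finally show ?thesis .
    qed
    then show ?thesis by blast
  qed
  have in_S: "eventually (\<lambda>n. x n \<in> S N) sequentially" for N
    unfolding eventually_sequentially using x mono by blast
  have "Cauchy_filter X (filtermap x sequentially)"
    unfolding Cauchy_filter_def
  proof (intro conjI ballI allI impI)
    show "filtermap x sequentially \<noteq> bot" by (simp add: filtermap_bot_iff)
    show "eventually (\<lambda>y. y \<in> carrier X) (filtermap x sequentially)"
      unfolding eventually_filtermap using x SD DX by (intro always_eventually allI) blast
    fix p and e :: real assume "p \<in> seminorms X" "e > 0"
    then obtain N where "\<forall>y\<in>S N. \<forall>z\<in>S N. p (y - z) < e" using small by blast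
    moreover have "S N \<subseteq> carrier X" using SD DX by blast
    ultimately show "\<exists>A\<subseteq>carrier X. eventually (\<lambda>y. y \<in> A) (filtermap x sequentially) \<and> (\<forall>y\<in>A. \<forall>z\<in>A. p (y - z) < e)"
      using in_S[of N] unfolding eventually_filtermap by blast
  qed
  then obtain l where l: "limitin (lcs_topology X) (\<lambda>y. y) l (filtermap x sequentially)"
    using complete unfolding complete_lcs_def by blast
  have "l \<in> D"
  proof (rule limitin_closedin[OF l closed])
    show "\<forall>\<^sub>F y in filtermap x sequentially. y \<in> D"
      unfolding eventually_filtermap using x SD by (intro always_eventually allI) blast
    show "filtermap x sequentially \<noteq> bot" by (simp add: filtermap_bot_iff)
  qed
  then obtain U where U: "U \<in> \<U>" "l \<in> U" using \<U>(2) by blast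
  have lX: "l \<in> carrier X" using \<open>l \<in> D\<close> DX by blast
  obtain p e where p: "p \<in> seminorms X" "e > 0" "{y \<in> carrier X. p (y - l) < e} \<subseteq> U"
    using \<U>(1)[OF U(1)] U(2) unfolding openin_iff by blast
  have e2: "e / 2 > 0" using p(2) by simp
  have ev: "eventually (\<lambda>n. x n \<in> carrier X \<and> p (x n - l) < e / 2) sequentially"
    using limitin_seminorm[OF l p(1) e2] unfolding eventually_filtermap .
  obtain N where N: "\<forall>y\<in>S N. \<forall>z\<in>S N. p (y - z) < e / 2" using small[OF p(1) e2] by blast
  obtain n where n: "x n \<in> S N" "x n \<in> carrier X" "p (x n - l) < e / 2"
    using eventually_conj[OF ev in_S[of N]] unfolding eventually_sequentially by blast
  \<comment> \<open>A single member of the cover then contains \<open>S N\<close>, which was to have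
    no finite subcover.\<close>
  have "S N \<subseteq> U"
  proof
    fix y assume y: "y \<in> S N"
    have yX: "y \<in> carrier X" using y SD DX by blast
    have "p (y - l) \<le> p (y - x n) + p (x n - l)"
      by (rule seminorm_triangle_diff[OF p(1) yX n(2) lX])
    also have "\<dots> < e / 2 + e / 2" using N y n(1,3) by (intro add_strict_mono) auto
    finally show "y \<in> U" using p(3) yX by auto
  qed
  then have "finite {U} \<and> {U} \<subseteq> \<U> \<and> S N \<subseteq> \<Union>{U}" using U(1) by simp
  then show False using S(1)[of N] unfolding bad_def by blast
qed

text \<open>In a complete metrizable space closed totally bounded sets are compact, and the Schwartz
  property makes bounded sets totally bounded. Both are applied to the bipolar of \<open>B\<close>,
  a closed bounded set in which the closure of \<open>B\<close> is a closed subset.\<close>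

lemma Frechet_Schwartz_semi_Montel:
  assumes "Frechet_Schwartz X"
  shows "semi_Montel X"
  unfolding semi_Montel_def
proof (intro allI impI)
  fix B assume B: "bounded_in X B"
  have FS: "metrizable_space (lcs_topology X)" "complete_lcs X" "Schwartz_space X"
    using assms by (simp_all add: Frechet_Schwartz_def)
  obtain r :: "nat \<Rightarrow> 'v \<Rightarrow> real" where r: "\<forall>n. r n \<in> seminorms X"
    "\<forall>p\<in>seminorms X. \<exists>n. \<exists>C>0. \<forall>x\<in>carrier X. p x \<le> C * r n x"
    using metrizable_countable_seminorms[OF FS(1)] by blast
  have "B \<subseteq> bipolar X B" using B by (intro subset_bipolar) (simp add: bounded_in_def)
  then have "lcs_topology X closure_of B \<subseteq> bipolar X B"
    by (rule closure_of_minimal[OF _ closedin_bipolar])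
  moreover have "compactin (lcs_topology X) (bipolar X B)"
  proof (rule totally_bounded_closed_compact[of r, OF _ _ FS(2) closedin_bipolar])
    fix p and e :: real assume "p \<in> seminorms X" "e > 0"
    then show "\<exists>A. finite A \<and> A \<subseteq> carrier X \<and> (\<forall>x\<in>bipolar X B. \<exists>a\<in>A. p (x - a) < e)"
      by (rule Schwartz_totally_bounded[OF FS(3) bounded_bipolar[OF B]])
  qed (use r in auto)
  ultimately show "compactin (lcs_topology X) (lcs_topology X closure_of B)"
    using closed_compactin closedin_closure_of by blast
qed

end

section \<open>The Krein-Smulian theorem\<close>

lemma closure_pointwise:
  fixes S :: "('a \<Rightarrow> 'b::metric_space) set"
  assumes \<phi>: "\<phi> \<in> closure S" and A: "finite A" and e: "e > 0"
  shows "\<exists>\<psi>\<in>S. \<forall>a\<in>A. dist (\<psi> a) (\<phi> a) < e"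
proof -
  define W where "W = (\<Inter>a\<in>A. {\<psi>::'a \<Rightarrow> 'b. dist (\<psi> a) (\<phi> a) < e})"
  have "open W"
    unfolding W_def
    using A by (intro open_INT ballI open_Collect_less continuous_intros continuous_on_product_coordinates) auto
  moreover have "\<phi> \<in> W" using e by (simp add: W_def)
  then have "W \<inter> closure S \<noteq> {}" using \<phi> by blast
  ultimately have "W \<inter> S \<noteq> {}" by (simp add: open_Int_closure_eq_empty)
  then obtain \<psi> where "\<psi> \<in> S" "\<psi> \<in> W" by blast
  then show ?thesis unfolding W_def by (intro bexI[of _ \<psi>]) auto
qed

context lcspace
begin

text \<open>The premise of the Krein-Smulian theorem: every dual functional that is a pointwise
  limit of members of \<open>G\<close> from one multiple of a polar lies in \<open>G\<close>.
  Weak-star adherence is spelled out by finite sets and tolerances.\<close>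

definition equicontinuously_closed :: "('v \<Rightarrow> 'k) set \<Rightarrow> bool" where
  "equicontinuously_closed G \<longleftrightarrow> (\<forall>\<psi>\<in>dual X. \<forall>s\<in>seminorms X. \<forall>C>0.
     (\<forall>A e. finite A \<longrightarrow> A \<subseteq> carrier X \<longrightarrow> e > 0 \<longrightarrow>
       (\<exists>\<theta>\<in>G \<inter> polar X (\<lambda>x. C * s x). \<forall>a\<in>A. norm (\<theta> a - \<psi> a) < e)) \<longrightarrow> \<psi> \<in> G)"

text \<open>Otherwise the functionals of \<open>\<phi> - G\<close> bounded by 1 on \<open>U \<union> T \<union> F\<close> would have the finite intersection
  property for the topology of pointwise convergence, and a common cluster point contradicts the last
  assumption.\<close>

lemma Krein_Smulian_step:
  assumes G: "module.subspace (pointwise_scale (*)) G" "G \<subseteq> dual X" and \<phi>: "\<phi> \<in> dual X"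
    and closed: "equicontinuously_closed G"
    and p: "p \<in> seminorms X" "C > 0"
    and U: "\<And>x. x \<in> carrier X \<Longrightarrow> C * p x \<le> 1 \<Longrightarrow> x \<in> U" and V: "V \<subseteq> carrier X" and T: "T \<subseteq> carrier X"
    and no: "\<And>\<theta>. \<theta> \<in> G \<Longrightarrow> \<exists>x\<in>V \<union> T. norm (\<phi> x - \<theta> x) > 1"
  shows "\<exists>F. finite F \<and> F \<subseteq> V \<and> (\<forall>\<theta>\<in>G. \<exists>x\<in>U \<union> (T \<union> F). norm (\<phi> x - \<theta> x) > 1)"
proof (rule ccontr)
  assume neg: "\<not> ?thesis"
  interpret D: lcspace "kappa_dual X" by (rule lcspace_kappa_dual)
  define Q where "Q F = {\<psi>. \<phi> - \<psi> \<in> G \<and> (\<forall>x\<in>U \<union> (T \<union> F). norm (\<psi> x) \<le> 1)}" for F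
  have Q_ne: "Q F \<noteq> {}" if "finite F" "F \<subseteq> V" for F
  proof -
    have "\<not> (\<forall>\<theta>\<in>G. \<exists>x\<in>U \<union> (T \<union> F). norm (\<phi> x - \<theta> x) > 1)" using neg that by blast
    then obtain \<theta> where \<theta>: "\<theta> \<in> G" "\<not> (\<exists>x\<in>U \<union> (T \<union> F). norm (\<phi> x - \<theta> x) > 1)" by blast
    have "norm (\<phi> x - \<theta> x) \<le> 1" if "x \<in> U \<union> (T \<union> F)" for x
      using \<theta>(2) that by (simp only: bex_simps not_less[symmetric]) blast
    then have "\<phi> - \<theta> \<in> Q F" using \<theta>(1) by (simp add: Q_def)
    then show ?thesis by blast
  qed
  have Q_dual: "\<psi> \<in> dual X" if "\<psi> \<in> Q F" for \<psi> F
  proof -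
    have "\<phi> - \<psi> \<in> dual X" using that G(2) by (auto simp: Q_def)
    then show ?thesis using D.carrier_diff[of \<phi> "\<phi> - \<psi>"] \<phi> by simp
  qed
  \<comment> \<open>The 2 is that of \<open>scaling_bound\<close>, applied to the ball
    \<open>p < 1 / C\<close>, which lies in \<open>U\<close>.\<close>
  define c where "c = 2 * C"
  have c: "c > 0" using p(2) by (simp add: c_def)
  have Q_polar: "Q F \<subseteq> polar X (\<lambda>x. c * p x)" for F
  proof
    fix \<psi> assume \<psi>: "\<psi> \<in> Q F"
    have d: "\<psi> \<in> dual X" by (rule Q_dual[OF \<psi>])
    have "norm (\<psi> x) \<le> (2 * 1 / (1 / C)) * p x" if x: "x \<in> carrier X" for x
    proof (rule scaling_bound[OF p(1) _ _ _ _ x])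
      show "norm (\<psi> y) \<le> 1" if "y \<in> carrier X" "p y < 1 / C" for y
      proof -
        have "y \<in> U" using U[OF that(1)] that(2) p(2) by (simp add: field_simps)
        then show ?thesis using \<psi> by (simp add: Q_def)
      qed
      show "norm (\<psi> (scale X (of_real t) y)) = t * norm (\<psi> y)" if "t > 0" "y \<in> carrier X" for t y
        using dual_scale[OF d that(2)] that(1) by (simp add: norm_mult)
    qed (use p(2) in auto)
    then show "\<psi> \<in> polar X (\<lambda>x. c * p x)"
      using dual_linear[OF d] dual_outside[OF d] by (simp add: polar_def c_def)
  qed
  have cp: "compact (polar X (\<lambda>x. c * p x))" by (rule compact_polar)
  have Q_mono: "Q F' \<subseteq> Q F" if "F \<subseteq> F'" for F F' using that by (auto simp: Q_def)
  have "polar X (\<lambda>x. c * p x) \<inter> \<Inter>{closure (Q F) |F. finite F \<and> F \<subseteq> V} \<noteq> {}"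
  proof (rule compact_imp_fip[OF cp])
    show "closed S" if "S \<in> {closure (Q F) |F. finite F \<and> F \<subseteq> V}" for S using that by auto
    fix \<F> assume \<F>: "finite \<F>" "\<F> \<subseteq> {closure (Q F) |F. finite F \<and> F \<subseteq> V}"
    have "\<F> \<subseteq> (\<lambda>F. closure (Q F)) ` {F. finite F \<and> F \<subseteq> V}" using \<F>(2) by blast
    from finite_subset_image[OF \<F>(1) this] obtain \<A> where
      \<A>: "\<A> \<subseteq> {F. finite F \<and> F \<subseteq> V}" "finite \<A>" "\<F> = (\<lambda>F. closure (Q F)) ` \<A>" by blast
    have "finite (\<Union>\<A>)" "\<Union>\<A> \<subseteq> V" using \<A> by auto
    from Q_ne[OF this] obtain \<psi> where \<psi>: "\<psi> \<in> Q (\<Union>\<A>)" by blast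
    have "\<psi> \<in> closure (Q F)" if "F \<in> \<A>" for F
      using Q_mono[of F "\<Union>\<A>"] \<psi> that closure_subset by blast
    then show "polar X (\<lambda>x. c * p x) \<inter> \<Inter>\<F> \<noteq> {}"
      using \<psi> Q_polar \<A>(3) by blast
  qed
  then obtain \<psi> where \<psi>: "\<psi> \<in> polar X (\<lambda>x. c * p x)" and cl: "\<And>F. finite F \<Longrightarrow> F \<subseteq> V \<Longrightarrow> \<psi> \<in> closure (Q F)"
    by blast
  have \<psi>d: "\<psi> \<in> dual X" by (rule polar_dual[OF p(1) c \<psi>])
  have \<psi>1: "norm (\<psi> x) \<le> 1" if x: "x \<in> V \<union> T" for x
  proof (rule field_le_epsilon)
    fix e :: real assume e: "e > 0"
    \<comment> \<open>If \<open>x\<close> is in \<open>V\<close>, putting it into \<open>F\<close>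
      forces the bound at \<open>x\<close>; if \<open>x\<close> is in \<open>T\<close>, the bound
      holds on every \<open>Q F\<close>.\<close>
    define F where "F = {x} \<inter> V"
    have "\<psi> \<in> closure (Q F)" by (intro cl) (auto simp: F_def)
    from closure_pointwise[OF this, of "{x}", OF _ e] obtain \<theta> where \<theta>: "\<theta> \<in> Q F" "dist (\<theta> x) (\<psi> x) < e" by auto
    have "norm (\<theta> x) \<le> 1" using \<theta>(1) x by (auto simp: Q_def F_def)
    moreover have "norm (\<psi> x) \<le> norm (\<theta> x) + dist (\<theta> x) (\<psi> x)"
      using norm_triangle_ineq4[of "\<theta> x" "\<theta> x - \<psi> x"] by (simp add: dist_norm)
    ultimately show "norm (\<psi> x) \<le> 1 + e" using \<theta>(2) by simp
  qed
  obtain p' C' where p': "p' \<in> seminorms X" "C' > 0" "\<And>x. x \<in> carrier X \<Longrightarrow> norm (\<phi> x) \<le> C' * p' x"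
    using dual_bound[OF \<phi>] by blast
  have "finite {p, p'}" "{p, p'} \<subseteq> seminorms X" using p p' by auto
  from directed_finite[OF this] obtain s B where s: "s \<in> seminorms X" "B > 0"
    "\<And>q x. q \<in> {p, p'} \<Longrightarrow> x \<in> carrier X \<Longrightarrow> q x \<le> B * s x" by blast
  \<comment> \<open>\<open>\<phi>\<close> is bounded by \<open>C' * B * s\<close> and the members of
    \<open>Q {}\<close> by \<open>c * B * s\<close>. Their differences thus stay in one multiple of
    the polar of \<open>s\<close>, as closedness requires for the conclusion that
    \<open>\<phi> - \<psi>\<close> is in \<open>G\<close>.\<close>
  have pos: "C' * B + c * B > 0" using p'(2) s(2) c by (intro add_pos_pos) auto
  have \<phi>\<psi>: "\<phi> - \<psi> \<in> dual X" using D.carrier_diff \<phi> \<psi>d by simp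
  have "\<forall>A e. finite A \<longrightarrow> A \<subseteq> carrier X \<longrightarrow> e > 0 \<longrightarrow>
    (\<exists>\<theta>\<in>G \<inter> polar X (\<lambda>x. (C' * B + c * B) * s x). \<forall>a\<in>A. norm (\<theta> a - (\<phi> - \<psi>) a) < e)"
  proof (intro allI impI)
    fix A and e :: real assume A: "finite A" "A \<subseteq> carrier X" "e > 0"
    have "\<psi> \<in> closure (Q {})" by (rule cl) auto
    from closure_pointwise[OF this A(1,3)] obtain \<theta> where
      \<theta>: "\<theta> \<in> Q {}" "\<And>a. a \<in> A \<Longrightarrow> dist (\<theta> a) (\<psi> a) < e" by blast
    have \<theta>p: "\<theta> \<in> polar X (\<lambda>x. c * p x)" using \<theta>(1) Q_polar by blast
    have d: "\<phi> - \<theta> \<in> dual X" using D.carrier_diff \<phi> Q_dual[OF \<theta>(1)] by simp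
    have "norm ((\<phi> - \<theta>) x) \<le> (C' * B + c * B) * s x" if x: "x \<in> carrier X" for x
    proof -
      have "norm (\<phi> x - \<theta> x) \<le> norm (\<phi> x) + norm (\<theta> x)" by (rule norm_triangle_ineq4)
      also have "\<dots> \<le> C' * p' x + c * p x" using p'(3)[OF x] polar_bound[OF \<theta>p x] by simp
      also have "\<dots> \<le> C' * (B * s x) + c * (B * s x)"
        using s(3)[of p x] s(3)[of p' x] x p'(2) c by (intro add_mono mult_left_mono) auto
      finally show ?thesis by (simp add: algebra_simps)
    qed
    then have "\<phi> - \<theta> \<in> polar X (\<lambda>x. (C' * B + c * B) * s x)"
      using dual_linear[OF d] dual_outside[OF d] by (simp add: polar_def)
    moreover have "\<phi> - \<theta> \<in> G" using \<theta>(1) by (simp add: Q_def)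
    moreover have "norm ((\<phi> - \<theta>) a - (\<phi> - \<psi>) a) < e" if "a \<in> A" for a
      using \<theta>(2)[OF that] by (simp add: dist_norm norm_minus_commute)
    ultimately show "\<exists>\<theta>\<in>G \<inter> polar X (\<lambda>x. (C' * B + c * B) * s x). \<forall>a\<in>A. norm (\<theta> a - (\<phi> - \<psi>) a) < e"
      by (intro bexI[of _ "\<phi> - \<theta>"]) auto
  qed
  with closed \<phi>\<psi> s(1) pos have "\<phi> - \<psi> \<in> G" unfolding equicontinuously_closed_def by blast
  \<comment> \<open>With \<open>\<theta> = \<phi> - \<psi>\<close> the difference
    \<open>\<phi> - \<theta>\<close> is \<open>\<psi>\<close>, which is bounded by 1 on
    \<open>V \<union> T\<close>.\<close>
  from no[OF this] obtain x where "x \<in> V \<union> T" "norm (\<phi> x - (\<phi> - \<psi>) x) > 1" by blast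
  then show False using \<psi>1[of x] by simp
qed

text \<open>The construction of Banach and Dieudonne. If \<open>\<phi>\<close> is outside
  \<open>G\<close>, finite sets are collected inside shrinking neighbourhoods \<open>U n\<close> so
  that at each stage no member of \<open>G\<close> is within 1 of \<open>\<phi>\<close> on
  \<open>U n \<union> T n\<close>. Their union \<open>N\<close> is bounded, so its bipolar is
  compact and density yields some \<open>\<theta>\<close> in \<open>G\<close> within 1 of
  \<open>\<phi>\<close> on \<open>N\<close>. By continuity \<open>\<phi> - \<theta>\<close> is also
  bounded by 1 on some \<open>U n\<close>, a contradiction.\<close>

lemma Krein_Smulian_separating:
  assumes r: "\<And>n. r n \<in> seminorms X"
    and base: "\<And>p. p \<in> seminorms X \<Longrightarrow> \<exists>n. \<exists>C>0. \<forall>x\<in>carrier X. p x \<le> C * r (n::nat) x"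
    and SM: "semi_Montel X"
    and G: "module.subspace (pointwise_scale (*)) G" "G \<subseteq> dual X"
    and sep: "\<And>x. x \<in> carrier X \<Longrightarrow> (\<And>\<phi>. \<phi> \<in> G \<Longrightarrow> \<phi> x = 0) \<Longrightarrow> x = 0"
    and closed: "equicontinuously_closed G"
    and \<phi>: "\<phi> \<in> dual X"
  shows "\<phi> \<in> G"
proof (rule ccontr)
  assume \<phi>G: "\<phi> \<notin> G"
  interpret D: lcspace "kappa_dual X" by (rule lcspace_kappa_dual)
  \<comment> \<open>Growing \<open>n\<close> both adds seminorms and shrinks the radius, so the
    \<open>U n\<close> become a base of neighbourhoods of 0. For \<open>n = 0\<close> no condition
    is left and \<open>U 0\<close> is the whole carrier, where the recursion starts with
    \<open>T 0\<close> empty.\<close>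
  define U where "U n = {x \<in> carrier X. \<forall>i<n. real n * r i x \<le> 1}" for n
  define P where "P n T \<longleftrightarrow> finite T \<and> T \<subseteq> carrier X \<and> (\<forall>\<theta>\<in>G. \<exists>x\<in>U n \<union> T. norm (\<phi> x - \<theta> x) > 1)" for n T
  have UX: "U n \<subseteq> carrier X" for n by (auto simp: U_def)
  have P0: "P 0 {}"
  proof -
    have "\<exists>x\<in>carrier X. norm (\<phi> x - \<theta> x) > 1" if \<theta>: "\<theta> \<in> G" for \<theta>
    proof (rule ccontr)
      assume "\<not> ?thesis"
      then have le: "norm (\<phi> x - \<theta> x) \<le> 1" if "x \<in> carrier X" for x using that by force
      have d: "\<theta> \<in> dual X" using \<theta> G(2) by blast
      have "\<phi> x = \<theta> x" for x
      proof (cases "x \<in> carrier X")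
        case True
        show ?thesis
        proof (rule ccontr)
          assume "\<phi> x \<noteq> \<theta> x"
          then have n: "norm (\<phi> x - \<theta> x) > 0" by simp
          \<comment> \<open>Scales the difference at \<open>x\<close> to norm 2, above the assumed
            bound 1.\<close>
          let ?t = "2 / norm (\<phi> x - \<theta> x)"
          have "\<phi> (scale X (of_real ?t) x) - \<theta> (scale X (of_real ?t) x) = of_real ?t * (\<phi> x - \<theta> x)"
            using dual_scale[OF \<phi> True] dual_scale[OF d True] by (simp add: right_diff_distrib)
          then have "norm (\<phi> (scale X (of_real ?t) x) - \<theta> (scale X (of_real ?t) x)) = 2"
            using n by (simp only: norm_mult norm_of_real) simp
          then show False using le[OF carrier_scale[OF True, of "of_real ?t"]] by simp
        qed
      next
        case False
        then show ?thesis using dual_outside[OF \<phi>] dual_outside[OF d] by simp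
      qed
      then have "\<phi> = \<theta>" by blast
      then show False using \<theta> \<phi>G by simp
    qed
    then show ?thesis by (simp add: P_def U_def)
  qed
  have step: "\<exists>T'. P (Suc n) T' \<and> (T \<subseteq> T' \<and> T' \<subseteq> T \<union> U n)" if T: "P n T" for T n
  proof -
    have "finite (r ` {..n})" "r ` {..n} \<subseteq> seminorms X" using r by auto
    from directed_finite[OF this] obtain s C where s: "s \<in> seminorms X" "C > 0"
      "\<And>p x. p \<in> r ` {..n} \<Longrightarrow> x \<in> carrier X \<Longrightarrow> p x \<le> C * s x" by blast
    have "\<exists>F. finite F \<and> F \<subseteq> U n \<and> (\<forall>\<theta>\<in>G. \<exists>x\<in>U (Suc n) \<union> (T \<union> F). norm (\<phi> x - \<theta> x) > 1)"
    proof (rule Krein_Smulian_step[OF G \<phi> closed s(1)])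
      show "real (Suc n) * C > 0" using s(2) by simp
      show "x \<in> U (Suc n)" if x: "x \<in> carrier X" "real (Suc n) * C * s x \<le> 1" for x
      proof -
        have "real (Suc n) * r i x \<le> 1" if "i < Suc n" for i
        proof -
          have "r i x \<le> C * s x" using that x(1) by (intro s(3)) auto
          then have "real (Suc n) * r i x \<le> real (Suc n) * (C * s x)" by (intro mult_left_mono) auto
          then show ?thesis using x(2) by (simp only: mult.assoc)
        qed
        then show ?thesis using x(1) by (simp add: U_def)
      qed
      show "\<exists>x\<in>U n \<union> T. norm (\<phi> x - \<theta> x) > 1" if "\<theta> \<in> G" for \<theta>
        using T that unfolding P_def by blast
      show "T \<subseteq> carrier X" using T unfolding P_def by blast
    qed (use UX in auto)
    then obtain F where F: "finite F" "F \<subseteq> U n" "\<forall>\<theta>\<in>G. \<exists>x\<in>U (Suc n) \<union> (T \<union> F). norm (\<phi> x - \<theta> x) > 1"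
      by blast
    have "P (Suc n) (T \<union> F)" using T F UX[of n] unfolding P_def by blast
    then show ?thesis using F(2) by blast
  qed
  have "\<exists>T. \<forall>n. P n (T n) \<and> (T n \<subseteq> T (Suc n) \<and> T (Suc n) \<subseteq> T n \<union> U n)"
  proof (rule dependent_nat_choice[where P = P and Q = "\<lambda>n T T'. T \<subseteq> T' \<and> T' \<subseteq> T \<union> U n"])
    show "\<exists>T. P 0 T" using P0 ..
  qed (rule step)
  then obtain T where T': "\<forall>n. P n (T n) \<and> (T n \<subseteq> T (Suc n) \<and> T (Suc n) \<subseteq> T n \<union> U n)" ..
  have T: "P n (T n)" "T n \<subseteq> T (Suc n)" "T (Suc n) \<subseteq> T n \<union> U n" for n using T' by simp_all
  define N where "N = (\<Union>n. T n)"
  have NX: "N \<subseteq> carrier X" using T(1) by (auto simp: N_def P_def)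
  have "bounded_in X N"
    unfolding bounded_in_def
  proof (intro conjI NX ballI)
    fix p assume p: "p \<in> seminorms X"
    obtain k C where C: "C > 0" "\<And>x. x \<in> carrier X \<Longrightarrow> p x \<le> C * r k x" using base[OF p] by blast
    \<comment> \<open>Points added after stage \<open>Suc k\<close> lie in some \<open>U n\<close>
      with \<open>n > k\<close>, where \<open>r k \<le> 1\<close> and so \<open>p \<le> C\<close>.
      All but finitely many points of \<open>N\<close> satisfy this bound.\<close>
    have "T n \<subseteq> T (Suc k) \<union> {x \<in> carrier X. p x \<le> C}" for n
    proof (induction n)
      case 0
      have "T 0 \<subseteq> T m" for m using T(2) by (induction m) blast+
      then show ?case by blast
    next
      case (Suc n)
      show ?case
      proof (cases "n \<le> k")
        case True
        have "T n' \<subseteq> T m" if "n' \<le> m" for n' m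
          using that
        proof (induction rule: dec_induct)
          case (step i)
          then show ?case using T(2)[of i] by blast
        qed simp
        then show ?thesis using True by (meson Suc_le_mono le_supI1)
      next
        case False
        have "p x \<le> C" if x: "x \<in> U n" for x
        proof -
          have xc: "x \<in> carrier X" using x UX by blast
          have "real n * r k x \<le> 1" using x False by (simp add: U_def)
          moreover have "r k x \<le> real n * r k x"
          proof -
            have "1 * r k x \<le> real n * r k x"
              using False seminorm_nonneg[OF r xc] by (intro mult_right_mono) auto
            then show ?thesis by simp
          qed
          ultimately have "r k x \<le> 1" by simp
          then have "C * r k x \<le> C * 1" using C(1) by (intro mult_left_mono) auto
          then show ?thesis using C(2)[OF xc] by simp
        qed
        then show ?thesis using Suc T(3)[of n] UX[of n] by blast
      qed
    qed
    then have sub: "N \<subseteq> T (Suc k) \<union> {x \<in> carrier X. p x \<le> C}" unfolding N_def by blast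
    have fin: "finite (T (Suc k))" using T(1) by (simp add: P_def)
    have "p x \<le> max C (Max (insert 0 (p ` T (Suc k))))" if "x \<in> N" for x
    proof (cases "x \<in> T (Suc k)")
      case True
      then have "p x \<le> Max (insert 0 (p ` T (Suc k)))" using fin by (intro Max_ge) auto
      then show ?thesis by simp
    next
      case False
      then have "p x \<le> C" using sub that by blast
      then show ?thesis by simp
    qed
    then show "bdd_above (p ` N)" by (intro bdd_aboveI) auto
  qed
  then have K: "compactin (lcs_topology X) (bipolar X N)" by (rule semi_Montel_compact_bipolar[OF SM])
  obtain \<theta> where \<theta>: "\<theta> \<in> G" "kappa_norm (bipolar X N) (\<phi> - \<theta>) < 1"
    using separating_subspace_dense[OF G sep absolutely_convex_bipolar K \<phi> zero_less_one] by blast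
  have \<theta>d: "\<theta> \<in> dual X" using \<theta>(1) G(2) by blast
  have d: "\<phi> - \<theta> \<in> dual X" using D.carrier_diff \<phi> \<theta>d by simp
  have le1: "norm (\<phi> x - \<theta> x) \<le> 1" if x: "x \<in> N" for x
  proof -
    have "x \<in> bipolar X N" using x subset_bipolar[OF NX] by blast
    from kappa_norm_upper[OF d K this] \<theta>(2) show ?thesis by simp
  qed
  obtain p B where p: "p \<in> seminorms X" "B > 0" "\<And>x. x \<in> carrier X \<Longrightarrow> norm ((\<phi> - \<theta>) x) \<le> B * p x"
    using dual_bound[OF d] by blast
  obtain k C where C: "C > 0" "\<And>x. x \<in> carrier X \<Longrightarrow> p x \<le> C * r k x" using base[OF p(1)] by blast
  obtain n0 :: nat where n0: "B * C < real n0" using reals_Archimedean2 by blast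
  \<comment> \<open>\<open>n > k\<close> makes \<open>r k\<close> one of the seminorms in
    \<open>U n\<close>, and \<open>n \<ge> B * C\<close> absorbs the constants in the bound of
    \<open>\<phi> - \<theta>\<close>.\<close>
  define n where "n = max n0 (Suc k)"
  have n: "B * C \<le> real n" "k < n" using n0 by (auto simp: n_def)
  have "norm (\<phi> x - \<theta> x) \<le> 1" if x: "x \<in> U n" for x
  proof -
    have xc: "x \<in> carrier X" using x UX by blast
    have "norm (\<phi> x - \<theta> x) \<le> B * p x" using p(3)[OF xc] by simp
    also have "\<dots> \<le> B * (C * r k x)" using C(2)[OF xc] p(2) by simp
    also have "\<dots> = B * C * r k x" by simp
    also have "\<dots> \<le> real n * r k x" using n(1) seminorm_nonneg[OF r xc] by (intro mult_right_mono)
    also have "\<dots> \<le> 1" using x n(2) by (simp add: U_def)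
    finally show ?thesis .
  qed
  moreover have "norm (\<phi> x - \<theta> x) \<le> 1" if "x \<in> T n" for x using le1[of x] that by (auto simp: N_def)
  ultimately have "\<not> (\<exists>x\<in>U n \<union> T n. norm (\<phi> x - \<theta> x) > 1)" by (auto simp: not_less)
  then show False using T(1)[of n] \<theta>(1) unfolding P_def by blast
qed

end


section \<open>Surjectivity for locally complete \<open>E\<close>\<close>

context lcspace
begin

section \<open>Gauges and spans of discs\<close>

lemma gauge_le:
  assumes "t > 0" "z \<in> scale X (of_real t) ` D" shows "gauge_of X D z \<le> t"
  unfolding gauge_of_def using assms by (intro cInf_lower bdd_belowI[of _ 0]) auto

text \<open>The span of \<open>D\<close> is a union of natural multiples, while estimates produce
  real factors; \<open>t * D\<close> lies in \<open>n * D\<close> for \<open>n > t\<close> because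
  \<open>D\<close> is balanced.\<close>

lemma scale_subset_span:
  assumes D: "absolutely_convex X D" and t: "t > 0" and z: "z \<in> scale X (of_real t) ` D"
  shows "z \<in> (\<Union>n::nat. scale X (of_nat n) ` D)"
proof -
  obtain x where x: "x \<in> D" "z = scale X (of_real t) x" using z by blast
  obtain n :: nat where n: "t < real n" using reals_Archimedean2 by blast
  have n0: "real n > 0" using n t by linarith
  have "norm (of_real (t / real n) :: 'k) \<le> 1" unfolding norm_of_real using n t n0 by simp
  then have "scale X (of_real (t / real n)) x \<in> D" by (rule absolutely_convex_scale[OF D x(1)])
  moreover have "z = scale X (of_nat n) (scale X (of_real (t / real n)) x)"
  proof -
    have "of_nat n * of_real (t / real n) = (of_real (real n * (t / real n)) :: 'k)" by simp
    also have "real n * (t / real n) = t" using n0 by simp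
    finally show ?thesis by (simp only: x(2) scale_scale)
  qed
  ultimately show ?thesis by blast
qed

text \<open>A bound \<open>M\<close> on \<open>D\<close> becomes \<open>M * t\<close> on
  \<open>t * D\<close>, and the gauge is the infimum of the admissible \<open>t\<close>. Convergence
  in the gauge therefore implies convergence under every functional that is bounded on
  \<open>D\<close>.\<close>

lemma dual_le_gauge:
  assumes D: "absolutely_convex X D" and \<phi>: "\<phi> \<in> dual X" and M: "M > 0" "\<And>x. x \<in> D \<Longrightarrow> norm (\<phi> x) \<le> M"
    and z: "z \<in> (\<Union>n::nat. scale X (of_nat n) ` D)"
  shows "norm (\<phi> z) \<le> M * gauge_of X D z"
proof -
  have DX: "D \<subseteq> carrier X" using D by (simp add: absolutely_convex_def)
  obtain n :: nat and x where x: "x \<in> D" "z = scale X (of_nat n) x" using z by blast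
  \<comment> \<open>The infimum has to run over a nonempty set; for \<open>n = 0\<close> the vector
    is 0 and the factor 1 is admissible.\<close>
  have ne: "{t. 0 < t \<and> z \<in> scale X (of_real t) ` D} \<noteq> {}"
  proof (cases "n = 0")
    case True
    then have "z = scale X (of_real 1) 0" using x(2) by simp
    then show ?thesis using absolutely_convex_zero[OF D] zero_less_one by blast
  next
    case False
    then have "0 < real n" "z = scale X (of_real (real n)) x" using x(2) by simp_all
    then show ?thesis using x(1) by blast
  qed
  have "norm (\<phi> z) / M \<le> t" if "t \<in> {t. 0 < t \<and> z \<in> scale X (of_real t) ` D}" for t
  proof -
    from that have t: "t > 0" and "z \<in> scale X (of_real t) ` D" by auto
    then obtain y where y: "y \<in> D" "z = scale X (of_real t) y" by blast
    have "norm (\<phi> z) = t * norm (\<phi> y)"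
      using dual_scale[OF \<phi>, of y "of_real t"] y DX t by (auto simp: norm_mult)
    also have "\<dots> \<le> t * M" using M(2)[OF y(1)] t by simp
    finally show ?thesis using M(1) by (simp add: pos_divide_le_eq)
  qed
  then have "norm (\<phi> z) / M \<le> gauge_of X D z"
    unfolding gauge_of_def by (rule cInf_greatest[OF ne])
  then show ?thesis using M(1) by (simp add: pos_divide_le_eq mult.commute)
qed

text \<open>Turns an estimate that holds for every functional into membership in a dilated bipolar,
  and so bounds of functionals on \<open>X\<close> into gauge bounds of their representing
  vectors.\<close>

lemma bipolar_scaleI:
  assumes z: "z \<in> carrier X" and t: "t > 0"
    and le: "\<And>\<phi> c. \<phi> \<in> dual X \<Longrightarrow> c \<ge> 0 \<Longrightarrow> (\<And>y. y \<in> N \<Longrightarrow> norm (\<phi> y) \<le> c) \<Longrightarrow> norm (\<phi> z) \<le> t * c"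
  shows "z \<in> scale X (of_real t) ` bipolar X N"
proof -
  have "norm (\<phi> (scale X (of_real (1 / t)) z)) \<le> c"
    if \<phi>: "\<phi> \<in> dual X" and c: "c \<ge> 0" "\<forall>y\<in>N. norm (\<phi> y) \<le> c" for \<phi> c
  proof -
    have "norm (\<phi> (scale X (of_real (1 / t)) z)) = norm (\<phi> z) / t"
      using dual_scale[OF \<phi> z, of "of_real (1 / t)"] t by (simp add: norm_divide)
    also have "\<dots> \<le> c" using le[OF \<phi> c(1)] c(2) t by (simp add: pos_divide_le_eq mult.commute)
    finally show ?thesis .
  qed
  then have "scale X (of_real (1 / t)) z \<in> bipolar X N"
    unfolding bipolar_def using z by blast
  moreover have "z = scale X (of_real t) (scale X (of_real (1 / t)) z)" using t by simp
  ultimately show ?thesis by blast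
qed

end

context epsilon_setting
begin

text \<open>Adherence gives approximation at finitely many points only. The finite cover of a
  Schwartz space upgrades it to uniform approximation on a neighbourhood of 0, so a sequence
  \<open>\<theta> k\<close> with a rate can be extracted. The dictionary between weighted seminorms
  and \<open>N_set\<close> transfers the rate to the representing vectors, measured by the gauge of
  the bipolar \<open>D\<close> of \<open>N_set\<close>.\<close>

lemma represented_equicontinuously_closed:
  assumes f: "f \<in> carrier Z" and S: "Schwartz_space X" and E: "locally_complete E"
  shows "X.equicontinuously_closed (represented f)"
  unfolding X.equicontinuously_closed_def
proof (intro ballI allI impI)
  fix \<psi> s and C :: real
  assume \<psi>: "\<psi> \<in> dual X" and s: "s \<in> seminorms X" and C: "C > 0"
    and adh: "\<forall>A e. finite A \<longrightarrow> A \<subseteq> carrier X \<longrightarrow> e > 0 \<longrightarrow>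
      (\<exists>\<theta>\<in>represented f \<inter> polar X (\<lambda>x. C * s x). \<forall>a\<in>A. norm (\<theta> a - \<psi> a) < e)"
  have \<psi>_le: "norm (\<psi> x) \<le> C * s x" if x: "x \<in> carrier X" for x
  proof (rule field_le_epsilon)
    fix e :: real assume e: "e > 0"
    have "finite {x}" "{x} \<subseteq> carrier X" using x by auto
    from adh[rule_format, OF this e] obtain \<theta> where
      \<theta>: "\<theta> \<in> polar X (\<lambda>x. C * s x)" "norm (\<theta> x - \<psi> x) < e" by blast
    have "norm (\<psi> x) \<le> norm (\<theta> x) + norm (\<theta> x - \<psi> x)"
      using norm_triangle_ineq4[of "\<theta> x" "\<theta> x - \<psi> x"] by simp
    then show "norm (\<psi> x) \<le> C * s x + e" using X.polar_bound[OF \<theta>(1) x] \<theta>(2) by simp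
  qed
  obtain s' d where s': "s' \<in> seminorms X" "d > 0" and cover: "\<forall>e>0. \<exists>A. finite A \<and> A \<subseteq> carrier X \<and>
    (\<forall>x\<in>carrier X. s' x < d \<longrightarrow> (\<exists>a\<in>A. \<exists>y\<in>carrier X. s y \<le> 1 \<and> x = a + scale X (of_real e) y))"
    using X.Schwartz_cover[OF S s] by blast
  define \<epsilon> where "\<epsilon> k = 1 / (real k + 1)" for k :: nat
  have \<epsilon>: "\<epsilon> k > 0" for k by (simp add: \<epsilon>_def)
  have "\<forall>k. \<exists>\<theta>. \<theta> \<in> represented f \<inter> polar X (\<lambda>x. C * s x) \<and>
      (\<forall>x\<in>carrier X. s' x < d \<longrightarrow> norm (\<theta> x - \<psi> x) \<le> (1 + 2 * C) * \<epsilon> k)"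
  proof
    fix k
    from cover[rule_format, OF \<epsilon>[of k]] obtain A where A': "finite A \<and> A \<subseteq> carrier X \<and>
      (\<forall>x\<in>carrier X. s' x < d \<longrightarrow> (\<exists>a\<in>A. \<exists>y\<in>carrier X. s y \<le> 1 \<and> x = a + scale X (of_real (\<epsilon> k)) y))" ..
    note A = conjunct1[OF A'] conjunct1[OF conjunct2[OF A']] conjunct2[OF conjunct2[OF A'], rule_format]
    from adh[rule_format, OF A(1,2) \<epsilon>[of k]] obtain \<theta> where
      \<theta>: "\<theta> \<in> represented f \<inter> polar X (\<lambda>x. C * s x)" "\<forall>a\<in>A. norm (\<theta> a - \<psi> a) < \<epsilon> k" ..
    have \<theta>d: "\<theta> \<in> dual X" using \<theta>(1) by (simp add: represented_def)
    \<comment> \<open>The error at the centre \<open>a\<close> is \<open>\<epsilon> k\<close>; the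
      remainder is \<open>\<epsilon> k\<close> times \<open>\<theta> - \<psi>\<close> on the unit
      ball of \<open>s\<close>, where both functionals are at most \<open>C\<close>.\<close>
    have "norm (\<theta> x - \<psi> x) \<le> (1 + 2 * C) * \<epsilon> k" if x: "x \<in> carrier X" "s' x < d" for x
    proof -
      from A(3)[OF x] obtain a y where ay: "a \<in> A" "y \<in> carrier X" "s y \<le> 1" "x = a + scale X (of_real (\<epsilon> k)) y"
        by (elim bexE conjE)
      have aX: "a \<in> carrier X" using ay(1) A(2) by blast
      note sy = X.carrier_scale[OF ay(2), of "of_real (\<epsilon> k)"]
      have "\<theta> x - \<psi> x = (\<theta> a - \<psi> a) + of_real (\<epsilon> k) * (\<theta> y - \<psi> y)"
        unfolding ay(4) X.dual_add[OF \<theta>d aX sy] X.dual_add[OF \<psi> aX sy]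
          X.dual_scale[OF \<theta>d ay(2)] X.dual_scale[OF \<psi> ay(2)] by (simp add: algebra_simps)
      then have "norm (\<theta> x - \<psi> x) \<le> norm (\<theta> a - \<psi> a) + norm (of_real (\<epsilon> k) * (\<theta> y - \<psi> y))"
        by (simp only: norm_triangle_ineq)
      also have "\<dots> = norm (\<theta> a - \<psi> a) + \<epsilon> k * norm (\<theta> y - \<psi> y)"
        using \<epsilon>[of k] by (simp add: norm_mult)
      also have "\<dots> \<le> \<epsilon> k + \<epsilon> k * (2 * C)"
      proof (intro add_mono mult_left_mono)
        show "norm (\<theta> a - \<psi> a) \<le> \<epsilon> k" using \<theta>(2) ay(1) by force
        have "norm (\<theta> y) \<le> C * s y" using X.polar_bound[of \<theta> "\<lambda>x. C * s x", OF _ ay(2)] \<theta>(1) by simp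
        then have "norm (\<theta> y - \<psi> y) \<le> C * s y + C * s y"
          using norm_triangle_ineq4[of "\<theta> y" "\<psi> y"] \<psi>_le[OF ay(2)] by simp
        also have "C * s y \<le> C" using ay(3) C by simp
        finally show "norm (\<theta> y - \<psi> y) \<le> 2 * C" using \<open>C * s y \<le> C\<close> by simp
      qed (use \<epsilon>[of k] in simp)
      finally show ?thesis by (simp add: algebra_simps)
    qed
    then show "\<exists>\<theta>. \<theta> \<in> represented f \<inter> polar X (\<lambda>x. C * s x) \<and>
      (\<forall>x\<in>carrier X. s' x < d \<longrightarrow> norm (\<theta> x - \<psi> x) \<le> (1 + 2 * C) * \<epsilon> k)" using \<theta>(1) by blast
  qed
  from choice[OF this] obtain \<theta> where \<theta>': "\<forall>k. \<theta> k \<in> represented f \<inter> polar X (\<lambda>x. C * s x) \<and>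
      (\<forall>x\<in>carrier X. s' x < d \<longrightarrow> norm (\<theta> k x - \<psi> x) \<le> (1 + 2 * C) * \<epsilon> k)" ..
  have \<theta>r: "\<theta> k \<in> represented f" and \<theta>p: "\<theta> k \<in> polar X (\<lambda>x. C * s x)"
    and \<theta>s: "x \<in> carrier X \<Longrightarrow> s' x < d \<Longrightarrow> norm (\<theta> k x - \<psi> x) \<le> (1 + 2 * C) * \<epsilon> k" for k x
    using spec[OF \<theta>', of k] by simp_all
  have \<theta>d: "\<theta> k \<in> dual X" for k using \<theta>r[of k] by (simp add: represented_def)
  have "finite {s, s'}" "{s, s'} \<subseteq> seminorms X" using s s' by auto
  from X.directed_finite[OF this] obtain r B where r: "r \<in> seminorms X" "B > 0"
    "\<And>p x. p \<in> {s, s'} \<Longrightarrow> x \<in> carrier X \<Longrightarrow> p x \<le> B * r x" by blast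
  obtain j m where jm: "r = WX.weighted_norm j m norm" using r(1) unfolding seminorms_X by blast
  \<comment> \<open>The factor \<open>2 / d\<close> is that of \<open>scaling_bound\<close> for the
    ball \<open>s' < d\<close>, and \<open>B\<close> passes from \<open>s'\<close> to
    \<open>r\<close>.\<close>
  define \<delta> where "\<delta> k = 2 * ((1 + 2 * C) * \<epsilon> k) / d * B" for k
  have \<delta>: "\<delta> k > 0" for k using C \<epsilon>[of k] s'(2) r(2) by (simp add: \<delta>_def)
  have diff: "norm (\<theta> k x - \<psi> x) \<le> \<delta> k * r x" if x: "x \<in> carrier X" for k x
  proof -
    have nn: "(1 + 2 * C) * \<epsilon> k \<ge> 0" using C \<epsilon>[of k] by simp
    have "norm (\<theta> k x - \<psi> x) \<le> (2 * ((1 + 2 * C) * \<epsilon> k) / d) * s' x"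
    proof (rule X.scaling_bound[OF s' nn _ _ x])
      show "norm (\<theta> k (scale X (of_real t) y) - \<psi> (scale X (of_real t) y)) = t * norm (\<theta> k y - \<psi> y)"
        if "t > 0" "y \<in> carrier X" for t y
      proof -
        have "\<theta> k (scale X (of_real t) y) - \<psi> (scale X (of_real t) y) = of_real t * (\<theta> k y - \<psi> y)"
          unfolding X.dual_scale[OF \<theta>d that(2)] X.dual_scale[OF \<psi> that(2)] by (simp only: right_diff_distrib)
        then show ?thesis using that(1) by (simp add: norm_mult)
      qed
    qed (rule \<theta>s)
    also have "\<dots> \<le> (2 * ((1 + 2 * C) * \<epsilon> k) / d) * (B * r x)"
      using r(3)[of s' x] x nn s'(2) by (intro mult_left_mono) auto
    finally show ?thesis by (simp add: \<delta>_def)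
  qed
  have \<theta>_le: "norm (\<theta> k x) \<le> (C * B) * r x" if x: "x \<in> carrier X" for k x
  proof -
    have "norm (\<theta> k x) \<le> C * s x" by (rule X.polar_bound[OF \<theta>p x])
    also have "\<dots> \<le> C * (B * r x)" using r(3)[of s x] x C by simp
    finally show ?thesis by simp
  qed
  have "\<forall>k. \<exists>y. y \<in> carrier E \<and> (\<forall>e'\<in>dual E. e' y = \<theta> k (e' \<circ> f))"
    using \<theta>r by (auto simp: represented_def)
  from choice[OF this] obtain y where y': "\<forall>k. y k \<in> carrier E \<and> (\<forall>e'\<in>dual E. e' (y k) = \<theta> k (e' \<circ> f))" ..
  have yE: "y k \<in> carrier E" and y: "e' \<in> dual E \<Longrightarrow> e' (y k) = \<theta> k (e' \<circ> f)" for k e'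
    using spec[OF y', of k] by simp_all
  define N where "N = N_set \<omega> \<nu> E DE j m f"
  define D where "D = bipolar E N"
  have Nb: "bounded_in E N" unfolding N_def by (rule bounded_N_set[OF f])
  have Dac: "absolutely_convex E D" unfolding D_def by (rule E.absolutely_convex_bipolar)
  have Db: "bounded_in E D" unfolding D_def by (rule E.bounded_bipolar[OF Nb])
  define L where "L = (\<Union>n::nat. scale E (of_nat n) ` D)"
  have Ban: "Banach_space_on L (scale E) (gauge_of E D)"
  proof -
    have "closedin (lcs_topology E) D \<and> bounded_in E D \<and> absolutely_convex E D"
      using E.closedin_bipolar[of N] Db Dac by (simp add: D_def)
    from E[unfolded locally_complete_def, rule_format, OF this] show ?thesis
      unfolding L_def .
  qed
  have LE: "L \<subseteq> carrier E" using Dac by (auto simp: L_def absolutely_convex_def)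
  have r_le: "r (e' \<circ> f) \<le> c" if "e' \<in> dual E" "\<And>y. y \<in> N \<Longrightarrow> norm (e' y) \<le> c" for e' c
    unfolding jm using that(2) unfolding N_def by (rule weighted_norm_dual_comp[OF f that(1)])
  \<comment> \<open>The bound of the \<open>\<theta> k\<close> by \<open>(C * B) * r\<close> puts
    every \<open>y k\<close> into the same dilate of \<open>D\<close>, so that the whole sequence
    lives in one Banach space.\<close>
  have yL: "y k \<in> L" for k
    unfolding L_def
  proof (rule E.scale_subset_span[OF Dac])
    show pos: "C * B > 0" using C r(2) by simp
    show "y k \<in> scale E (of_real (C * B)) ` D"
      unfolding D_def
    proof (rule E.bipolar_scaleI[OF yE pos])
      fix e' c assume e': "e' \<in> dual E" and c: "\<And>y. y \<in> N \<Longrightarrow> norm (e' y) \<le> c"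
      have "norm (e' (y k)) \<le> (C * B) * r (e' \<circ> f)"
        unfolding y[OF e'] by (rule \<theta>_le[OF dual_comp_carrier[OF f e']])
      also have "\<dots> \<le> (C * B) * c" using r_le[OF e' c] pos by (intro mult_left_mono) auto
      finally show "norm (e' (y k)) \<le> C * B * c" .
    qed
  qed
  \<comment> \<open>\<open>\<psi>\<close> cancels from the difference of two approximations, so the
    rates towards \<open>\<psi>\<close> give a Cauchy estimate before any vector representing
    \<open>\<psi>\<close> is at hand.\<close>
  have gauge: "gauge_of E D (y k - y l) \<le> \<delta> k + \<delta> l" for k l
  proof (rule E.gauge_le)
    show pos: "\<delta> k + \<delta> l > 0" using \<delta> by (intro add_pos_pos)
    show "y k - y l \<in> scale E (of_real (\<delta> k + \<delta> l)) ` D"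
      unfolding D_def
    proof (rule E.bipolar_scaleI[OF E.carrier_diff[OF yE yE] pos])
      fix e' c assume e': "e' \<in> dual E" and c: "\<And>y. y \<in> N \<Longrightarrow> norm (e' y) \<le> c"
      note ef = dual_comp_carrier[OF f e']
      have "e' (y k - y l) = (\<theta> k (e' \<circ> f) - \<psi> (e' \<circ> f)) - (\<theta> l (e' \<circ> f) - \<psi> (e' \<circ> f))"
        unfolding E.dual_diff[OF e' yE yE] y[OF e'] by simp
      then have "norm (e' (y k - y l)) \<le> norm (\<theta> k (e' \<circ> f) - \<psi> (e' \<circ> f)) + norm (\<theta> l (e' \<circ> f) - \<psi> (e' \<circ> f))"
        by (simp only: norm_triangle_ineq4)
      also have "\<dots> \<le> \<delta> k * r (e' \<circ> f) + \<delta> l * r (e' \<circ> f)"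
        using diff[OF ef] by (intro add_mono)
      also have "\<dots> = (\<delta> k + \<delta> l) * r (e' \<circ> f)" by (simp only: distrib_right)
      also have "\<dots> \<le> (\<delta> k + \<delta> l) * c" using r_le[OF e' c] pos by (intro mult_left_mono) auto
      finally show "norm (e' (y k - y l)) \<le> (\<delta> k + \<delta> l) * c" .
    qed
  qed
  have \<delta>0: "\<delta> \<longlonglongrightarrow> 0"
  proof -
    have "\<epsilon> \<longlonglongrightarrow> 0"
      using LIMSEQ_Suc[OF lim_inverse_n'] by (simp add: \<epsilon>_def[abs_def] add.commute)
    from tendsto_mult_left[OF this, of "2 * (1 + 2 * C) / d * B"]
    have "(\<lambda>k. (2 * (1 + 2 * C) / d * B) * \<epsilon> k) \<longlonglongrightarrow> 0" by simp
    moreover have "\<delta> = (\<lambda>k. (2 * (1 + 2 * C) / d * B) * \<epsilon> k)"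
      by (rule ext) (simp add: \<delta>_def)
    ultimately show ?thesis by simp
  qed
  have Cauchy: "\<forall>e>0. \<exists>M. \<forall>k\<ge>M. \<forall>l\<ge>M. gauge_of E D (y k - y l) < e"
  proof (intro allI impI)
    fix e :: real assume "e > 0"
    then have "eventually (\<lambda>k. \<delta> k < e / 2) sequentially"
      using \<delta>0 by (intro order_tendstoD(2)) auto
    then obtain M where M: "\<And>k. k \<ge> M \<Longrightarrow> \<delta> k < e / 2" unfolding eventually_sequentially by blast
    have "gauge_of E D (y k - y l) < e" if "k \<ge> M" "l \<ge> M" for k l
      using gauge[of k l] M[OF that(1)] M[OF that(2)] by simp
    then show "\<exists>M. \<forall>k\<ge>M. \<forall>l\<ge>M. gauge_of E D (y k - y l) < e" by blast
  qed
  have "\<forall>\<sigma>::nat \<Rightarrow> 'e. (\<forall>n. \<sigma> n \<in> L) \<and>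
      (\<forall>e>0. \<exists>M. \<forall>k\<ge>M. \<forall>l\<ge>M. gauge_of E D (\<sigma> k - \<sigma> l) < e) \<longrightarrow>
      (\<exists>l\<in>L. (\<lambda>n. gauge_of E D (\<sigma> n - l)) \<longlonglongrightarrow> 0)"
    using Ban unfolding Banach_space_on_def by (elim conjE)
  from this[rule_format, OF conjI, OF allI[OF yL] Cauchy]
  obtain l where l: "l \<in> L" "(\<lambda>n. gauge_of E D (y n - l)) \<longlonglongrightarrow> 0" by (elim bexE)
  have lE: "l \<in> carrier E" using l(1) LE by blast
  have subL: "E.subspace L" using Ban unfolding Banach_space_on_def by blast
  \<comment> \<open>The numbers \<open>e' (y n)\<close> have two limits to be identified:
    \<open>e' l\<close> because \<open>e'\<close> is bounded by a multiple of the gauge, and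
    \<open>\<psi> (e' \<circ> f)\<close> because \<open>\<theta> n\<close> tends to
    \<open>\<psi>\<close> at the rate \<open>\<delta> n\<close>.\<close>
  have "e' l = \<psi> (e' \<circ> f)" if e': "e' \<in> dual E" for e'
  proof -
    have "bdd_above ((\<lambda>x. norm (e' x)) ` D)" by (rule E.dual_bounded_on[OF e' Db])
    then obtain M where "\<forall>z\<in>(\<lambda>x. norm (e' x)) ` D. z \<le> M" unfolding bdd_above_def ..
    then have M: "norm (e' x) \<le> max M 1" if "x \<in> D" for x using that by force
    have le: "norm (e' (y n) - e' l) \<le> max M 1 * gauge_of E D (y n - l)" for n
    proof -
      have "y n - l \<in> (\<Union>n::nat. scale E (of_nat n) ` D)"
        using E.subspace_diff[OF subL yL l(1)] by (simp add: L_def)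
      from E.dual_le_gauge[OF Dac e' _ M this] show ?thesis
        by (simp add: E.dual_diff[OF e' yE lE])
    qed
    have "(\<lambda>n. max M 1 * gauge_of E D (y n - l)) \<longlonglongrightarrow> 0"
      using tendsto_mult_left[OF l(2), of "max M 1"] unfolding mult_zero_right .
    with always_eventually[OF allI[OF le]] have "(\<lambda>n. e' (y n) - e' l) \<longlonglongrightarrow> 0"
      by (rule Lim_null_comparison)
    then have lim1: "(\<lambda>n. e' (y n)) \<longlonglongrightarrow> e' l" by (simp add: LIM_zero_iff)
    have le': "norm (e' (y n) - \<psi> (e' \<circ> f)) \<le> \<delta> n * r (e' \<circ> f)" for n
      unfolding y[OF e'] by (rule diff[OF dual_comp_carrier[OF f e']])
    have "(\<lambda>n. \<delta> n * r (e' \<circ> f)) \<longlonglongrightarrow> 0"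
      using tendsto_mult_right[OF \<delta>0, of "r (e' \<circ> f)"] unfolding mult_zero_left .
    with always_eventually[OF allI[OF le']] have "(\<lambda>n. e' (y n) - \<psi> (e' \<circ> f)) \<longlonglongrightarrow> 0"
      by (rule Lim_null_comparison)
    then have "(\<lambda>n. e' (y n)) \<longlonglongrightarrow> \<psi> (e' \<circ> f)" by (simp add: LIM_zero_iff)
    then show ?thesis by (rule LIMSEQ_unique[OF lim1])
  qed
  then show "\<psi> \<in> represented f" using \<psi> lE by (auto simp: represented_def)
qed

lemma represented_if_Frechet_Schwartz:
  assumes f: "f \<in> carrier Z" and FS: "Frechet_Schwartz X" and E: "locally_complete E" and \<phi>: "\<phi> \<in> dual X"
  shows "\<phi> \<in> represented f"
proof -
  have "metrizable_space (lcs_topology X)" "Schwartz_space X"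
    using FS by (simp_all add: Frechet_Schwartz_def)
  from X.metrizable_countable_seminorms[OF this(1)] obtain r :: "nat \<Rightarrow> ('x \<Rightarrow> 'k) \<Rightarrow> real" where
    r: "(\<forall>n. r n \<in> seminorms X) \<and> (\<forall>p\<in>seminorms X. \<exists>n. \<exists>C>0. \<forall>x\<in>carrier X. p x \<le> C * r n x)" ..
  show ?thesis
  proof (rule X.Krein_Smulian_separating[OF _ _ _ represented_subspace _ represented_separates[OF f]
        represented_equicontinuously_closed[OF f \<open>Schwartz_space X\<close> E] \<phi>])
    show "r n \<in> seminorms X" for n using r by blast
    show "\<exists>n. \<exists>C>0. \<forall>x\<in>carrier X. p x \<le> C * r n x" if "p \<in> seminorms X" for p using r that by blast
    show "semi_Montel X" by (rule X.Frechet_Schwartz_semi_Montel[OF FS])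
    show "represented f \<subseteq> dual X" by (auto simp: represented_def)
  qed
qed

end

theorem corollary3p2p5:
  fixes E :: "('k::real_or_complex, 'e::ab_group_add) lcs"
    and \<omega> :: "'m \<Rightarrow> 'w set"
    and \<nu> :: "'j \<Rightarrow> 'm \<Rightarrow> 'w \<Rightarrow> real"
    and DE :: "('x, 'w, 'm, 'e) operator_data"
    and DK :: "('x, 'w, 'm, 'k) operator_data"
  assumes "lcHs E"
    and "generator \<omega> \<nu> E DE DK"
    and "strong \<omega> \<nu> E DE DK"
    and "consistent \<omega> \<nu> E DE DK"
    and "(semi_Montel (FV_space \<omega> \<nu> scalars DK) \<and> complete_lcs E) \<or>
         (Frechet_Schwartz (FV_space \<omega> \<nu> scalars DK) \<and> locally_complete E) \<or>
         semi_Montel E \<or>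
         (\<forall>f\<in>carrier (FV_space \<omega> \<nu> E DE). \<forall>j m. \<exists>K. absolutely_convex E K \<and>
            compactin (lcs_topology E) K \<and> N_set \<omega> \<nu> E DE j m f \<subseteq> K)"
  shows "eps_compatible (FV_space \<omega> \<nu> scalars DK) E (FV_space \<omega> \<nu> E DE) \<and>
         lcs_isomorphic (FV_space \<omega> \<nu> E DE) (eps_product (FV_space \<omega> \<nu> scalars DK) E)"
proof -
  interpret epsilon_setting E \<omega> \<nu> DE DK
    using assms(1-4) by unfold_locales
  show ?thesis
    unfolding eps_compatible_def
  proof (rule isomorphism_if_surjective)
    fix f assume f: "f \<in> carrier Z"
    from assms(5) show "f \<in> S_map X ` carrier XE"
    proof (elim disjE conjE)
      assume "semi_Montel X" "complete_lcs E"
      then show ?thesis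
        using surjective_if_represented[OF f] represented_if_complete[OF f] by blast
    next
      assume FS: "Frechet_Schwartz X" and E: "locally_complete E"
      show ?thesis
        by (rule surjective_if_represented[OF f X.Frechet_Schwartz_semi_Montel[OF FS]
              represented_if_Frechet_Schwartz[OF f FS E]])
    next
      assume "semi_Montel E"
      then show ?thesis by (rule surjective_semi_Montel_range[OF f])
    next
      assume "\<forall>f\<in>carrier Z. \<forall>j m. \<exists>K. absolutely_convex E K \<and>
        compactin (lcs_topology E) K \<and> N_set \<omega> \<nu> E DE j m f \<subseteq> K"
      then show ?thesis using f by (intro surjective_compact_range[OF f]) blast
    qed
  qed
qed

end
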